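(* (a) Let $X$ be a Banach space such that $\mathcal{B}(X)$ has a character. Let $Z$ be any non-zero Banach space. Then there is a continuous, injective algebra homomorphism $\phi\colon\mathcal{B}(X)\to\mathcal{B}(X\oplus Z)$ with $\phi(I_X)=I_{X\oplus Z}$ which maps rank one operators into rank one operators but $\phi$ is not surjective. (b) In particular, let $X$ be the $p$-th James space $\mathcal{J}_p$ (where $1<p<\infty$) or the Semadeni space $C[0,\omega_1]$. Then there is a continuous, injective algebra homomorphism $\phi\colon\mathcal{B}(X)\to\mathcal{B}(X)$ with $\phi(I_X)=I_X$ which maps rank one operators into rank one operators but $\phi$ is not surjective.
   Context: All Banach spaces are complex. $\mathcal{B}(X)$ is the Banach algebra of bounded linear operators on $X$, and $I_X$ is the identity operator on $X$. $X\oplus Z$ is the direct sum of the Banach spaces $X$ and $Z$. A character of a unital Banach algebra is a non-zero multiplicative linear functional into $\mathbb{C}$. For $1<p<\infty$, the James space $\mathcal{J}_p$ is the space of scalar sequences $x=(x_n)_{n\in\mathbb{N}}\in c_0$ with finite $p$-variation, i.e. with $\sup\big(\sum_{j=1}^{k-1}|x_{n_{j+1}}-x_{n_j}|^p\big)^{1/p}<\infty$, where the supremum is over all $k\geq 2$ and $n_1<\dots<n_k$, and this supremum is the norm (up to equivalence). $C[0,\omega_1]$ is the space of continuous complex-valued functions, with the supremum norm, on the ordinal interval $[0,\omega_1]$ with the order topology, where $\omega_1$ is the first uncountable ordinal.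
   Formalization: In (a) it is additionally assumed that dim X ≠ 1: if dim X = 1, then B(X) has a character and I_X has rank one, but φ(I_X) = I_{X⊕Z} has rank at least 2, so the claim fails for every non-zero Z. *)

theory Defs
  imports "HOL-Analysis.Analysis" "HOL-Library.Function_Algebras"
begin

section \<open>Complex Banach spaces\<close>

text \<open>
  The James spaces depend on a real parameter, so Banach spaces cannot all be types. A space is
  given by a subspace of an ambient complex vector space together with a norm on that subspace.
  The values of the norm outside the carrier are irrelevant.
\<close>

record 'a cnspace =
  carr :: "'a set"
  scl :: "complex \<Rightarrow> 'a \<Rightarrow> 'a"
  nrm :: "'a \<Rightarrow> real"

text \<open>
  The locale \<^locale>\<open>Metric_space\<close> requires symmetry and non-negativity of the distance on the
  whole type, whence the case distinction.
\<close>

definition ndist :: "('a::ab_group_add, 'm) cnspace_scheme \<Rightarrow> 'a \<Rightarrow> 'a \<Rightarrow> real" where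
  "ndist X x y = (if x \<in> carr X \<and> y \<in> carr X then nrm X (x - y) else 0)"

definition ntop :: "('a::ab_group_add, 'm) cnspace_scheme \<Rightarrow> 'a topology" where
  "ntop X = Metric_space.mtopology (carr X) (ndist X)"

text \<open>This is 0 on infinite-dimensional subspaces.\<close>

abbreviation cdim :: "('a::ab_group_add, 'm) cnspace_scheme \<Rightarrow> 'a set \<Rightarrow> nat" where
  "cdim X \<equiv> vector_space.dim (scl X)"

locale complex_banach_space =
  fixes X :: "('a::ab_group_add, 'm) cnspace_scheme"
  assumes vector_space: "vector_space (scl X)"
    and subspace: "module.subspace (scl X) (carr X)"
    and norm_nonneg: "x \<in> carr X \<Longrightarrow> 0 \<le> nrm X x"
    and norm_eq_0_iff: "x \<in> carr X \<Longrightarrow> nrm X x = 0 \<longleftrightarrow> x = 0"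
    and norm_scl: "x \<in> carr X \<Longrightarrow> nrm X (scl X c x) = cmod c * nrm X x"
    and norm_triangle: "\<lbrakk>x \<in> carr X; y \<in> carr X\<rbrakk> \<Longrightarrow> nrm X (x + y) \<le> nrm X x + nrm X y"
    and complete: "Metric_space.mcomplete (carr X) (ndist X)"

definition direct_sum ::
    "'a::ab_group_add cnspace \<Rightarrow> 'b::ab_group_add cnspace \<Rightarrow> ('a \<times> 'b) cnspace" where
  "direct_sum X Z =
    \<lparr> carr = carr X \<times> carr Z,
      scl = (\<lambda>c (x, z). (scl X c x, scl Z c z)),
      nrm = (\<lambda>(x, z). nrm X x + nrm Z z) \<rparr>"


section \<open>Unital algebras and algebras of bounded operators\<close>

record 'a cnalgebra = "'a cnspace" +
  mul :: "'a \<Rightarrow> 'a \<Rightarrow> 'a"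
  unt :: 'a

definition character :: "'a::ab_group_add cnalgebra \<Rightarrow> ('a \<Rightarrow> complex) \<Rightarrow> bool" where
  "character A \<psi> \<longleftrightarrow>
    (\<forall>S\<in>carr A. \<forall>T\<in>carr A. \<psi> (S + T) = \<psi> S + \<psi> T) \<and>
    (\<forall>c. \<forall>T\<in>carr A. \<psi> (scl A c T) = c * \<psi> T) \<and>
    (\<forall>S\<in>carr A. \<forall>T\<in>carr A. \<psi> (mul A S T) = \<psi> S * \<psi> T) \<and>
    (\<exists>T\<in>carr A. \<psi> T \<noteq> 0)"

definition algebra_hom ::
    "'a::ab_group_add cnalgebra \<Rightarrow> 'b::ab_group_add cnalgebra \<Rightarrow> ('a \<Rightarrow> 'b) \<Rightarrow> bool" where
  "algebra_hom A B \<phi> \<longleftrightarrow>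
    \<phi> ` carr A \<subseteq> carr B \<and>
    (\<forall>S\<in>carr A. \<forall>T\<in>carr A. \<phi> (S + T) = \<phi> S + \<phi> T) \<and>
    (\<forall>c. \<forall>T\<in>carr A. \<phi> (scl A c T) = scl B c (\<phi> T)) \<and>
    (\<forall>S\<in>carr A. \<forall>T\<in>carr A. \<phi> (mul A S T) = mul B (\<phi> S) (\<phi> T))"

text \<open>
  An operator on \<open>X\<close> is represented by its extension by 0 to the ambient type, so that equality of
  operators is equality of functions and sums are pointwise.
\<close>

definition bounded_operators :: "'a::ab_group_add cnspace \<Rightarrow> ('a \<Rightarrow> 'a) set" where
  "bounded_operators X =
    {T. (\<forall>x\<in>carr X. T x \<in> carr X) \<and>
        (\<forall>x\<in>carr X. \<forall>y\<in>carr X. T (x + y) = T x + T y) \<and>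
        (\<forall>c. \<forall>x\<in>carr X. T (scl X c x) = scl X c (T x)) \<and>
        (\<exists>K. \<forall>x\<in>carr X. nrm X (T x) \<le> K * nrm X x) \<and>
        (\<forall>x. x \<notin> carr X \<longrightarrow> T x = 0)}"

definition operator_algebra :: "'a::ab_group_add cnspace \<Rightarrow> ('a \<Rightarrow> 'a) cnalgebra" ("\<B>") where
  "\<B> X =
    \<lparr> carr = bounded_operators X,
      scl = (\<lambda>c T x. scl X c (T x)),
      nrm = (\<lambda>T. SUP x\<in>{x \<in> carr X. nrm X x \<le> 1}. nrm X (T x)),
      mul = (\<circ>),
      unt = (\<lambda>x. if x \<in> carr X then x else 0) \<rparr>"

definition rank_one :: "'a::ab_group_add cnspace \<Rightarrow> ('a \<Rightarrow> 'a) \<Rightarrow> bool" where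
  "rank_one X T \<longleftrightarrow> T \<in> carr (\<B> X) \<and> cdim X (T ` carr X) = 1"


section \<open>James spaces\<close>

definition p_variations :: "real \<Rightarrow> (nat \<Rightarrow> complex) \<Rightarrow> real set" where
  "p_variations p x =
    {(\<Sum>j=1..k - 1. cmod (x (n (j + 1)) - x (n j)) powr p) powr (1 / p) | k n.
      2 \<le> k \<and> strict_mono_on {1..k} (n :: nat \<Rightarrow> nat)}"

definition james_space :: "real \<Rightarrow> (nat \<Rightarrow> complex) cnspace" where
  "james_space p =
    \<lparr> carr = {x. x \<longlonglongrightarrow> 0 \<and> bdd_above (p_variations p x)},
      scl = (\<lambda>c x n. c * x n),
      nrm = (\<lambda>x. Sup (p_variations p x)) \<rparr>"


section \<open>The Semadeni space\<close>

text \<open>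
  A well-ordered type that is long enough to contain the first uncountable ordinal: any well-order
  on a set of cardinality greater than that of the continuum would do.
\<close>

typedef ordinal = "UNIV :: nat set set set" ..

instantiation ordinal :: linorder
begin

definition less_eq_ordinal :: "ordinal \<Rightarrow> ordinal \<Rightarrow> bool" where
  "a \<le> b \<longleftrightarrow> (Rep_ordinal a, Rep_ordinal b) \<in> card_of (UNIV :: nat set set set)"

definition less_ordinal :: "ordinal \<Rightarrow> ordinal \<Rightarrow> bool" where
  "less_ordinal a b \<longleftrightarrow> a \<le> b \<and> a \<noteq> b"

instance
proof
  have wo: "well_order_on UNIV (card_of (UNIV :: nat set set set))"
    by (rule card_of_well_order_on)
  then have lin: "linear_order_on UNIV (card_of (UNIV :: nat set set set))"
    by (simp add: well_order_on_def)
  then have refl: "refl (card_of (UNIV :: nat set set set))"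
    and trans: "trans (card_of (UNIV :: nat set set set))"
    and antisym: "antisym (card_of (UNIV :: nat set set set))"
    and total: "total (card_of (UNIV :: nat set set set))"
    by (auto simp: order_on_defs)
  fix a b c :: ordinal
  show refl': "a \<le> a"
    using refl by (simp add: less_eq_ordinal_def refl_on_def)
  show "a \<le> c" if "a \<le> b" "b \<le> c"
    using trans that unfolding less_eq_ordinal_def by (meson transD)
  show antisym': "a = b" if "a \<le> b" "b \<le> a"
    using antisym that unfolding less_eq_ordinal_def by (meson Rep_ordinal_inject antisymD)
  show "a \<le> b \<or> b \<le> a"
    using total refl' unfolding less_eq_ordinal_def total_on_def
    by (metis Rep_ordinal_inject UNIV_I)
  show "a < b \<longleftrightarrow> a \<le> b \<and> \<not> b \<le> a"
    using antisym' refl' by (auto simp: less_ordinal_def)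
qed

end

instantiation ordinal :: linorder_topology
begin

definition open_ordinal :: "ordinal set \<Rightarrow> bool" where
  "open_ordinal = generate_topology (range lessThan \<union> range greaterThan)"

instance
  by standard (rule open_ordinal_def)

end

instance ordinal :: wellorder
proof
  fix P :: "ordinal \<Rightarrow> bool" and a :: ordinal
  assume step: "\<And>x. (\<And>y. y < x \<Longrightarrow> P y) \<Longrightarrow> P x"
  let ?r = "card_of (UNIV :: nat set set set)"
  have "wf (?r - Id)"
    using card_of_well_order_on[of "UNIV :: nat set set set"] by (simp add: well_order_on_def)
  then have "wf (inv_image (?r - Id) Rep_ordinal)"
    by (rule wf_inv_image)
  moreover have "inv_image (?r - Id) Rep_ordinal = {(x, y). x < y}"
    by (auto simp: inv_image_def less_ordinal_def less_eq_ordinal_def Rep_ordinal_inject)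
  ultimately have "wf {(x, y :: ordinal). x < y}"
    by simp
  then show "P a"
    by (induction a rule: wf_induct_rule) (auto intro: step)
qed

definition omega1 :: ordinal ("\<omega>\<^sub>1") where
  "\<omega>\<^sub>1 = (LEAST a. uncountable {..<a})"

lemma ex_uncountable_initial_segment: "\<exists>a :: ordinal. uncountable {..<a}"
proof -
  let ?r = "card_of (UNIV :: nat set set set)" and ?s = "card_of (UNIV :: nat set set)"
  have "(?s, ?r) \<in> ordLess"
    using card_of_Pow[of "UNIV :: nat set set"] by simp
  then obtain a where "(?s, Restr ?r (underS ?r a)) \<in> ordIso"
    by (auto simp only: ordLess_iff_ordIso_Restr[OF card_of_Well_order card_of_Well_order])
  then obtain f where "bij_betw f (Field ?s) (Field (Restr ?r (underS ?r a)))"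
    by (auto simp only: ordIso_def iso_def)
  then have inj: "inj f" and "range f = Field (Restr ?r (underS ?r a))"
    by (simp_all only: bij_betw_def Field_card_of)
  then have range: "range f \<subseteq> underS ?r a"
    unfolding Field_def by blast
  have "uncountable (UNIV :: nat set set)"
  proof
    assume "countable (UNIV :: nat set set)"
    then have "range (from_nat_into UNIV) = (UNIV :: nat set set)"
      by (intro range_from_nat_into) auto
    then show False
      using Cantors_theorem[of "UNIV :: nat set"] by auto
  qed
  then have "uncountable (range f)"
    using inj countable_image_inj_on by blast
  then have "uncountable (underS ?r a)"
    using range countable_subset by blast
  moreover have "underS ?r a \<subseteq> Rep_ordinal ` {..<Abs_ordinal a}"
  proof
    fix b
    assume "b \<in> underS ?r a"
    then have "b \<noteq> a" "(b, a) \<in> ?r"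
      by (simp_all add: underS_def)
    then have "Abs_ordinal b < Abs_ordinal a"
      by (simp add: less_ordinal_def less_eq_ordinal_def Abs_ordinal_inverse Abs_ordinal_inject)
    then show "b \<in> Rep_ordinal ` {..<Abs_ordinal a}"
      by (intro image_eqI[of _ _ "Abs_ordinal b"]) (simp_all add: Abs_ordinal_inverse)
  qed
  ultimately have "uncountable {..<Abs_ordinal a}"
    using countable_subset[OF _ countable_image] by metis
  then show ?thesis ..
qed

lemma uncountable_lessThan_omega1: "uncountable {..<\<omega>\<^sub>1}"
  unfolding omega1_def using ex_uncountable_initial_segment by (rule LeastI_ex)

lemma countable_lessThan_if_less_omega1: "a < \<omega>\<^sub>1 \<Longrightarrow> countable {..<a}"
  unfolding omega1_def using not_less_Least by blast

text \<open>
  The interval \<open>[0, \<omega>\<^sub>1]\<close> is the initial segment \<open>{..\<omega>\<^sub>1}\<close>; as it is convex, its order topology is the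
  subspace topology. As for operators, functions are extended by 0.
\<close>

definition semadeni_space :: "(ordinal \<Rightarrow> complex) cnspace" where
  "semadeni_space =
    \<lparr> carr = {f. continuous_on {..\<omega>\<^sub>1} f \<and> (\<forall>a. a \<notin> {..\<omega>\<^sub>1} \<longrightarrow> f a = 0)},
      scl = (\<lambda>c f a. c * f a),
      nrm = (\<lambda>f. SUP a\<in>{..\<omega>\<^sub>1}. cmod (f a)) \<rparr>"

end

theory Submission
  imports Defs
begin

text \<open>
  Let \<open>\<psi>\<close> be a character of \<open>\<B>(X)\<close> and let \<open>S : X \<rightarrow> Y\<close>, \<open>L : Y \<rightarrow> X\<close> be bounded with \<open>L S = I\<close> and
  \<open>S L \<noteq> I\<close>. Then \<open>\<phi> T = S T L + \<psi> T (I - S L)\<close> is a unital homomorphism with \<open>L (\<phi> T) S = T\<close>, so it is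
  injective. Characters are contractive, and they vanish on rank one operators unless \<open>dim X = 1\<close>.
  Every \<open>\<phi> T\<close> leaves the range of \<open>I - S L\<close> invariant, which some operator on \<open>Y\<close> does not. For \<open>Y = X \<oplus> Z\<close>
  take the inclusion and the projection; on the James and Semadeni spaces, take shifts.

  Both of these spaces have codimension one in a larger space \<open>X + \<complex> e\<close> of functions, where \<open>e\<close> is a
  pointwise limit of a bounded net in \<open>X\<close> and the bidual of every operator on \<open>X\<close> acts on \<open>X + \<complex> e\<close>. The
  induced action on the quotient by \<open>X\<close> is a character. That the bidual behaves in this way follows
  from gliding hump arguments: bounded functionals vanish in the limit on bounded nets that converge
  to 0 pointwise.
\<close>

section \<open>Normed spaces\<close>

text \<open>Put E = I - S L. Then L E = 0, E S = 0 and E E = E, so the summands S T L and \<psi> T E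
  do not interact and \<phi> is multiplicative. The second summand makes \<phi> unital; since it
  acts on the range of E by scalars, these must form a character. Contractivity of \<psi> gives
  continuity of \<phi>, and the vanishing of \<psi> on rank one operators preserves rank one. If dim
  X = 1, then I has rank one, while the identity of X + Z has not; hence the exclusion of this case
  in part (a).

  The bidual is never formed. An operator is tested on one net tending pointwise to e, and
  multiplicativity of the resulting coefficient rests on null nets being mapped to null nets. For
  the James spaces e is the constant sequence 1; n glued blocks have norm of order n powr (1 / p),
  which for p > 1 is small compared with n. For the Semadeni space e is the indicator of the point
  \<open>\<omega>\<^sub>1\<close>; sums of disjointly supported functions stay in the unit ball, and
  countably many conditions near \<open>\<omega>\<^sub>1\<close> can be met simultaneously, so that
  limits become exact equalities.\<close>

locale complex_normed_space =
  fixes X :: "('a::ab_group_add, 'm) cnspace_scheme"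
  assumes vector_space: "vector_space (scl X)"
    and subspace: "module.subspace (scl X) (carr X)"
    and norm_nonneg: "x \<in> carr X \<Longrightarrow> 0 \<le> nrm X x"
    and norm_eq_0_iff: "x \<in> carr X \<Longrightarrow> nrm X x = 0 \<longleftrightarrow> x = 0"
    and norm_scl: "x \<in> carr X \<Longrightarrow> nrm X (scl X c x) = cmod c * nrm X x"
    and norm_triangle: "\<lbrakk>x \<in> carr X; y \<in> carr X\<rbrakk> \<Longrightarrow> nrm X (x + y) \<le> nrm X x + nrm X y"
begin

sublocale vs: vector_space "scl X"
  by (rule vector_space)

lemma zero_mem [simp]: "0 \<in> carr X"
  using subspace by (rule vs.subspace_0)

lemma add_mem [simp]: "x \<in> carr X \<Longrightarrow> y \<in> carr X \<Longrightarrow> x + y \<in> carr X"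
  using subspace by (rule vs.subspace_add)

lemma scl_mem [simp]: "x \<in> carr X \<Longrightarrow> scl X c x \<in> carr X"
  using subspace by (rule vs.subspace_scale)

lemma diff_mem [simp]: "x \<in> carr X \<Longrightarrow> y \<in> carr X \<Longrightarrow> x - y \<in> carr X"
  using subspace by (rule vs.subspace_diff)

lemma minus_mem [simp]: "x \<in> carr X \<Longrightarrow> - x \<in> carr X"
  using subspace by (rule vs.subspace_neg)

lemma norm_0 [simp]: "nrm X 0 = 0"
  using norm_eq_0_iff[of 0] by simp

lemma norm_minus: "x \<in> carr X \<Longrightarrow> nrm X (- x) = nrm X x"
  using norm_scl[of x "-1"] by simp

lemma norm_triangle_diff: "x \<in> carr X \<Longrightarrow> y \<in> carr X \<Longrightarrow> nrm X (x - y) \<le> nrm X x + nrm X y"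
  using norm_triangle[of x "- y"] norm_minus[of y] by simp

lemma norm_pos: "x \<in> carr X \<Longrightarrow> x \<noteq> 0 \<Longrightarrow> 0 < nrm X x"
  using norm_nonneg[of x] norm_eq_0_iff[of x] by linarith

lemma ndist_eq [simp]: "x \<in> carr X \<Longrightarrow> y \<in> carr X \<Longrightarrow> ndist X x y = nrm X (x - y)"
  by (simp add: ndist_def)

sublocale ms: Metric_space "carr X" "ndist X"
proof
  fix x y z
  show "0 \<le> ndist X x y"
    by (simp add: ndist_def norm_nonneg)
  show "ndist X x y = ndist X y x"
    using norm_minus[of "x - y"] by (simp add: ndist_def)
  show "ndist X x y = 0 \<longleftrightarrow> x = y" if "x \<in> carr X" "y \<in> carr X"
    using that by (simp add: norm_eq_0_iff)
  show "ndist X x z \<le> ndist X x y + ndist X y z" if "x \<in> carr X" "y \<in> carr X" "z \<in> carr X"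
    using that norm_triangle[of "x - y" "y - z"] by simp
qed

lemma complex_banach_spaceI:
  assumes "\<And>\<sigma> :: nat \<Rightarrow> 'a. range \<sigma> \<subseteq> carr X \<Longrightarrow> (\<And>e. 0 < e \<Longrightarrow> \<exists>N. \<forall>m\<ge>N. \<forall>n\<ge>N. nrm X (\<sigma> m - \<sigma> n) < e) \<Longrightarrow>
    \<exists>x\<in>carr X. \<forall>e>0. \<exists>N. \<forall>n\<ge>N. nrm X (\<sigma> n - x) < e"
  shows "complex_banach_space X"
proof (rule complex_banach_space.intro)
  show "Metric_space.mcomplete (carr X) (ndist X)"
    unfolding ms.mcomplete_def
  proof (intro allI impI)
    fix \<sigma>
    assume C: "ms.MCauchy \<sigma>"
    then have mem: "\<sigma> n \<in> carr X" for n
      by (auto simp: ms.MCauchy_def)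
    have "\<exists>x\<in>carr X. \<forall>e>0. \<exists>N. \<forall>n\<ge>N. nrm X (\<sigma> n - x) < e"
    proof (rule assms)
      show "range \<sigma> \<subseteq> carr X"
        by (simp add: image_subset_iff mem)
      show "\<exists>N. \<forall>m\<ge>N. \<forall>n\<ge>N. nrm X (\<sigma> m - \<sigma> n) < e" if e: "0 < e" for e
      proof -
        obtain N where "\<forall>m n. N \<le> m \<longrightarrow> N \<le> n \<longrightarrow> ndist X (\<sigma> m) (\<sigma> n) < e"
          using C e unfolding ms.MCauchy_def by blast
        then show ?thesis
          using mem by (intro exI[of _ N]) simp
      qed
    qed
    then obtain x where "x \<in> carr X" "\<forall>e>0. \<exists>N. \<forall>n\<ge>N. nrm X (\<sigma> n - x) < e"
      by blast
    then have "limitin ms.mtopology \<sigma> x sequentially"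
      using mem by (simp add: ms.limit_metric_sequentially)
    then show "\<exists>x. limitin ms.mtopology \<sigma> x sequentially" ..
  qed
qed (fact vector_space subspace norm_nonneg norm_eq_0_iff norm_scl norm_triangle)+

end

sublocale complex_banach_space \<subseteq> complex_normed_space
  by (rule complex_normed_space.intro)
    (fact vector_space subspace norm_nonneg norm_eq_0_iff norm_scl norm_triangle)+

section \<open>Bounded linear maps and the normed algebra of operators\<close>

definition bounded_linear_on ::
    "('a::ab_group_add, 'm) cnspace_scheme \<Rightarrow> ('b::ab_group_add, 'n) cnspace_scheme \<Rightarrow> ('a \<Rightarrow> 'b) \<Rightarrow> bool" where
  "bounded_linear_on X Y T \<longleftrightarrow>
    (\<forall>x\<in>carr X. T x \<in> carr Y) \<and>
    (\<forall>x\<in>carr X. \<forall>y\<in>carr X. T (x + y) = T x + T y) \<and>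
    (\<forall>c. \<forall>x\<in>carr X. T (scl X c x) = scl Y c (T x)) \<and>
    (\<exists>K. \<forall>x\<in>carr X. nrm Y (T x) \<le> K * nrm X x)"

text \<open>The scalar field in the same format as all other spaces, so that functionals are
  instances of \<open>bounded_linear_map\<close>.\<close>

definition scalar_space :: "complex cnspace" where
  "scalar_space = \<lparr> carr = UNIV, scl = (*), nrm = cmod \<rparr>"

lemma scalar_space_simps [simp]:
  "carr scalar_space = UNIV" "scl scalar_space = (*)" "nrm scalar_space = cmod"
  by (simp_all add: scalar_space_def)

lemma complex_normed_space_scalar_space: "complex_normed_space scalar_space"
proof -
  have vs: "vector_space ((*) :: complex \<Rightarrow> complex \<Rightarrow> complex)"
    by unfold_locales (simp_all add: algebra_simps)
  show ?thesis
    using vs by (intro complex_normed_space.intro)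
      (simp_all add: module.subspace_def[OF vs[unfolded module_iff_vector_space[symmetric]]] norm_mult norm_triangle_ineq)
qed

lemma bounded_operators_iff:
  "T \<in> bounded_operators X \<longleftrightarrow> bounded_linear_on X X T \<and> (\<forall>x. x \<notin> carr X \<longrightarrow> T x = 0)"
  by (auto simp: bounded_operators_def bounded_linear_on_def)

locale bounded_linear_map = X: complex_normed_space X + Y: complex_normed_space Y
  for X :: "('a::ab_group_add, 'm) cnspace_scheme" and Y :: "('b::ab_group_add, 'n) cnspace_scheme" +
  fixes T :: "'a \<Rightarrow> 'b"
  assumes bounded_linear: "bounded_linear_on X Y T"
begin

lemma mem [simp]: "x \<in> carr X \<Longrightarrow> T x \<in> carr Y"
  using bounded_linear by (simp add: bounded_linear_on_def)

lemma add: "x \<in> carr X \<Longrightarrow> y \<in> carr X \<Longrightarrow> T (x + y) = T x + T y"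
  using bounded_linear by (simp add: bounded_linear_on_def)

lemma scl: "x \<in> carr X \<Longrightarrow> T (scl X c x) = scl Y c (T x)"
  using bounded_linear by (simp add: bounded_linear_on_def)

lemma zero [simp]: "T 0 = 0"
  using scl[of 0 0] by simp

lemma minus: "x \<in> carr X \<Longrightarrow> T (- x) = - T x"
  using scl[of x "-1"] by simp

lemma diff: "x \<in> carr X \<Longrightarrow> y \<in> carr X \<Longrightarrow> T (x - y) = T x - T y"
  using add[of x "- y"] minus[of y] by simp

text \<open>The definition admits any real bound, for instance 0 for the zero map; a positive one
  can be divided by later.\<close>

lemma bounded: "\<exists>K>0. \<forall>x\<in>carr X. nrm Y (T x) \<le> K * nrm X x"
proof -
  obtain K where K: "\<And>x. x \<in> carr X \<Longrightarrow> nrm Y (T x) \<le> K * nrm X x"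
    using bounded_linear unfolding bounded_linear_on_def by blast
  have "nrm Y (T x) \<le> max 1 K * nrm X x" if "x \<in> carr X" for x
    using K[OF that] mult_right_mono[OF max.cobounded2[of K 1] X.norm_nonneg[OF that]] by linarith
  then show ?thesis
    by (intro exI[of _ "max 1 K"]) simp
qed

end

lemma bounded_linear_on_compose:
  assumes "bounded_linear_map X Y T" "bounded_linear_map Y Z S"
  shows "bounded_linear_on X Z (\<lambda>x. S (T x))"
proof -
  interpret T: bounded_linear_map X Y T by fact
  interpret S: bounded_linear_map Y Z S by fact
  obtain K where K: "0 < K" "\<And>x. x \<in> carr X \<Longrightarrow> nrm Y (T x) \<le> K * nrm X x"
    using T.bounded by blast
  obtain M where M: "0 < M" "\<And>x. x \<in> carr Y \<Longrightarrow> nrm Z (S x) \<le> M * nrm Y x"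
    using S.bounded by blast
  have "nrm Z (S (T x)) \<le> (M * K) * nrm X x" if "x \<in> carr X" for x
  proof -
    have "M * nrm Y (T x) \<le> M * (K * nrm X x)"
      using K(2)[OF that] M(1) by (intro mult_left_mono) auto
    then show ?thesis
      using M(2)[OF T.mem[OF that]] by (simp add: mult.assoc)
  qed
  then show ?thesis
    unfolding bounded_linear_on_def by (auto simp: T.add S.add T.scl S.scl)
qed

lemma operator_algebra_simps [simp]:
  "carr (\<B> X) = bounded_operators X"
  "scl (\<B> X) = (\<lambda>c T x. scl X c (T x))"
  "mul (\<B> X) = (\<circ>)"
  "unt (\<B> X) = (\<lambda>x. if x \<in> carr X then x else 0)"
  by (simp_all add: operator_algebra_def)

locale operator_space = complex_normed_space X
  for X :: "'a::ab_group_add cnspace"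
begin

lemma operator_linear_map: "T \<in> bounded_operators X \<Longrightarrow> bounded_linear_map X X T"
  by unfold_locales (simp add: bounded_operators_iff)

lemma operator_outside: "T \<in> bounded_operators X \<Longrightarrow> x \<notin> carr X \<Longrightarrow> T x = 0"
  by (simp add: bounded_operators_iff)

lemma operatorI:
  assumes "\<And>x. x \<in> carr X \<Longrightarrow> T x \<in> carr X"
    and "\<And>x y. x \<in> carr X \<Longrightarrow> y \<in> carr X \<Longrightarrow> T (x + y) = T x + T y"
    and "\<And>c x. x \<in> carr X \<Longrightarrow> T (scl X c x) = scl X c (T x)"
    and "\<And>x. x \<in> carr X \<Longrightarrow> nrm X (T x) \<le> K * nrm X x"
    and "\<And>x. x \<notin> carr X \<Longrightarrow> T x = 0"
  shows "T \<in> bounded_operators X"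
  unfolding bounded_operators_def using assms by blast

lemma operator_add:
  assumes "S \<in> bounded_operators X" "T \<in> bounded_operators X"
  shows "S + T \<in> bounded_operators X"
proof -
  interpret S: bounded_linear_map X X S by (rule operator_linear_map) fact
  interpret T: bounded_linear_map X X T by (rule operator_linear_map) fact
  obtain K where K: "0 < K" "\<And>x. x \<in> carr X \<Longrightarrow> nrm X (S x) \<le> K * nrm X x"
    using S.bounded by blast
  obtain M where M: "0 < M" "\<And>x. x \<in> carr X \<Longrightarrow> nrm X (T x) \<le> M * nrm X x"
    using T.bounded by blast
  show ?thesis
  proof (rule operatorI)
    show "nrm X ((S + T) x) \<le> (K + M) * nrm X x" if "x \<in> carr X" for x
      using norm_triangle[of "S x" "T x"] K(2)[OF that] M(2)[OF that] that by (simp add: distrib_right)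
  qed (use assms in \<open>auto simp: S.add T.add S.scl T.scl vs.scale_right_distrib operator_outside\<close>)
qed

lemma operator_scl:
  assumes "T \<in> bounded_operators X"
  shows "(\<lambda>x. scl X c (T x)) \<in> bounded_operators X"
proof -
  interpret T: bounded_linear_map X X T by (rule operator_linear_map) fact
  obtain M where M: "0 < M" "\<And>x. x \<in> carr X \<Longrightarrow> nrm X (T x) \<le> M * nrm X x"
    using T.bounded by blast
  show ?thesis
  proof (rule operatorI)
    show "nrm X (scl X c (T x)) \<le> (cmod c * M) * nrm X x" if "x \<in> carr X" for x
      using mult_left_mono[OF M(2)[OF that], of "cmod c"] that by (simp add: norm_scl mult.assoc)
  qed (use assms in \<open>auto simp: T.add T.scl vs.scale_right_distrib operator_outside mult.commute\<close>)
qed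

lemma operator_diff:
  assumes "S \<in> bounded_operators X" "T \<in> bounded_operators X"
  shows "S - T \<in> bounded_operators X"
proof -
  have "S - T = S + (\<lambda>x. scl X (-1) (T x))"
    by (simp add: fun_eq_iff)
  then show ?thesis
    using operator_add[OF assms(1) operator_scl[OF assms(2), of "-1"]] by argo
qed

lemma operator_compose:
  assumes "S \<in> bounded_operators X" "T \<in> bounded_operators X"
  shows "S \<circ> T \<in> bounded_operators X"
proof -
  interpret S: bounded_linear_map X X S by (rule operator_linear_map) fact
  show ?thesis
    using bounded_linear_on_compose[OF operator_linear_map operator_linear_map] assms
    by (simp add: bounded_operators_iff comp_def)
qed

lemma operator_id: "(\<lambda>x. if x \<in> carr X then x else 0) \<in> bounded_operators X"
  by (rule operatorI[where K = 1]) simp_all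

lemma operator_zero: "0 \<in> bounded_operators X"
  by (rule operatorI[where K = 0]) simp_all

lemma operator_norm_def: "nrm (\<B> X) T = (SUP x\<in>{x \<in> carr X. nrm X x \<le> 1}. nrm X (T x))"
  by (simp add: operator_algebra_def)

lemma operator_norm_le:
  assumes "\<And>x. x \<in> carr X \<Longrightarrow> nrm X (T x) \<le> K * nrm X x" "0 \<le> K"
  shows "nrm (\<B> X) T \<le> K"
  unfolding operator_norm_def
proof (rule cSUP_least)
  show "{x \<in> carr X. nrm X x \<le> 1} \<noteq> {}"
    using zero_mem norm_0 by (metis (mono_tags, lifting) empty_iff mem_Collect_eq zero_le_one)
  show "nrm X (T x) \<le> K" if "x \<in> {x \<in> carr X. nrm X x \<le> 1}" for x
    using assms(1)[of x] mult_left_mono[of "nrm X x" 1 K] that assms(2) by simp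
qed

lemma operator_bdd_above:
  assumes "T \<in> bounded_operators X"
  shows "bdd_above ((\<lambda>x. nrm X (T x)) ` {x \<in> carr X. nrm X x \<le> 1})"
proof -
  interpret T: bounded_linear_map X X T by (rule operator_linear_map) fact
  obtain M where M: "0 < M" "\<And>x. x \<in> carr X \<Longrightarrow> nrm X (T x) \<le> M * nrm X x"
    using T.bounded by blast
  show ?thesis
  proof (rule bdd_aboveI2)
    show "nrm X (T x) \<le> M" if "x \<in> {x \<in> carr X. nrm X x \<le> 1}" for x
    proof -
      have "M * nrm X x \<le> M * 1"
        using that M(1) by (intro mult_left_mono) auto
      then show ?thesis
        using M(2)[of x] that by simp
    qed
  qed
qed

lemma operator_norm_bound:
  assumes "T \<in> bounded_operators X" "x \<in> carr X"
  shows "nrm X (T x) \<le> nrm (\<B> X) T * nrm X x"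
proof (cases "x = 0")
  case False
  interpret T: bounded_linear_map X X T by (rule operator_linear_map) fact
  have pos: "0 < nrm X x"
    using assms(2) False by (rule norm_pos)
  have "nrm X (T (scl X (inverse (nrm X x)) x)) \<le> nrm (\<B> X) T"
    unfolding operator_norm_def using operator_bdd_above[OF assms(1)]
        using pos assms(2) by (intro cSUP_upper) (auto simp: norm_scl norm_inverse)
  then have "inverse (nrm X x) * nrm X (T x) \<le> nrm (\<B> X) T"
    using pos assms(2) by (simp add: T.scl norm_scl norm_inverse)
  then show ?thesis
    using pos by (simp add: field_simps)
next
  case True
  interpret T: bounded_linear_map X X T by (rule operator_linear_map) fact
  show ?thesis
    using True by simp
qed

lemma operator_norm_nonneg:
  assumes "T \<in> bounded_operators X"
  shows "0 \<le> nrm (\<B> X) T"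
proof -
  interpret T: bounded_linear_map X X T by (rule operator_linear_map) fact
  have "nrm X (T 0) \<le> nrm (\<B> X) T"
    unfolding operator_norm_def using operator_bdd_above[OF assms(1)] by (intro cSUP_upper) auto
  then show ?thesis
    by simp
qed

lemma complex_normed_space_operators: "complex_normed_space (\<B> X)"
proof (rule complex_normed_space.intro)
  show vs: "vector_space (scl (\<B> X))"
    by unfold_locales
      (simp_all add: fun_eq_iff vs.scale_right_distrib vs.scale_left_distrib)
  interpret b: vector_space "scl (\<B> X)" by (rule vs)
  show "module.subspace (scl (\<B> X)) (carr (\<B> X))"
    unfolding b.subspace_def using operator_add operator_scl operator_zero by simp
  show "0 \<le> nrm (\<B> X) T" if "T \<in> carr (\<B> X)" for T
    using that by (simp add: operator_norm_nonneg)
  show "nrm (\<B> X) T = 0 \<longleftrightarrow> T = 0" if T: "T \<in> carr (\<B> X)" for T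
  proof
    assume 0: "nrm (\<B> X) T = 0"
    interpret T: bounded_linear_map X X T by (rule operator_linear_map) (use T in simp)
    have "T x = 0" for x
    proof (cases "x \<in> carr X")
      case True
      then show ?thesis
        using operator_norm_bound[of T x] T 0 norm_nonneg[of "T x"] norm_eq_0_iff[of "T x"] by simp
    qed (use T in \<open>simp add: operator_outside\<close>)
    then show "T = 0"
      by (simp add: fun_eq_iff)
  next
    assume "T = 0"
    then show "nrm (\<B> X) T = 0"
      using operator_norm_le[of T 0] operator_norm_nonneg[of T] operator_zero by simp
  qed
  show triangle: "nrm (\<B> X) (S + T) \<le> nrm (\<B> X) S + nrm (\<B> X) T"
    if ST: "S \<in> carr (\<B> X)" "T \<in> carr (\<B> X)" for S T
  proof (rule operator_norm_le)
    interpret S: bounded_linear_map X X S by (rule operator_linear_map) (use ST in simp)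
    interpret T: bounded_linear_map X X T by (rule operator_linear_map) (use ST in simp)
    show "nrm X ((S + T) x) \<le> (nrm (\<B> X) S + nrm (\<B> X) T) * nrm X x" if "x \<in> carr X" for x
      using norm_triangle[of "S x" "T x"] operator_norm_bound[of S x] operator_norm_bound[of T x] ST that
      by (simp add: distrib_right)
  qed (use ST in \<open>simp add: operator_norm_nonneg\<close>)
  have le: "nrm (\<B> X) (scl (\<B> X) c T) \<le> cmod c * nrm (\<B> X) T" if T: "T \<in> carr (\<B> X)" for c T
  proof (rule operator_norm_le)
    interpret T: bounded_linear_map X X T by (rule operator_linear_map) (use T in simp)
    show "nrm X (scl (\<B> X) c T x) \<le> cmod c * nrm (\<B> X) T * nrm X x" if "x \<in> carr X" for x
      using mult_left_mono[OF operator_norm_bound[of T x], of "cmod c"] T that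
      by (simp add: norm_scl mult.assoc)
  qed (use T in \<open>simp add: operator_norm_nonneg\<close>)
  show "nrm (\<B> X) (scl (\<B> X) c T) = cmod c * nrm (\<B> X) T" if T: "T \<in> carr (\<B> X)" for c T
  proof (cases "c = 0")
    case True
    then show ?thesis
      using le[OF T, of 0] operator_norm_nonneg[OF operator_scl, of T 0] T by simp
  next
    case False
    \<comment> \<open>The reverse inequality is \<open>le\<close> for \<open>inverse c\<close>,
      applied to the scaled operator.\<close>
    then have "nrm (\<B> X) T \<le> cmod (inverse c) * nrm (\<B> X) (scl (\<B> X) c T)"
      using le[of "scl (\<B> X) c T" "inverse c"] T by (simp add: operator_scl)
    then have "cmod c * nrm (\<B> X) T \<le> cmod c * (cmod (inverse c) * nrm (\<B> X) (scl (\<B> X) c T))"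
      by (rule mult_left_mono) simp
    also have "\<dots> = nrm (\<B> X) (scl (\<B> X) c T)"
      using False by (simp add: norm_inverse)
    finally show ?thesis
      using le[OF T, of c] by (rule antisym[rotated])
  qed
qed

end

section \<open>Separation of points by bounded functionals\<close>

context complex_normed_space
begin

text \<open>The inequality in the second clause, used for \<open>t\<close> and
  \<open>inverse t\<close>, yields equality. The value 0 off the carrier makes functionals that
  agree on the space equal as functions, as antisymmetry of the pointwise order requires.\<close>

definition sublinear :: "('a \<Rightarrow> real) \<Rightarrow> bool" where
  "sublinear q \<longleftrightarrow>
    (\<forall>x\<in>carr X. \<forall>y\<in>carr X. q (x + y) \<le> q x + q y) \<and>
    (\<forall>t>0. \<forall>x\<in>carr X. q (scl X (of_real t) x) \<le> t * q x) \<and>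
    (\<forall>x. x \<notin> carr X \<longrightarrow> q x = 0)"

lemma sublinear_add: "sublinear q \<Longrightarrow> x \<in> carr X \<Longrightarrow> y \<in> carr X \<Longrightarrow> q (x + y) \<le> q x + q y"
  by (simp add: sublinear_def)

lemma sublinear_scale_le: "sublinear q \<Longrightarrow> x \<in> carr X \<Longrightarrow> 0 < t \<Longrightarrow> q (scl X (of_real t) x) \<le> t * q x"
  by (simp add: sublinear_def)

lemma sublinear_0: "sublinear q \<Longrightarrow> q 0 = 0"
  using sublinear_scale_le[of q 0 2] sublinear_scale_le[of q 0 "1 / 2"] by simp

text \<open>For \<open>q\<close> below \<open>p\<close> this gives
  \<open>- p (- x) \<le> q x\<close>, a lower bound common to all such \<open>q\<close>, so that
  infima over them exist.\<close>

lemma sublinear_minus_ge: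
  assumes "sublinear q" "x \<in> carr X"
  shows "- q (- x) \<le> q x"
proof -
  have "q (x + - x) \<le> q x + q (- x)"
    using assms by (intro sublinear_add) simp_all
  then show ?thesis
    using sublinear_0[OF assms(1)] by simp
qed

lemma sublinear_scale:
  assumes "sublinear q" "x \<in> carr X" "0 < t"
  shows "q (scl X (of_real t) x) = t * q x"
proof (rule antisym)
  show "q (scl X (of_real t) x) \<le> t * q x"
    using assms by (rule sublinear_scale_le)
  have "q (scl X (of_real (inverse t)) (scl X (of_real t) x)) \<le> inverse t * q (scl X (of_real t) x)"
    using assms by (intro sublinear_scale_le) simp_all
  then have "q x \<le> inverse t * q (scl X (of_real t) x)"
    using assms(3) by simp
  then show "t * q x \<le> q (scl X (of_real t) x)"
    using assms(3) by (simp add: field_simps)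
qed

text \<open>Shifting a sublinear functional along \<open>y\<close> makes it smaller unless it is odd at \<open>y\<close>; hence the
  minimal sublinear functionals are the linear ones.\<close>

definition shift :: "'a \<Rightarrow> ('a \<Rightarrow> real) \<Rightarrow> 'a \<Rightarrow> real" where
  "shift y q x = (if x \<in> carr X then INF t\<in>{0..}. q (x + scl X (of_real t) y) - t * q y else 0)"

lemma shift_bdd_below:
  assumes "sublinear q" "x \<in> carr X" "y \<in> carr X"
  shows "bdd_below ((\<lambda>t. q (x + scl X (of_real t) y) - t * q y) ` {0..})"
proof (rule bdd_belowI2)
  fix t :: real assume t: "t \<in> {0..}"
  have "q (scl X (of_real t) y) = t * q y"
    using t assms sublinear_scale[of q y t] sublinear_0[of q] by (cases "t = 0") auto
  moreover have "q (x + scl X (of_real t) y + - x) \<le> q (x + scl X (of_real t) y) + q (- x)"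
    using assms by (intro sublinear_add) simp_all
  ultimately show "- q (- x) \<le> q (x + scl X (of_real t) y) - t * q y"
    by simp
qed

lemma shift_le:
  assumes "sublinear q" "x \<in> carr X" "y \<in> carr X" "0 \<le> t"
  shows "shift y q x \<le> q (x + scl X (of_real t) y) - t * q y"
  unfolding shift_def using assms cINF_lower[OF shift_bdd_below[OF assms(1-3)], of t] by simp

lemma shift_greatest:
  assumes "x \<in> carr X" "\<And>t. 0 \<le> t \<Longrightarrow> c \<le> q (x + scl X (of_real t) y) - t * q y"
  shows "c \<le> shift y q x"
  unfolding shift_def using assms by (auto intro!: cINF_greatest)

lemma sublinear_shift:
  assumes q: "sublinear q" and y: "y \<in> carr X"
  shows "sublinear (shift y q)"
  unfolding sublinear_def
proof (intro conjI ballI allI impI)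
  fix x x' assume x: "x \<in> carr X" and x': "x' \<in> carr X"
  have "shift y q (x + x') \<le> (q (x + scl X (of_real t) y) - t * q y) + (q (x' + scl X (of_real s) y) - s * q y)"
    if ts: "0 \<le> t" "0 \<le> s" for t s
  proof -
    \<comment> \<open>The parameters add up: \<open>t + s\<close> at \<open>x + x'\<close> competes
      with \<open>t\<close> at \<open>x\<close> and \<open>s\<close> at \<open>x'\<close>.\<close>
    have "shift y q (x + x') \<le> q (x + x' + scl X (of_real (t + s)) y) - (t + s) * q y"
      using q x x' y ts by (intro shift_le) auto
    also have "x + x' + scl X (of_real (t + s)) y = (x + scl X (of_real t) y) + (x' + scl X (of_real s) y)"
      by (simp add: vs.scale_left_distrib algebra_simps)
    also have "q \<dots> \<le> q (x + scl X (of_real t) y) + q (x' + scl X (of_real s) y)"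
      using q x x' y by (intro sublinear_add) simp_all
    finally show ?thesis
      by (simp add: algebra_simps)
  qed
  then have "shift y q (x + x') - (q (x + scl X (of_real t) y) - t * q y) \<le> shift y q x'" if "0 \<le> t" for t
    using that x' by (intro shift_greatest) (simp_all add: diff_le_eq add.commute)
  then have "shift y q (x + x') - shift y q x' \<le> shift y q x"
    using x by (intro shift_greatest) (auto simp: algebra_simps)
  then show "shift y q (x + x') \<le> shift y q x + shift y q x'"
    by simp
next
  fix s :: real and x assume s: "0 < s" and x: "x \<in> carr X"
  have "inverse s * shift y q (scl X (of_real s) x) \<le> q (x + scl X (of_real t) y) - t * q y"
    if t: "0 \<le> t" for t
  proof -
    have "shift y q (scl X (of_real s) x) \<le> q (scl X (of_real s) x + scl X (of_real (s * t)) y) - (s * t) * q y"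
      using q x y t s by (intro shift_le) auto
    also have "scl X (of_real s) x + scl X (of_real (s * t)) y = scl X (of_real s) (x + scl X (of_real t) y)"
      by (simp add: vs.scale_right_distrib)
    also have "q \<dots> = s * q (x + scl X (of_real t) y)"
      using q x y s by (intro sublinear_scale) auto
    finally show ?thesis
      using s by (simp add: field_simps)
  qed
  then have "inverse s * shift y q (scl X (of_real s) x) \<le> shift y q x"
    using x by (intro shift_greatest) auto
  then show "shift y q (scl X (of_real s) x) \<le> s * shift y q x"
    using s by (simp add: field_simps)
qed (simp add: shift_def)

text \<open>Zorn's lemma for the reversed pointwise order: a nonempty chain is bounded by its
  pointwise infimum.\<close>

lemma ex_minimal_sublinear:
  assumes p: "sublinear p"
  shows "\<exists>q. sublinear q \<and> (\<forall>x. q x \<le> p x) \<and>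
    (\<forall>r. sublinear r \<longrightarrow> (\<forall>x. r x \<le> q x) \<longrightarrow> r = q)"
proof -
  let ?A = "{q. sublinear q \<and> (\<forall>x. q x \<le> p x)}"
  let ?P = "\<lambda>q r. \<forall>x. r x \<le> (q x :: real)"
  have "\<exists>m\<in>?A. \<forall>a\<in>?A. ?P m a \<longrightarrow> a = m"
  proof (rule predicate_Zorn)
    show "partial_order_on ?A (relation_of ?P ?A)"
      by (rule partial_order_on_relation_ofI) (auto intro!: ext intro: order_trans antisym)
    fix C assume "C \<in> Chains (relation_of ?P ?A)"
    then have CA: "C \<subseteq> ?A" and chain: "\<And>q r. q \<in> C \<Longrightarrow> r \<in> C \<Longrightarrow> ?P q r \<or> ?P r q"
      by (auto simp: Chains_def relation_of_def)
    show "\<exists>u\<in>?A. \<forall>q\<in>C. ?P q u"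
    proof (cases "C = {}")
      case True
      then show ?thesis
        using p by auto
    next
      case False
      define u where "u x = (INF q\<in>C. q x)" for x
      have bdd: "bdd_below ((\<lambda>q. q x) ` C)" for x
      proof (cases "x \<in> carr X")
        case True
        show ?thesis
        proof (rule bdd_belowI2)
          fix q assume "q \<in> C"
          then have "sublinear q" "q (- x) \<le> p (- x)"
            using CA by auto
          then show "- p (- x) \<le> q x"
            using sublinear_minus_ge[of q x] True by linarith
        qed
      next
        case False
        show ?thesis
          by (rule bdd_belowI2[of _ 0]) (use CA False in \<open>auto simp: sublinear_def\<close>)
      qed
      have u_le: "u x \<le> q x" if "q \<in> C" for q x
        unfolding u_def using bdd that by (rule cINF_lower)
      have u_ge: "c \<le> u x" if "\<And>q. q \<in> C \<Longrightarrow> c \<le> q x" for c x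
        unfolding u_def using False that by (rule cINF_greatest)
      have "sublinear u"
        unfolding sublinear_def
      proof (intro conjI ballI allI impI)
        fix x y assume x: "x \<in> carr X" and y: "y \<in> carr X"
        have "u (x + y) \<le> q x + r y" if qr: "q \<in> C" "r \<in> C" for q r
        proof -
          \<comment> \<open>The infima at \<open>x\<close> and at \<open>y\<close> may be approached
            along different members of the chain; the smaller of the two serves both.\<close>
          obtain s where s: "s \<in> C" "s x \<le> q x" "s y \<le> r y"
            using chain[OF qr] qr by (metis order_refl)
          have "s (x + y) \<le> s x + s y"
            using s(1) CA x y by (auto simp: sublinear_def)
          then show ?thesis
            using u_le[OF s(1), of "x + y"] s by linarith
        qed
        then have "u (x + y) - q x \<le> u y" if "q \<in> C" for q
          using that by (intro u_ge) (metis diff_le_eq add.commute)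
        then have "u (x + y) - u y \<le> u x"
          by (intro u_ge) (auto simp: algebra_simps)
        then show "u (x + y) \<le> u x + u y"
          by simp
      next
        fix t :: real and x assume t: "0 < t" and x: "x \<in> carr X"
        have "inverse t * u (scl X (of_real t) x) \<le> q x" if q: "q \<in> C" for q
        proof -
          have "u (scl X (of_real t) x) \<le> t * q x"
            using u_le[OF q, of "scl X (of_real t) x"] sublinear_scale[of q x t] CA q x t by auto
          then show ?thesis
            using t by (simp add: field_simps)
        qed
        then have "inverse t * u (scl X (of_real t) x) \<le> u x"
          by (rule u_ge)
        then show "u (scl X (of_real t) x) \<le> t * u x"
          using t by (simp add: field_simps)
      next
        fix x assume "x \<notin> carr X"
        then have "q x = 0" if "q \<in> C" for q
          using CA that by (auto simp: sublinear_def)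
        then have "(\<lambda>q. q x) ` C = {0}"
          using False by force
        then show "u x = 0"
          by (simp add: u_def)
      qed
      moreover have "u x \<le> p x" for x
      proof -
        obtain q where "q \<in> C"
          using False by blast
        then show ?thesis
          using u_le[of q x] CA by (auto intro: order_trans)
      qed
      ultimately show ?thesis
        using u_le by blast
    qed
  qed
  then obtain m where m: "sublinear m" "\<forall>x. m x \<le> p x"
    "\<And>a. sublinear a \<Longrightarrow> (\<forall>x. a x \<le> p x) \<Longrightarrow> (\<forall>x. a x \<le> m x) \<Longrightarrow> a = m"
    by auto
  have "r = m" if "sublinear r" "\<forall>x. r x \<le> m x" for r
    using m(3)[OF that(1)] that(2) m(2) by (metis order_trans)
  then show ?thesis
    using m by blast
qed

text \<open>Hahn-Banach by minimality. A minimal \<open>m\<close> satisfies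
  \<open>shift z m = m\<close> for every \<open>z\<close>, which forces
  \<open>m (- z) = - m z\<close> and with it real linearity. Taking \<open>m\<close> below
  \<open>shift y p\<close> instead of the norm \<open>p\<close> itself secures
  \<open>m (- y) \<le> - nrm X y\<close>, so \<open>m\<close> does not vanish at
  \<open>y\<close>.\<close>

theorem separating_functional:
  assumes y: "y \<in> carr X" "y \<noteq> 0"
  shows "\<exists>g. bounded_linear_on X scalar_space g \<and> g y \<noteq> 0"
proof -
  define p where "p x = (if x \<in> carr X then nrm X x else 0)" for x
  have p: "sublinear p"
    unfolding sublinear_def p_def by (auto simp: norm_triangle norm_scl)
  obtain m where m: "sublinear m" "\<And>x. m x \<le> shift y p x"
    and min: "\<And>r. sublinear r \<Longrightarrow> (\<And>x. r x \<le> m x) \<Longrightarrow> r = m"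
    using ex_minimal_sublinear[OF sublinear_shift[OF p y(1)]] by blast
  have shift_le_self: "shift z q x \<le> q x" if "sublinear q" "z \<in> carr X" for q z x
    using shift_le[OF that(1) _ that(2), of x 0] that(1) by (cases "x \<in> carr X") (auto simp: shift_def sublinear_def)
  have odd: "m (- z) = - m z" if z: "z \<in> carr X" for z
  proof -
    have "shift z m = m"
      using m(1) z by (intro min sublinear_shift shift_le_self)
    then have "m (- z) \<le> m (- z + scl X (of_real 1) z) - 1 * m z"
      using shift_le[OF m(1) _ z, of "- z" 1] z by simp
    then show ?thesis
      using sublinear_minus_ge[OF m(1) z] sublinear_0[OF m(1)] by simp
  qed
  have m_le: "m (x + z) \<le> m x + m z" if "x \<in> carr X" "z \<in> carr X" for x z
    using m(1) that by (simp add: sublinear_def)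
  have add: "m (x + z) = m x + m z" if "x \<in> carr X" "z \<in> carr X" for x z
    using m_le[OF that] m_le[of "x + z" "- z"] odd[of z] that by simp
  have scale: "m (scl X (of_real t) x) = t * m x" if x: "x \<in> carr X" for t x
  proof -
    consider "t = 0" | "0 < t" | "t < 0" by linarith
    then show ?thesis
    proof cases
      case 3
      then have "m (scl X (of_real (- t)) x) = - t * m x"
        using sublinear_scale[OF m(1) x, of "- t"] by simp
      then show ?thesis
        using odd[of "scl X (of_real t) x"] x by simp
    qed (use sublinear_scale[OF m(1) x] sublinear_0[OF m(1)] in auto)
  qed
  have le_norm: "m x \<le> nrm X x" if "x \<in> carr X" for x
    using m(2)[of x] shift_le_self[OF p y(1), of x] that by (simp add: p_def)
  have abs_le: "\<bar>m x\<bar> \<le> nrm X x" if "x \<in> carr X" for x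
    using le_norm[OF that] le_norm[of "- x"] odd[OF that] norm_minus[OF that] that by simp
  \<comment> \<open>The complex-linear functional with real part \<open>m\<close>.\<close>
  define g where "g x = Complex (m x) (- m (scl X \<i> x))" for x
  have "bounded_linear_on X scalar_space g"
    unfolding bounded_linear_on_def scalar_space_simps
  proof (intro conjI ballI allI exI)
    fix x z assume "x \<in> carr X" "z \<in> carr X"
    then show "g (x + z) = g x + g z"
      by (simp add: g_def add vs.scale_right_distrib complex_eq_iff)
  next
    fix c x assume x: "x \<in> carr X"
    have "scl X c x = scl X (of_real (Re c)) x + scl X (of_real (Im c)) (scl X \<i> x)"
      using vs.scale_left_distrib[of "of_real (Re c)" "of_real (Im c) * \<i>" x] complex_eq[of c]
      by (simp add: mult.commute)
    then have 1: "m (scl X c x) = Re c * m x + Im c * m (scl X \<i> x)"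
      using x by (simp only: add scale scl_mem)
    have "\<i> * c = of_real (Re c) * \<i> + of_real (- Im c)"
      by (simp add: complex_eq_iff)
    then have "scl X \<i> (scl X c x) = scl X (of_real (Re c)) (scl X \<i> x) + scl X (of_real (- Im c)) x"
      using vs.scale_left_distrib[of "of_real (Re c) * \<i>" "of_real (- Im c)" x] by (simp only: vs.scale_scale)
    then have "scl X \<i> (scl X c x) = scl X (of_real (Re c)) (scl X \<i> x) + scl X (of_real (- Im c)) x"
      by (simp only: vs.scale_scale)
    then have 2: "m (scl X \<i> (scl X c x)) = Re c * m (scl X \<i> x) + - Im c * m x"
      using x by (simp only: add scale scl_mem)
    show "g (scl X c x) = c * g x"
      unfolding g_def 1 2 by (simp add: complex_eq_iff)
  next
    fix x assume x: "x \<in> carr X"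
    have "cmod (g x) \<le> \<bar>m x\<bar> + \<bar>m (scl X \<i> x)\<bar>"
      using cmod_le[of "g x"] by (simp add: g_def)
    also have "\<dots> \<le> 2 * nrm X x"
      using abs_le[of x] abs_le[of "scl X \<i> x"] x by (simp add: norm_scl)
    finally show "cmod (g x) \<le> 2 * nrm X x" .
  qed simp
  moreover have "g y \<noteq> 0"
  proof -
    have "m (- y) \<le> p (- y + scl X (of_real 1) y) - 1 * p y"
      using m(2)[of "- y"] shift_le[OF p _ y(1), of "- y" 1] y by simp
    then have "m (- y) < 0"
      using norm_pos[OF y] y by (simp add: p_def)
    then show ?thesis
      using odd[OF y(1)] by (auto simp: g_def complex_eq_iff)
  qed
  ultimately show ?thesis
    by blast
qed

end

section \<open>Rank one operators and characters\<close>

text \<open>A basis of cardinality 1 is a singleton, so the value 0 of \<open>cdim\<close> on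
  infinite-dimensional subspaces causes no confusion.\<close>

lemma (in complex_normed_space) dim_eq_1_iff:
  assumes "vs.subspace V"
  shows "cdim X V = 1 \<longleftrightarrow> (\<exists>x. x \<noteq> 0 \<and> V = range (\<lambda>c. scl X c x))"
proof
  assume "cdim X V = 1"
  then obtain B where B: "B \<subseteq> V" "vs.independent B" "V \<subseteq> vs.span B" "card B = 1"
    by (metis vs.basis_exists)
  then obtain x where x: "B = {x}"
    by (auto simp: card_1_singleton_iff)
  have "vs.span B \<subseteq> V"
    using B(1) assms by (rule vs.span_minimal)
  then have "V = range (\<lambda>c. scl X c x)"
    using B(3) by (auto simp: x vs.span_singleton)
  moreover have "x \<noteq> 0"
    using B(2) x vs.dependent_zero by blast
  ultimately show "\<exists>x. x \<noteq> 0 \<and> V = range (\<lambda>c. scl X c x)"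
    by blast
next
  assume "\<exists>x. x \<noteq> 0 \<and> V = range (\<lambda>c. scl X c x)"
  then obtain x where x: "x \<noteq> 0" "V = vs.span {x}"
    by (auto simp: vs.span_singleton)
  have "vs.independent {x}"
    using x(1) by simp
  then show "cdim X V = 1"
    unfolding x(2) using vs.dim_span_eq_card_independent by fastforce
qed

lemma (in bounded_linear_map) subspace_image: "Y.vs.subspace (T ` carr X)"
  unfolding Y.vs.subspace_def
proof (intro conjI ballI allI)
  show "0 \<in> T ` carr X"
    by (rule image_eqI[of _ _ 0]) simp_all
  fix y assume "y \<in> T ` carr X"
  then obtain x where x: "x \<in> carr X" "y = T x"
    by blast
  show "scl Y c y \<in> T ` carr X" for c
    by (rule image_eqI[of _ _ "scl X c x"]) (simp_all add: x scl)
  fix y' assume "y' \<in> T ` carr X"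
  then obtain x' where x': "x' \<in> carr X" "y' = T x'"
    by blast
  show "y + y' \<in> T ` carr X"
    by (rule image_eqI[of _ _ "x + x'"]) (simp_all add: x x' add)
qed

context operator_space
begin

lemma rank_one_iff:
  "rank_one X T \<longleftrightarrow>
    T \<in> bounded_operators X \<and> (\<exists>x. x \<noteq> 0 \<and> T ` carr X = range (\<lambda>c. scl X c x))"
proof (cases "T \<in> bounded_operators X")
  case True
  interpret T: bounded_linear_map X X T by (rule operator_linear_map) fact
  show ?thesis
    using dim_eq_1_iff[OF T.subspace_image] True by (simp add: rank_one_def)
qed (simp add: rank_one_def)

text \<open>The elementary operators from which both the factors of a rank one operator and the
  operator missed by \<phi> are made.\<close>

lemma functional_operator:
  assumes "bounded_linear_on X scalar_space f" "x \<in> carr X"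
  shows "(\<lambda>v. if v \<in> carr X then scl X (f v) x else 0) \<in> bounded_operators X"
proof -
  interpret C: complex_normed_space scalar_space by (rule complex_normed_space_scalar_space)
  interpret f: bounded_linear_map X scalar_space f by unfold_locales fact
  obtain K where K: "0 < K" "\<And>x. x \<in> carr X \<Longrightarrow> cmod (f x) \<le> K * nrm X x"
    using f.bounded by auto
  show ?thesis
  proof (rule operatorI)
    fix v assume v: "v \<in> carr X"
    have "cmod (f v) * nrm X x \<le> K * nrm X v * nrm X x"
      using K(2)[OF v] norm_nonneg[OF assms(2)] by (rule mult_right_mono)
    then show "nrm X (if v \<in> carr X then scl X (f v) x else 0) \<le> (K * nrm X x) * nrm X v"
      using v assms(2) by (simp add: norm_scl mult_ac)
  qed (use assms(2) f.add f.scl in \<open>auto simp: vs.scale_left_distrib\<close>)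
qed

text \<open>A rank one operator factors as \<open>A \<circ> N\<close> with \<open>N \<circ> N = 0\<close>: send its range to a nonzero vector of
  its kernel and back.\<close>

lemma character_rank_one:
  assumes \<psi>: "character (\<B> X) \<psi>" and dim: "cdim X (carr X) \<noteq> 1" and T: "rank_one X T"
  shows "\<psi> T = 0"
proof -
  have TB: "T \<in> bounded_operators X"
    using T by (simp add: rank_one_iff)
  interpret T: bounded_linear_map X X T by (rule operator_linear_map) fact
  obtain x where x: "x \<noteq> 0" "T ` carr X = range (\<lambda>c. scl X c x)"
    using T by (auto simp: rank_one_iff)
  have xX: "x \<in> carr X"
    using x(2) T.mem vs.scale_one by (metis imageE rangeI)
  have "\<exists>c. T v = scl X c x" if "v \<in> carr X" for v
    using x(2) imageI[OF that, of T] by auto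
  then obtain f where f: "\<And>v. v \<in> carr X \<Longrightarrow> T v = scl X (f v) x"
    by metis
  have f_eqI: "f v = c" if "v \<in> carr X" "T v = scl X c x" for v c
    using f[OF that(1)] that(2) x(1) vs.scale_right_imp_eq by metis
  obtain K where K: "0 < K" "\<And>x. x \<in> carr X \<Longrightarrow> nrm X (T x) \<le> K * nrm X x"
    using T.bounded by blast
  have flin: "bounded_linear_on X scalar_space f"
    unfolding bounded_linear_on_def scalar_space_simps
  proof (intro conjI ballI allI exI)
    show "f (v + w) = f v + f w" if "v \<in> carr X" "w \<in> carr X" for v w
      using that by (intro f_eqI) (simp_all add: T.add f[of v] f[of w] vs.scale_left_distrib)
    show "f (scl X c v) = c * f v" if "v \<in> carr X" for c v
      using that by (intro f_eqI) (simp_all add: T.scl f[of v])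
    show "cmod (f v) \<le> (K / nrm X x) * nrm X v" if "v \<in> carr X" for v
      using K(2)[OF that] f[OF that] norm_pos[OF xX x(1)] xX by (simp add: norm_scl field_simps)
  qed simp
  \<comment> \<open>Here dim X \<noteq> 1 enters: some \<open>z\<close> lies outside the line of
    \<open>x\<close>, and then the span of \<open>x\<close> and \<open>z\<close> meets the kernel of
    \<open>T\<close>.\<close>
  have "carr X \<noteq> range (\<lambda>c. scl X c x)"
    using dim dim_eq_1_iff[OF subspace] x(1) by blast
  moreover have "range (\<lambda>c. scl X c x) \<subseteq> carr X"
    using xX by auto
  ultimately obtain z where z: "z \<in> carr X" "\<And>c. z \<noteq> scl X c x"
    by blast
  obtain y where y: "y \<in> carr X" "y \<noteq> 0" "T y = 0"
  proof (cases "T z = 0")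
    case True
    then show ?thesis
      using that[of z] z(1) z(2)[of 0] by simp
  next
    case False
    then have fz: "f z \<noteq> 0"
      using f[OF z(1)] by auto
    \<comment> \<open>\<open>T\<close> maps \<open>x\<close> to \<open>f x\<close> times
      \<open>x\<close> and \<open>z\<close> to \<open>f z\<close> times \<open>x\<close>, so the two
      terms cancel under \<open>T\<close>.\<close>
    let ?y = "scl X (f z) x - scl X (f x) z"
    have "T ?y = 0"
      using xX z(1) by (simp add: T.diff T.scl f[of x] f[of z] mult.commute)
    moreover have "?y \<noteq> 0"
    proof
      assume eq: "?y = 0"
      show False
      proof (cases "f x = 0")
        case True
        then show False
          using eq fz x(1) by simp
      next
        case False
        have "z = scl X (inverse (f x)) (scl X (f x) z)"
          using False by simp
        also have "scl X (f x) z = scl X (f z) x"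
          using eq by simp
        also have "scl X (inverse (f x)) (scl X (f z) x) = scl X (inverse (f x) * f z) x"
          by simp
        finally show False
          using z(2) by blast
      qed
    qed
    ultimately show ?thesis
      using that[of ?y] xX z(1) by simp
  qed
  obtain h where h: "bounded_linear_on X scalar_space h" "h y \<noteq> 0"
    using separating_functional[OF y(1,2)] by blast
  have fy: "f y = 0"
    using y by (intro f_eqI) simp_all
  \<comment> \<open>The factor \<open>inverse (h y)\<close> makes \<open>A\<close> send
    \<open>y\<close> to \<open>x\<close>. The range of \<open>N\<close> lies in the line of
    \<open>y\<close>, on which \<open>f\<close> vanishes, so \<open>N\<close> squares to 0.\<close>
  define A where "A v = (if v \<in> carr X then scl X (h v) (scl X (inverse (h y)) x) else 0)" for v
  define N where "N v = (if v \<in> carr X then scl X (f v) y else 0)" for v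
  have A: "A \<in> bounded_operators X"
    using functional_operator[OF h(1), of "scl X (inverse (h y)) x"] xX by (simp add: A_def[abs_def])
  have N: "N \<in> bounded_operators X"
    using functional_operator[OF flin y(1)] by (simp add: N_def[abs_def])
  have "N \<circ> N = 0"
  proof
    fix v
    have "f (scl X c y) = 0" for c
      using flin y(1) fy by (simp add: bounded_linear_on_def)
    from this[of 0] this show "(N \<circ> N) v = 0 v"
      using y(1) by (simp add: N_def)
  qed
  then have "\<psi> N * \<psi> N = \<psi> 0"
    using \<psi> N unfolding character_def by (metis operator_algebra_simps(1,3))
  moreover have "\<psi> 0 = 0"
    using \<psi> operator_zero unfolding character_def operator_algebra_simps
    by (metis add_cancel_right_left add_0)
  ultimately have "\<psi> N = 0"
    by simp
  moreover have "T = A \<circ> N"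
  proof
    fix v
    have "h (scl X c y) = c * h y" for c
      using h(1) y(1) by (simp add: bounded_linear_on_def)
    from this[of 0] this show "T v = (A \<circ> N) v"
      using y(1) h(2) f[of v] operator_outside[OF TB, of v]
      by (simp add: A_def N_def)
  qed
  moreover have "\<psi> (A \<circ> N) = \<psi> A * \<psi> N"
    using \<psi> A N by (simp add: character_def)
  ultimately show ?thesis
    by simp
qed

text \<open>Cancel \<psi> T from \<psi> T = \<psi> T * \<psi> I for some \<open>T\<close> on which
  \<psi> is not 0.\<close>

lemma character_unit:
  assumes "character (\<B> X) \<psi>"
  shows "\<psi> (unt (\<B> X)) = 1"
proof -
  obtain T where T: "T \<in> bounded_operators X" "\<psi> T \<noteq> 0"
    using assms by (auto simp: character_def)
  have "T \<circ> unt (\<B> X) = T"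
    using operator_outside[OF T(1)] operator_linear_map[OF T(1)] 
    by (auto simp: fun_eq_iff bounded_linear_map.zero)
  moreover have "\<psi> (T \<circ> unt (\<B> X)) = \<psi> T * \<psi> (unt (\<B> X))"
    using assms T(1) operator_id by (simp add: character_def)
  ultimately show ?thesis
    using T(2) by simp
qed

end

text \<open>If \<open>\<parallel>S\<parallel> < 1\<close> and \<open>\<psi> S = 1\<close>, then applying \<open>\<psi>\<close> to the Neumann series \<open>R = I + S \<circ> R\<close> gives
  \<open>\<psi> R = 1 + \<psi> R\<close>.\<close>

lemma character_le_norm:
  fixes X :: "'a::ab_group_add cnspace"
  assumes "complex_banach_space X" and \<psi>: "character (\<B> X) \<psi>" and T: "T \<in> bounded_operators X"
  shows "cmod (\<psi> T) \<le> nrm (\<B> X) T"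
proof (rule ccontr)
  assume less: "\<not> ?thesis"
  interpret complex_banach_space X by fact
  interpret operator_space X by unfold_locales
  interpret BX: complex_normed_space "\<B> X" by (rule complex_normed_space_operators)
  have \<psi>T: "\<psi> T \<noteq> 0"
    using less operator_norm_nonneg[OF T] by auto
  define S where "S = scl (\<B> X) (inverse (\<psi> T)) T"
  have S: "S \<in> bounded_operators X"
    using operator_scl[OF T] by (simp add: S_def)
  have \<psi>S: "\<psi> S = 1"
    using \<psi> T \<psi>T unfolding S_def character_def operator_algebra_simps(1) by simp
  define k where "k = nrm (\<B> X) S"
  have "k = inverse (cmod (\<psi> T)) * nrm (\<B> X) T"
    using BX.norm_scl[of T "inverse (\<psi> T)"] T by (simp add: k_def S_def norm_inverse del: operator_algebra_simps(2))
  then have k: "k < 1"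
    using less \<psi>T by (simp add: inverse_eq_divide divide_less_eq)
  have k0: "0 \<le> k"
    unfolding k_def by (rule operator_norm_nonneg[OF S])
  interpret S: bounded_linear_map X X S by (rule operator_linear_map) fact
  have S_le: "nrm X (S x) \<le> k * nrm X x" if "x \<in> carr X" for x
    unfolding k_def using S that by (rule operator_norm_bound)
  \<comment> \<open>The series is not summed in the operator algebra: \<open>R x\<close> is found
    pointwise as the fixed point of the contraction \<open>\<lambda>y. x + S y\<close>, for which
    completeness of \<open>X\<close> suffices.\<close>
  have "\<exists>y. y \<in> carr X \<and> x + S y = y" if x: "x \<in> carr X" for x
  proof (rule ms.Banach_fixedpoint_thm[of "\<lambda>y. x + S y" k])
    show "ndist X (x + S y) (x + S z) \<le> k * ndist X y z" if "y \<in> carr X" "z \<in> carr X" for y z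
      using S_le[of "y - z"] x that by (simp add: S.diff)
  qed (use x k complete in auto)
  then obtain R0 where R0: "\<And>x. x \<in> carr X \<Longrightarrow> R0 x \<in> carr X" "\<And>x. x \<in> carr X \<Longrightarrow> x + S (R0 x) = R0 x"
    by metis
  \<comment> \<open>Uniqueness of the fixed points yields linearity of \<open>R\<close>.\<close>
  have uniq: "y = z" if "y \<in> carr X" "z \<in> carr X" "x + S y = y" "x + S z = z" for x y z
  proof -
    have "y - z = S (y - z)"
      using that by (metis S.diff add_diff_cancel_left)
    then have "nrm X (y - z) \<le> k * nrm X (y - z)"
      using S_le[of "y - z"] that by simp
    then have "(1 - k) * nrm X (y - z) \<le> 0"
      by (simp add: algebra_simps)
    then have "nrm X (y - z) \<le> 0"
      using k by (simp add: mult_le_0_iff)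
    then show ?thesis
      using norm_pos[of "y - z"] that by force
  qed
  define R where "R x = (if x \<in> carr X then R0 x else 0)" for x
  have R: "R \<in> bounded_operators X"
  proof (rule operatorI)
    fix x y assume xy: "x \<in> carr X" "y \<in> carr X"
    have "R0 (x + y) = R0 x + R0 y"
    proof (rule uniq)
      show "x + y + S (R0 x + R0 y) = R0 x + R0 y"
        using R0(2)[OF xy(1)] R0(2)[OF xy(2)] R0(1) xy
        by (simp add: S.add) (metis add.assoc add.left_commute)
    qed (use R0 xy in auto)
    then show "R (x + y) = R x + R y"
      using xy by (simp add: R_def)
  next
    fix c x assume x: "x \<in> carr X"
    have "R0 (scl X c x) = scl X c (R0 x)"
    proof (rule uniq)
      show "scl X c x + S (scl X c (R0 x)) = scl X c (R0 x)"
        using R0[OF x] by (simp add: S.scl) (metis vs.scale_right_distrib)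
    qed (use R0 x in auto)
    then show "R (scl X c x) = scl X c (R x)"
      using x by (simp add: R_def)
  next
    fix x assume x: "x \<in> carr X"
    \<comment> \<open>Absorbing the last term on the left gives the bound \<open>1 / (1 - k)\<close>
      for \<open>R\<close>.\<close>
    have "nrm X (R0 x) \<le> nrm X x + k * nrm X (R0 x)"
      using R0[OF x] norm_triangle[of x "S (R0 x)"] S_le[of "R0 x"] x by (simp only:) force
    then show "nrm X (R x) \<le> (1 / (1 - k)) * nrm X x"
      using x k by (simp add: R_def field_simps)
  qed (simp_all add: R_def R0)
  have "unt (\<B> X) + (S \<circ> R) = R"
  proof
    show "(unt (\<B> X) + (S \<circ> R)) x = R x" for x
      using R0(2)[of x] by (simp add: R_def)
  qed
  moreover have "\<psi> (unt (\<B> X) + (S \<circ> R)) = \<psi> (unt (\<B> X)) + \<psi> S * \<psi> R"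
    using \<psi> S R operator_id operator_compose[OF S R] by (simp add: character_def)
  ultimately show False
    using \<psi>S character_unit[OF \<psi>] by simp
qed

theorem character_extension:
  fixes X :: "'a::ab_group_add cnspace" and Y :: "'b::ab_group_add cnspace"
  assumes X: "complex_banach_space X" and Y: "complex_normed_space Y"
    and \<psi>: "character (\<B> X) \<psi>" and dim: "cdim X (carr X) \<noteq> 1"
    and S: "bounded_linear_on X Y S" and L: "bounded_linear_on Y X L"
    and LS: "\<And>x. x \<in> carr X \<Longrightarrow> L (S x) = x"
    and w: "w \<in> carr Y" "w \<noteq> 0" "L w = 0"
  shows "\<exists>\<phi>. algebra_hom (\<B> X) (\<B> Y) \<phi> \<and>
          continuous_map (ntop (\<B> X)) (ntop (\<B> Y)) \<phi> \<and>
          inj_on \<phi> (carr (\<B> X)) \<and>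
          \<phi> (unt (\<B> X)) = unt (\<B> Y) \<and>
          (\<forall>T. rank_one X T \<longrightarrow> rank_one Y (\<phi> T)) \<and>
          \<phi> ` carr (\<B> X) \<noteq> carr (\<B> Y)"
proof -
  interpret X: complex_banach_space X by fact
  interpret Y: complex_normed_space Y by fact
  interpret X: operator_space X by unfold_locales
  interpret Y: operator_space Y by unfold_locales
  interpret S: bounded_linear_map X Y S by unfold_locales fact
  interpret L: bounded_linear_map Y X L by unfold_locales fact
  interpret BX: complex_normed_space "\<B> X" by (rule X.complex_normed_space_operators)
  interpret BY: complex_normed_space "\<B> Y" by (rule Y.complex_normed_space_operators)
  define \<phi> where "\<phi> T y = (if y \<in> carr Y then S (T (L y)) + scl Y (\<psi> T) (y - S (L y)) else 0)" for T y
  obtain K where K: "0 < K" "\<And>x. x \<in> carr X \<Longrightarrow> nrm Y (S x) \<le> K * nrm X x"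
    using S.bounded by blast
  obtain M where M: "0 < M" "\<And>x. x \<in> carr Y \<Longrightarrow> nrm X (L x) \<le> M * nrm Y x"
    using L.bounded by blast
  \<comment> \<open>The part S T L contributes \<open>K * M\<close>, the scalar part
    \<open>1 + K * M\<close>; contractivity of \<psi> makes both proportional to the norm of
    \<open>T\<close>.\<close>
  have \<phi>_le: "nrm Y (\<phi> T y) \<le> (2 * K * M + 1) * nrm (\<B> X) T * nrm Y y"
    if T: "T \<in> bounded_operators X" and y: "y \<in> carr Y" for T y
  proof -
    interpret T: bounded_linear_map X X T by (rule X.operator_linear_map) fact
    let ?n = "nrm (\<B> X) T"
    have n: "0 \<le> ?n"
      using T by (rule X.operator_norm_nonneg)
    have "nrm X (T (L y)) \<le> ?n * (M * nrm Y y)"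
      using X.operator_norm_bound[OF T, of "L y"] mult_left_mono[OF M(2)[OF y] n] y by simp
    then have 1: "nrm Y (S (T (L y))) \<le> K * (?n * (M * nrm Y y))"
      using K(2)[of "T (L y)"] mult_left_mono[of "nrm X (T (L y))" _ K] K(1) y
      by (meson L.mem T.mem less_imp_le order_trans)
    have "nrm Y (S (L y)) \<le> K * (M * nrm Y y)"
      using K(2)[of "L y"] mult_left_mono[OF M(2)[OF y], of K] K(1) y
      by (meson L.mem less_imp_le order_trans)
    then have "nrm Y (y - S (L y)) \<le> nrm Y y + K * (M * nrm Y y)"
      using Y.norm_triangle_diff[of y "S (L y)"] y by simp
    then have "cmod (\<psi> T) * nrm Y (y - S (L y)) \<le> ?n * (nrm Y y + K * (M * nrm Y y))"
      using character_le_norm[OF X \<psi> T] n y by (intro mult_mono) (auto simp: Y.norm_nonneg)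
    moreover have "nrm Y (\<phi> T y) \<le> nrm Y (S (T (L y))) + cmod (\<psi> T) * nrm Y (y - S (L y))"
      using Y.norm_triangle[of "S (T (L y))" "scl Y (\<psi> T) (y - S (L y))"]
        Y.norm_scl[of "y - S (L y)" "\<psi> T"] y
      by (simp add: \<phi>_def del: Y.vs.scale_right_diff_distrib)
    moreover have "(2 * K * M + 1) * ?n * nrm Y y =
        K * (?n * (M * nrm Y y)) + ?n * (nrm Y y + K * (M * nrm Y y))"
      by (simp add: algebra_simps)
    ultimately show ?thesis
      using 1 by linarith
  qed
  have \<phi>_mem: "\<phi> T \<in> bounded_operators Y" if T: "T \<in> bounded_operators X" for T
  proof (rule Y.operatorI)
    interpret T: bounded_linear_map X X T by (rule X.operator_linear_map) fact
    show "\<phi> T (x + y) = \<phi> T x + \<phi> T y" if "x \<in> carr Y" "y \<in> carr Y" for x y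
      using that by (simp add: \<phi>_def S.add T.add L.add Y.vs.scale_right_distrib Y.vs.scale_right_diff_distrib)
    show "\<phi> T (scl Y c y) = scl Y c (\<phi> T y)" if "y \<in> carr Y" for c y
      using that by (simp add: \<phi>_def S.scl T.scl L.scl Y.vs.scale_right_distrib
          Y.vs.scale_right_diff_distrib mult.commute)
    show "\<phi> T y \<in> carr Y" if "y \<in> carr Y" for y
      using that by (simp add: \<phi>_def)
    show "nrm Y (\<phi> T y) \<le> (2 * K * M + 1) * nrm (\<B> X) T * nrm Y y" if "y \<in> carr Y" for y
      using T that by (rule \<phi>_le)
  qed (simp add: \<phi>_def)
  have \<phi>_add: "\<phi> (T + U) = \<phi> T + \<phi> U" if "T \<in> bounded_operators X" "U \<in> bounded_operators X" for T U
  proof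
    fix y
    interpret T: bounded_linear_map X X T by (rule X.operator_linear_map) fact
    interpret U: bounded_linear_map X X U by (rule X.operator_linear_map) fact
    have "\<psi> (T + U) = \<psi> T + \<psi> U"
      using \<psi> that by (simp add: character_def)
    then show "\<phi> (T + U) y = (\<phi> T + \<phi> U) y"
      by (simp add: \<phi>_def S.add Y.vs.scale_left_distrib algebra_simps)
  qed
  have \<phi>_scl: "\<phi> (scl (\<B> X) c T) = scl (\<B> Y) c (\<phi> T)" if "T \<in> bounded_operators X" for c T
  proof
    fix y
    interpret T: bounded_linear_map X X T by (rule X.operator_linear_map) fact
    have "\<psi> (\<lambda>x. scl X c (T x)) = c * \<psi> T"
      using \<psi> that by (simp add: character_def)
    then show "\<phi> (scl (\<B> X) c T) y = scl (\<B> Y) c (\<phi> T) y"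
      by (simp add: \<phi>_def S.scl Y.vs.scale_right_distrib)
  qed
  \<comment> \<open>Because L (I - S L) = 0. This intertwining relation is behind multiplicativity,
    injectivity and the failure of surjectivity.\<close>
  have L\<phi>: "L (\<phi> T y) = T (L y)" if "T \<in> bounded_operators X" "y \<in> carr Y" for T y
  proof -
    interpret T: bounded_linear_map X X T by (rule X.operator_linear_map) fact
    show ?thesis
      using that by (simp add: \<phi>_def L.add L.scl L.diff LS)
  qed
  have \<phi>_mult: "\<phi> (T \<circ> U) = \<phi> T \<circ> \<phi> U" if "T \<in> bounded_operators X" "U \<in> bounded_operators X" for T U
  proof
    fix y
    interpret T: bounded_linear_map X X T by (rule X.operator_linear_map) fact
    interpret U: bounded_linear_map X X U by (rule X.operator_linear_map) fact
    have "\<psi> (T \<circ> U) = \<psi> T * \<psi> U"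
      using \<psi> that by (simp add: character_def)
    moreover have "\<phi> T 0 = 0"
      using Y.operator_linear_map[OF \<phi>_mem[OF that(1)]] by (rule bounded_linear_map.zero)
    moreover have "\<phi> U y \<in> carr Y" if "y \<in> carr Y"
      using that by (simp add: \<phi>_def)
    ultimately show "\<phi> (T \<circ> U) y = (\<phi> T \<circ> \<phi> U) y"
    proof (cases "y \<in> carr Y")
      case True
      then have "\<phi> T (\<phi> U y) = S (T (U (L y))) + scl Y (\<psi> T) (\<phi> U y - S (U (L y)))"
        using L\<phi>[OF that(2)] \<open>y \<in> carr Y \<Longrightarrow> \<phi> U y \<in> carr Y\<close> by (simp add: \<phi>_def)
      also have "\<phi> U y - S (U (L y)) = scl Y (\<psi> U) (y - S (L y))"
        using True by (simp add: \<phi>_def)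
      finally show ?thesis
        using True \<open>\<psi> (T \<circ> U) = \<psi> T * \<psi> U\<close> by (simp add: \<phi>_def)
    qed (simp add: \<phi>_def)
  qed
  have hom: "algebra_hom (\<B> X) (\<B> Y) \<phi>"
    unfolding algebra_hom_def operator_algebra_simps(1,3)
    using \<phi>_mem \<phi>_add \<phi>_scl \<phi>_mult by blast
  moreover have "continuous_map (ntop (\<B> X)) (ntop (\<B> Y)) \<phi>"
    unfolding ntop_def BX.ms.metric_continuous_map[OF BY.ms.Metric_space_axioms]
  proof (intro conjI ballI allI impI)
    show "\<phi> ` carr (\<B> X) \<subseteq> carr (\<B> Y)"
      using \<phi>_mem by auto
    fix T and e :: real assume T: "T \<in> carr (\<B> X)" and e: "0 < e"
    let ?C = "2 * K * M + 1"
    have C: "0 < ?C"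
      using K(1) M(1) by (simp add: add_pos_pos)
    have "ndist (\<B> Y) (\<phi> T) (\<phi> U) < e" if U: "U \<in> carr (\<B> X)" and d: "ndist (\<B> X) T U < e / ?C" for U
    proof -
      have TU: "T - U \<in> bounded_operators X"
        using T U X.operator_diff by simp
      have "\<phi> T = \<phi> (T - U) + \<phi> U"
        using \<phi>_add[OF TU, of U] U by simp
      then have "\<phi> T - \<phi> U = \<phi> (T - U)"
        by simp
      then have "ndist (\<B> Y) (\<phi> T) (\<phi> U) = nrm (\<B> Y) (\<phi> (T - U))"
        using BY.ndist_eq[of "\<phi> T" "\<phi> U"] \<phi>_mem T U by simp
      also have "\<dots> \<le> ?C * nrm (\<B> X) (T - U)"
        using \<phi>_le[OF TU] C X.operator_norm_nonneg[OF TU] by (intro Y.operator_norm_le) auto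
      also have "\<dots> < e"
        using d T U C by (simp add: field_simps)
      finally show ?thesis .
    qed
    then show "\<exists>d>0. \<forall>U. U \<in> carr (\<B> X) \<and> ndist (\<B> X) T U < d \<longrightarrow> ndist (\<B> Y) (\<phi> T) (\<phi> U) < e"
      using e C by (intro exI[of _ "e / ?C"]) auto
  qed
  moreover have "inj_on \<phi> (carr (\<B> X))"
  proof (rule inj_onI)
    fix T U assume TU: "T \<in> carr (\<B> X)" "U \<in> carr (\<B> X)" "\<phi> T = \<phi> U"
    show "T = U"
    proof
      fix x
      show "T x = U x"
      proof (cases "x \<in> carr X")
        case True
        have "T x = L (\<phi> T (S x))" "U x = L (\<phi> U (S x))"
          using L\<phi>[of _ "S x"] TU(1,2) True LS by simp_all
        then show ?thesis
          using TU(3) by simp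
      next
        case False
        then show ?thesis
          using X.operator_outside[of T x] X.operator_outside[of U x] TU(1,2) by simp
      qed
    qed
  qed
  moreover have "\<phi> (unt (\<B> X)) = unt (\<B> Y)"
    using X.character_unit[OF \<psi>] by (auto simp: fun_eq_iff \<phi>_def)
  moreover have "rank_one Y (\<phi> T)" if T: "rank_one X T" for T
  proof -
    have TB: "T \<in> bounded_operators X"
      using T by (simp add: rank_one_def)
    interpret T: bounded_linear_map X X T by (rule X.operator_linear_map) fact
    obtain x where x: "x \<noteq> 0" "T ` carr X = range (\<lambda>c. scl X c x)"
      using T by (auto simp: X.rank_one_iff)
    have xX: "x \<in> carr X"
      using x(2) T.mem X.vs.scale_one by (metis imageE rangeI)
    have "L ` carr Y = carr X"
    proof
      show "carr X \<subseteq> L ` carr Y"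
        using LS S.mem by (metis image_eqI subsetI)
    qed auto
    \<comment> \<open>As \<psi> T = 0, only S T L remains, and \<open>L\<close> is onto.\<close>
    have "\<phi> T ` carr Y = (\<lambda>y. S (T (L y))) ` carr Y"
      using X.character_rank_one[OF \<psi> dim T] by (intro image_cong) (simp_all add: \<phi>_def)
    also have "\<dots> = S ` T ` L ` carr Y"
      by (simp add: image_image)
    also have "\<dots> = range (\<lambda>c. scl Y c (S x))"
      unfolding \<open>L ` carr Y = carr X\<close> x(2) by (simp add: image_image S.scl xX)
    finally have "\<phi> T ` carr Y = range (\<lambda>c. scl Y c (S x))" .
    moreover have "S x \<noteq> 0"
      using LS[OF xX] x(1) by auto
    ultimately show ?thesis
      using \<phi>_mem[OF TB] by (auto simp: Y.rank_one_iff)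
  qed
  moreover have "\<phi> ` carr (\<B> X) \<noteq> carr (\<B> Y)"
  proof
    assume eq: "\<phi> ` carr (\<B> X) = carr (\<B> Y)"
    obtain g where g: "bounded_linear_on Y scalar_space g" "g w \<noteq> 0"
      using Y.separating_functional[OF w(1,2)] by blast
    \<comment> \<open>On the zero space the unit would be 0, contrary to \<psi> I = 1.\<close>
    have "carr X \<noteq> {0}"
    proof
      assume "carr X = {0}"
      then have "unt (\<B> X) = 0"
        by (auto simp: fun_eq_iff)
      moreover have "\<psi> 0 = \<psi> 0 + \<psi> 0"
        using \<psi> X.operator_zero unfolding character_def operator_algebra_simps by (metis add_0)
      ultimately show False
        using X.character_unit[OF \<psi>] by simp
    qed
    then obtain x where x: "x \<in> carr X" "x \<noteq> 0"
      using X.zero_mem by blast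
    \<comment> \<open>This operator moves \<open>w\<close> out of the kernel of \<open>L\<close>,
      whereas every \<phi> T leaves that kernel invariant.\<close>
    define R where "R y = (if y \<in> carr Y then scl Y (g y) (S x) else 0)" for y
    have "R \<in> carr (\<B> Y)"
      using Y.functional_operator[OF g(1), of "S x"] x(1) by (simp add: R_def[abs_def])
    then obtain T where T: "T \<in> bounded_operators X" "R = \<phi> T"
      using eq by auto
    interpret T: bounded_linear_map X X T by (rule X.operator_linear_map) fact
    have "L (R w) = T (L w)"
      using L\<phi> T w(1) by simp
    then have "scl X (g w) x = 0"
      using w x by (simp add: R_def L.scl LS)
    then show False
      using g(2) x(2) by simp
  qed
  ultimately show ?thesis
    by blast
qed

section \<open>Characters from nets escaping the space\<close>

text \<open>
  The functions \<open>u \<alpha>\<close> converge pointwise to a function \<open>e\<close> outside \<open>X\<close>, which plays the role of an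
  element of the bidual such that the bidual of \<open>T\<close> maps \<open>e\<close> into \<open>X + \<complex> e\<close>. The character is the
  coefficient of \<open>e\<close>.
\<close>

theorem ex_character:
  fixes X :: "('i \<Rightarrow> complex) cnspace" and u :: "'j \<Rightarrow> 'i \<Rightarrow> complex"
  assumes X: "complex_normed_space X" and scl: "scl X = (\<lambda>c x i. c * x i)"
    and F: "F \<noteq> bot"
    and u: "\<And>\<alpha>. u \<alpha> \<in> carr X" "\<And>\<alpha>. nrm X (u \<alpha>) \<le> M" "\<And>i. ((\<lambda>\<alpha>. u \<alpha> i) \<longlongrightarrow> e i) F"
    and e: "e \<notin> carr X"
    and decomp: "\<And>T. T \<in> bounded_operators X \<Longrightarrow>
      \<exists>g\<in>carr X. \<exists>c. \<forall>i. ((\<lambda>\<alpha>. T (u \<alpha>) i) \<longlongrightarrow> g i + c * e i) F"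
    and null: "\<And>w N T i. (\<And>\<alpha>. w \<alpha> \<in> carr X) \<Longrightarrow> (\<And>\<alpha>. nrm X (w \<alpha>) \<le> N) \<Longrightarrow>
      (\<And>j. ((\<lambda>\<alpha>. w \<alpha> j) \<longlongrightarrow> 0) F) \<Longrightarrow> T \<in> bounded_operators X \<Longrightarrow>
      ((\<lambda>\<alpha>. T (w \<alpha>) i) \<longlongrightarrow> 0) F"
  shows "\<exists>\<psi>. character (\<B> X) \<psi>"
proof -
  interpret complex_normed_space X by fact
  interpret operator_space X by unfold_locales
  define P where "P T g c \<longleftrightarrow> g \<in> carr X \<and> (\<forall>i. ((\<lambda>\<alpha>. T (u \<alpha>) i) \<longlongrightarrow> g i + c * e i) F)" for T g c
  \<comment> \<open>Two different coefficients would exhibit \<open>e\<close> as a multiple of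
    \<open>g - g'\<close>, hence as an element of \<open>X\<close>.\<close>
  have unique: "c = c'" if "P T g c" "P T g' c'" for T g g' c c'
  proof (rule ccontr)
    assume ne: "c \<noteq> c'"
    have eq: "g i + c * e i = g' i + c' * e i" for i
      using that F unfolding P_def by (blast intro: tendsto_unique)
    have "e = scl X (inverse (c' - c)) (g - g')"
    proof
      show "e i = scl X (inverse (c' - c)) (g - g') i" for i
        using eq[of i] ne by (simp add: scl field_simps)
    qed
    moreover have "scl X (inverse (c' - c)) (g - g') \<in> carr X"
      using that by (simp add: P_def)
    ultimately show False
      using e by simp
  qed
  have ex: "\<exists>g c. P T g c" if "T \<in> bounded_operators X" for T
    using decomp[OF that] by (auto simp: P_def)
  define \<psi> where "\<psi> T = (THE c. \<exists>g. P T g c)" for T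
  have \<psi>_eq: "\<psi> T = c" if "P T g c" for T g c
    unfolding \<psi>_def using that unique by blast
  have "P (\<lambda>x. if x \<in> carr X then x else 0) 0 1"
    using u by (simp add: P_def)
  then have one: "\<psi> (\<lambda>x. if x \<in> carr X then x else 0) = 1"
    by (rule \<psi>_eq)
  have add: "\<psi> (S + T) = \<psi> S + \<psi> T" if ST: "S \<in> bounded_operators X" "T \<in> bounded_operators X" for S T
  proof -
    obtain g c g' c' where gc: "P S g c" "P T g' c'"
      using ex ST by blast
    have "P (S + T) (g + g') (c + c')"
      unfolding P_def
    proof (intro conjI allI)
      show "((\<lambda>\<alpha>. (S + T) (u \<alpha>) i) \<longlongrightarrow> (g + g') i + (c + c') * e i) F" for i
        using tendsto_add[of "\<lambda>\<alpha>. S (u \<alpha>) i" _ F "\<lambda>\<alpha>. T (u \<alpha>) i"] gc by (force simp: P_def algebra_simps)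
    qed (use gc in \<open>simp add: P_def\<close>)
    then show ?thesis
      using \<psi>_eq gc by metis
  qed
  have scale: "\<psi> (scl (\<B> X) a T) = a * \<psi> T" if T: "T \<in> bounded_operators X" for a T
  proof -
    obtain g c where gc: "P T g c"
      using ex T by blast
    have "P (scl (\<B> X) a T) (scl X a g) (a * c)"
      unfolding P_def
    proof (intro conjI allI)
      show "((\<lambda>\<alpha>. scl (\<B> X) a T (u \<alpha>) i) \<longlongrightarrow> scl X a g i + a * c * e i) F" for i
        using tendsto_mult_left[of "\<lambda>\<alpha>. T (u \<alpha>) i" "g i + c * e i" F a] gc
        by (simp add: P_def scl algebra_simps)
    qed (use gc in \<open>simp add: P_def\<close>)
    then show ?thesis
      using \<psi>_eq gc by metis
  qed
  have mult: "\<psi> (S \<circ> T) = \<psi> S * \<psi> T" if ST: "S \<in> bounded_operators X" "T \<in> bounded_operators X" for S T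
  proof -
    interpret S: bounded_linear_map X X S by (rule operator_linear_map) fact
    interpret T: bounded_linear_map X X T by (rule operator_linear_map) fact
    obtain g c g' c' where gc: "P S g c" "P T g' c'"
      using ex ST by blast
    then have g: "g \<in> carr X" "g' \<in> carr X"
      by (simp_all add: P_def)
    \<comment> \<open>The error in replacing \<open>T (u \<alpha>)\<close> by its limit
      \<open>g' + c' * e\<close>, with \<open>u \<alpha>\<close> in the place of \<open>e\<close>.
      It stays in \<open>X\<close>, is bounded and tends to 0 pointwise, so \<open>null\<close>
      removes it after \<open>S\<close> is applied; this replaces weak-star continuity of the bidual
      of \<open>S\<close>.\<close>
    define w where "w \<alpha> = T (u \<alpha>) - g' - scl X c' (u \<alpha>)" for \<alpha>
    have w: "w \<alpha> \<in> carr X" for \<alpha>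
      using u g by (simp add: w_def)
    obtain K where K: "0 < K" "\<And>x. x \<in> carr X \<Longrightarrow> nrm X (T x) \<le> K * nrm X x"
      using T.bounded by blast
    have bound: "nrm X (w \<alpha>) \<le> K * M + nrm X g' + cmod c' * M" for \<alpha>
    proof -
      have "nrm X (w \<alpha>) \<le> nrm X (T (u \<alpha>)) + nrm X g' + nrm X (scl X c' (u \<alpha>))"
        unfolding w_def using norm_triangle_diff[of "T (u \<alpha>) - g'" "scl X c' (u \<alpha>)"]
          norm_triangle_diff[of "T (u \<alpha>)" g'] u g by simp
      moreover have "K * nrm X (u \<alpha>) \<le> K * M" "cmod c' * nrm X (u \<alpha>) \<le> cmod c' * M"
        using u(2)[of \<alpha>] K(1) by (simp_all add: mult_left_mono)
      ultimately show ?thesis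
        using K(2)[OF u(1), of \<alpha>] norm_scl[OF u(1), of c' \<alpha>] by linarith
    qed
    have w0: "((\<lambda>\<alpha>. w \<alpha> i) \<longlongrightarrow> 0) F" for i
    proof -
      have "((\<lambda>\<alpha>. T (u \<alpha>) i - g' i - c' * u \<alpha> i) \<longlongrightarrow> (g' i + c' * e i) - g' i - c' * e i) F"
        using gc(2) u(3) by (intro tendsto_intros) (simp add: P_def)
      then show ?thesis
        by (simp add: w_def scl)
    qed
    \<comment> \<open>Formally, S (T e) = S (g' + c' e) = S g' + c' (g + c e).\<close>
    have "P (S \<circ> T) (S g' + scl X c' g) (c * c')"
      unfolding P_def
    proof (intro conjI allI)
      fix i
      have "((\<lambda>\<alpha>. S (w \<alpha>) i + S g' i + c' * S (u \<alpha>) i) \<longlongrightarrow> 0 + S g' i + c' * (g i + c * e i)) F"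
        using gc(1) null[OF w bound w0 ST(1)] by (intro tendsto_intros) (simp_all add: P_def)
      moreover have "S (T (u \<alpha>)) i = S (w \<alpha>) i + S g' i + c' * S (u \<alpha>) i" for \<alpha>
      proof -
        have "S (w \<alpha>) = S (T (u \<alpha>)) - S g' - scl X c' (S (u \<alpha>))"
          using u g by (simp add: w_def S.diff S.scl)
        then show ?thesis
          by (simp add: scl)
      qed
      ultimately show "((\<lambda>\<alpha>. (S \<circ> T) (u \<alpha>) i) \<longlongrightarrow> (S g' + scl X c' g) i + c * c' * e i) F"
        by (simp add: scl algebra_simps)
    qed (use g in simp)
    then show ?thesis
      using \<psi>_eq gc by metis
  qed
  have "character (\<B> X) \<psi>"
    unfolding character_def operator_algebra_simps(1,3)
  proof (intro conjI ballI allI bexI)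
    show "\<psi> (\<lambda>x. if x \<in> carr X then x else 0) \<noteq> 0"
      by (simp add: one)
  qed (fact add scale mult operator_id)+
  then show ?thesis
    by blast
qed

section \<open>Direct sums\<close>

lemma direct_sum_simps [simp]:
  "carr (direct_sum X Z) = carr X \<times> carr Z"
  "scl (direct_sum X Z) = (\<lambda>c (x, z). (scl X c x, scl Z c z))"
  "nrm (direct_sum X Z) = (\<lambda>(x, z). nrm X x + nrm Z z)"
  by (simp_all add: direct_sum_def)

lemma normed_direct_sum:
  assumes "complex_normed_space X" "complex_normed_space Z"
  shows "complex_normed_space (direct_sum X Z)"
proof -
  interpret X: complex_normed_space X by fact
  interpret Z: complex_normed_space Z by fact
  show ?thesis
  proof (rule complex_normed_space.intro)
    show vs: "vector_space (scl (direct_sum X Z))"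
      by unfold_locales (auto simp: X.vs.scale_right_distrib X.vs.scale_left_distrib
          Z.vs.scale_right_distrib Z.vs.scale_left_distrib)
    interpret v: vector_space "scl (direct_sum X Z)" by (rule vs)
    show "module.subspace (scl (direct_sum X Z)) (carr (direct_sum X Z))"
      unfolding v.subspace_def by (auto simp: zero_prod_def)
    fix v assume v: "v \<in> carr (direct_sum X Z)"
    show "0 \<le> nrm (direct_sum X Z) v"
      using v by (auto simp: X.norm_nonneg Z.norm_nonneg)
    show "nrm (direct_sum X Z) v = 0 \<longleftrightarrow> v = 0"
      using v by (auto simp: zero_prod_def add_nonneg_eq_0_iff X.norm_nonneg Z.norm_nonneg
          X.norm_eq_0_iff Z.norm_eq_0_iff)
    show "nrm (direct_sum X Z) (scl (direct_sum X Z) c v) = cmod c * nrm (direct_sum X Z) v" for c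
      using v by (auto simp: X.norm_scl Z.norm_scl distrib_left)
    fix w assume w: "w \<in> carr (direct_sum X Z)"
    show "nrm (direct_sum X Z) (v + w) \<le> nrm (direct_sum X Z) v + nrm (direct_sum X Z) w"
    proof -
      obtain x z x' z' where "v = (x, z)" "w = (x', z')" "x \<in> carr X" "z \<in> carr Z" "x' \<in> carr X" "z' \<in> carr Z"
        using v w by auto
      then show ?thesis
        using X.norm_triangle[of x x'] Z.norm_triangle[of z z'] by simp
    qed
  qed
qed

lemma direct_sum_extension:
  fixes X :: "'a::ab_group_add cnspace" and Z :: "'b::ab_group_add cnspace"
  assumes X: "complex_banach_space X" and dim: "cdim X (carr X) \<noteq> 1" and \<psi>: "character (\<B> X) \<psi>"
    and Z: "complex_banach_space Z" "carr Z \<noteq> {0}"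
  shows "\<exists>\<phi>. algebra_hom (\<B> X) (\<B> (direct_sum X Z)) \<phi> \<and>
    continuous_map (ntop (\<B> X)) (ntop (\<B> (direct_sum X Z))) \<phi> \<and>
    inj_on \<phi> (carr (\<B> X)) \<and>
    \<phi> (unt (\<B> X)) = unt (\<B> (direct_sum X Z)) \<and>
    (\<forall>T. rank_one X T \<longrightarrow> rank_one (direct_sum X Z) (\<phi> T)) \<and>
    \<phi> ` carr (\<B> X) \<noteq> carr (\<B> (direct_sum X Z))"
proof -
  interpret X: complex_banach_space X by fact
  interpret Z: complex_banach_space Z by fact
  have XZ: "complex_normed_space (direct_sum X Z)"
    using X.complex_normed_space_axioms Z.complex_normed_space_axioms by (rule normed_direct_sum)
  have S: "bounded_linear_on X (direct_sum X Z) (\<lambda>x. (x, 0))"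
    unfolding bounded_linear_on_def by (auto intro!: exI[of _ 1])
  have L: "bounded_linear_on (direct_sum X Z) X fst"
    unfolding bounded_linear_on_def by (auto simp: Z.norm_nonneg intro!: exI[of _ 1])
  obtain z where z: "z \<in> carr Z" "z \<noteq> 0"
    using Z(2) Z.zero_mem by blast
  show ?thesis
    by (rule character_extension[OF X XZ \<psi> dim S L, of "(0, z)"]) (use z in \<open>auto simp: zero_prod_def\<close>)
qed

section \<open>James spaces\<close>

text \<open>Finite increasing sequences of indices are lists, so that they can be concatenated and split.\<close>

fun pvar :: "real \<Rightarrow> (nat \<Rightarrow> complex) \<Rightarrow> nat list \<Rightarrow> real" where
  "pvar p x [] = 0"
| "pvar p x [a] = 0"
| "pvar p x (a # b # l) = cmod (x b - x a) powr p + pvar p x (b # l)"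

lemma pvar_nonneg: "0 \<le> pvar p x l"
  by (induction p x l rule: pvar.induct) simp_all

text \<open>Links the recursion to the indexed sums that define the norm; list positions start at
  0.\<close>

lemma pvar_eq_sum: "pvar p x l = (\<Sum>j=1..length l - 1. cmod (x (l ! j) - x (l ! (j - 1))) powr p)"
proof (induction p x l rule: pvar.induct)
  case (3 p x a b l)
  have "(\<Sum>j=1..length (a # b # l) - 1. cmod (x ((a # b # l) ! j) - x ((a # b # l) ! (j - 1))) powr p) =
      (\<Sum>j=0..length l. cmod (x ((b # l) ! j) - x ((a # b # l) ! j)) powr p)"
    by (rule sum.reindex_bij_witness[of _ Suc "\<lambda>j. j - 1"]) auto
  also have "\<dots> = cmod (x b - x a) powr p + (\<Sum>j=1..length l. cmod (x ((b # l) ! j) - x ((a # b # l) ! j)) powr p)"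
    by (simp add: sum.atLeast_Suc_atMost)
  also have "(\<Sum>j=1..length l. cmod (x ((b # l) ! j) - x ((a # b # l) ! j)) powr p) =
      (\<Sum>j=1..length l. cmod (x ((b # l) ! j) - x ((b # l) ! (j - 1))) powr p)"
    by (intro sum.cong refl) (auto simp: nth_Cons')
  finally show ?case
    using 3 by simp
qed simp_all

lemma pvar_short: "\<not> 2 \<le> length l \<Longrightarrow> pvar p x l = 0"
  by (cases "(p, x, l)" rule: pvar.cases) auto

lemma pvar_cong: "(\<And>i. i \<in> set l \<Longrightarrow> x i = y i) \<Longrightarrow> pvar p x l = pvar p y l"
  by (induction p x l rule: pvar.induct) auto

lemma pvar_const: "pvar p (\<lambda>i. c) l = 0"
  by (induction p "\<lambda>i :: nat. c" l rule: pvar.induct) simp_all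

lemma pvar_add_const: "pvar p (\<lambda>i. x i + c) l = pvar p x l"
  by (induction p x l rule: pvar.induct) simp_all

lemma pvar_map: "pvar p x (map f l) = pvar p (\<lambda>i. x (f i)) l"
  by (induction p "\<lambda>i. x (f i)" l rule: pvar.induct) simp_all

lemma pvar_scale: "pvar p (\<lambda>i. c * x i) l = cmod c powr p * pvar p x l"
proof (induction p x l rule: pvar.induct)
  case (3 p x a b l)
  have "cmod (c * x b - c * x a) powr p = cmod c powr p * cmod (x b - x a) powr p"
    by (metis norm_mult norm_ge_zero powr_mult right_diff_distrib)
  then show ?case
    using 3 by (simp add: distrib_left)
qed simp_all

lemma pvar_append_ge: "pvar p x l + pvar p x l' \<le> pvar p x (l @ l')"
proof (induction p x l rule: pvar.induct)
  case (2 p x a)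
  then show ?case
    by (cases l') simp_all
qed simp_all

text \<open>Concatenation adds a single difference, the one at the junction, and its modulus is at
  most \<open>2 * M\<close>.\<close>

lemma pvar_append_le:
  assumes "0 \<le> p"
  shows "(\<And>i. i \<in> set (l @ l') \<Longrightarrow> cmod (x i) \<le> M) \<Longrightarrow>
    pvar p x (l @ l') \<le> pvar p x l + pvar p x l' + (2 * M) powr p"
proof (induction l rule: induct_list012)
  case (2 a)
  show ?case
  proof (cases l')
    case (Cons b k)
    have "cmod (x b - x a) \<le> 2 * M"
      using norm_triangle_ineq4[of "x b" "x a"] 2[of a] 2[of b] Cons by simp
    then show ?thesis
      using Cons powr_mono2[OF assms, of "cmod (x b - x a)" "2 * M"] by simp
  qed simp
qed simp_all

text \<open>A bound on the variation along every finite list therefore passes to pointwise limits,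
  which is how limits are shown to lie in the James space.\<close>

lemma tendsto_pvar:
  assumes "0 < p" "\<And>i. ((\<lambda>n. y n i) \<longlongrightarrow> z i) F"
  shows "((\<lambda>n. pvar p (y n) l) \<longlongrightarrow> pvar p z l) F"
proof (induction l rule: induct_list012)
  case (3 a b l)
  have "((\<lambda>n. cmod (y n b - y n a) powr p + pvar p (y n) (b # l)) \<longlongrightarrow>
      cmod (z b - z a) powr p + pvar p z (b # l)) F"
    using assms 3 by (intro tendsto_intros tendsto_powr') auto
  then show ?case
    by simp
qed simp_all

lemma powr_le_cancel:
  assumes "0 < p" "0 \<le> b" "a powr p \<le> b powr p"
  shows "a \<le> (b :: real)"
  using powr_less_mono2[of p b a] assms by linarith

lemma convex_powr_scale:
  assumes "1 \<le> p" "0 \<le> t" "t \<le> 1" "0 \<le> (s :: real)"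
  shows "(t * s) powr p \<le> t * s powr p"
proof (cases "t = 0")
  case False
  have "t powr p \<le> t powr 1"
    using assms False by (intro powr_mono') auto
  then show ?thesis
    using assms by (simp add: powr_mult mult_right_mono)
qed simp

lemma convex_powr:
  assumes p: "1 \<le> p" and t: "0 \<le> t" "t \<le> 1" and ab: "0 \<le> a" "0 \<le> (b :: real)"
  shows "(t * a + (1 - t) * b) powr p \<le> t * a powr p + (1 - t) * b powr p"
proof -
  consider "a = 0" | "b = 0" | "0 < a" "0 < b"
    using ab by linarith
  then show ?thesis
  proof cases
    case 3
    then show ?thesis
      using convex_onD[OF powr_convex[OF p], of "1 - t" a b] t by simp
  qed (use convex_powr_scale[OF p, of "1 - t" b] convex_powr_scale[OF p t, of a] t ab in simp_all)
qed

text \<open>Minkowski's inequality from convexity of the p-th power: a + b is A + B times the convex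
  combination of a / A and b / B with weights A / (A + B) and B / (A + B).\<close>

lemma pvar_add_le:
  assumes p: "1 \<le> p" and A: "0 < A" and B: "0 < (B :: real)"
  shows "pvar p (\<lambda>i. x i + y i) l \<le>
    (A + B) powr p * (A / (A + B) * (pvar p x l / A powr p) + B / (A + B) * (pvar p y l / B powr p))"
proof (induction l rule: induct_list012)
  case (3 i j l)
  define a where "a = cmod (x j - x i)"
  define b where "b = cmod (y j - y i)"
  define t where "t = A / (A + B)"
  have t: "0 \<le> t" "t \<le> 1" "1 - t = B / (A + B)"
    using A B by (simp_all add: t_def field_simps)
  have "cmod (x j + y j - (x i + y i)) \<le> a + b"
    unfolding a_def b_def by (metis add_diff_add norm_triangle_ineq)
  also have "a + b = (A + B) * (t * (a / A) + (1 - t) * (b / B))"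
  proof -
    have "(A + B) * t = A" "(A + B) * (1 - t) = B"
      unfolding t(3) unfolding t_def using A B by simp_all
    moreover have "(A + B) * (t * (a / A) + (1 - t) * (b / B)) = ((A + B) * t) * (a / A) + ((A + B) * (1 - t)) * (b / B)"
      by (simp only: distrib_left mult.assoc)
    ultimately show ?thesis
      using A B by simp
  qed
  finally have "cmod (x j + y j - (x i + y i)) powr p \<le> ((A + B) * (t * (a / A) + (1 - t) * (b / B))) powr p"
    using p by (intro powr_mono2) auto
  also have "\<dots> = (A + B) powr p * (t * (a / A) + (1 - t) * (b / B)) powr p"
    by (rule powr_mult)
  also have "\<dots> \<le> (A + B) powr p * (t * (a / A) powr p + (1 - t) * (b / B) powr p)"
    using A B t by (intro mult_left_mono convex_powr p) (auto simp: a_def b_def)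
  also have "\<dots> = (A + B) powr p * (A / (A + B) * (a powr p / A powr p) + B / (A + B) * (b powr p / B powr p))"
    unfolding t(3) unfolding t_def by (simp add: powr_divide)
  finally show ?case
    using 3(2) by (simp add: a_def b_def add_divide_distrib distrib_left)
qed simp_all

lemma pvar_add_le':
  assumes p: "1 \<le> p" and A: "0 < A" "pvar p x l \<le> A powr p" and B: "0 < B" "pvar p y l \<le> B powr p"
  shows "pvar p (\<lambda>i. x i + y i) l \<le> (A + B) powr p"
proof -
  have "pvar p x l / A powr p \<le> 1" "pvar p y l / B powr p \<le> 1"
    using A B by simp_all
  then have "A / (A + B) * (pvar p x l / A powr p) + B / (A + B) * (pvar p y l / B powr p) \<le>
      A / (A + B) * 1 + B / (A + B) * 1"
    using A(1) B(1) by (intro add_mono mult_left_mono) auto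
  also have "\<dots> = 1"
    using A(1) B(1) by (simp flip: add_divide_distrib)
  finally have "(A + B) powr p * (A / (A + B) * (pvar p x l / A powr p) + B / (A + B) * (pvar p y l / B powr p)) \<le> (A + B) powr p * 1"
    by (rule mult_left_mono) simp
  then show ?thesis
    using pvar_add_le[OF p A(1) B(1), of x y l] by simp
qed

lemma sorted_split:
  fixes l :: "nat list"
  assumes "sorted_wrt (<) l"
  shows "l = filter (\<lambda>i. i < N) l @ filter (\<lambda>i. \<not> i < N) l"
  using assms
proof (induction l)
  case (Cons a l)
  show ?case
  proof (cases "a < N")
    case False
    then have "filter (\<lambda>i. i < N) l = []"
      using Cons.prems by (auto simp: filter_empty_conv)
    then show ?thesis
      using Cons False by simp
  qed (use Cons in simp)
qed simp

text \<open>An increasing list crosses \<open>N\<close> only once, so gluing two sequences at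
  \<open>N\<close> costs one jump. Truncations, unit blocks, humps and the right shift are all
  estimated in this way.\<close>

lemma pvar_splice:
  assumes "0 \<le> p" "sorted_wrt (<) l"
    and M: "\<And>i. i < N \<Longrightarrow> cmod (x i) \<le> M" "\<And>i. N \<le> i \<Longrightarrow> cmod (y i) \<le> M"
    and A: "\<And>k. sorted_wrt (<) k \<Longrightarrow> set k \<subseteq> {..<N} \<Longrightarrow> pvar p x k \<le> A"
    and B: "\<And>k. sorted_wrt (<) k \<Longrightarrow> set k \<subseteq> {N..} \<Longrightarrow> pvar p y k \<le> B"
  shows "pvar p (\<lambda>i. if i < N then x i else y i) l \<le> A + B + (2 * M) powr p"
proof -
  let ?z = "\<lambda>i. if i < N then x i else y i"
  let ?l = "filter (\<lambda>i. i < N) l" and ?r = "filter (\<lambda>i. \<not> i < N) l"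
  have "pvar p ?z l = pvar p ?z (?l @ ?r)"
    using sorted_split[OF assms(2), of N] by simp
  also have "\<dots> \<le> pvar p ?z ?l + pvar p ?z ?r + (2 * M) powr p"
    using M by (intro pvar_append_le assms(1)) auto
  also have "pvar p ?z ?l = pvar p x ?l"
    by (rule pvar_cong) simp
  also have "pvar p ?z ?r = pvar p y ?r"
    by (rule pvar_cong) simp
  also have "pvar p x ?l \<le> A"
    using assms(2) by (intro A sorted_wrt_filter) auto
  also have "pvar p y ?r \<le> B"
    using assms(2) by (intro B sorted_wrt_filter) auto
  finally show ?thesis
    by simp
qed

text \<open>Choose a list whose variation is within \<open>e\<close> of the supremum. Every list
  beyond it can be appended to it, so only \<open>e\<close> is left for the latter.\<close>

lemma pvar_tail:
  assumes bound: "\<And>l. sorted_wrt (<) l \<Longrightarrow> pvar p x l \<le> C" and e: "0 < e"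
  shows "\<exists>N. \<forall>l. sorted_wrt (<) l \<longrightarrow> set l \<subseteq> {N..} \<longrightarrow> pvar p x l \<le> e"
proof -
  define S where "S = (SUP l\<in>{l. sorted_wrt (<) l}. pvar p x l)"
  have bdd: "bdd_above (pvar p x ` {l. sorted_wrt (<) l})"
    using bound by (intro bdd_aboveI2[of _ _ C]) auto
  have ne: "{l :: nat list. sorted_wrt (<) l} \<noteq> {}"
    by (auto intro: exI[of _ "[]"])
  have "S - e < S"
    using e by simp
  then obtain k where k: "sorted_wrt (<) k" "S - e < pvar p x k"
    unfolding S_def less_cSUP_iff[OF ne bdd] by auto
  \<comment> \<open>The sum of the entries dominates each of them.\<close>
  define N where "N = Suc (sum_list k)"
  have "pvar p x l \<le> e" if l: "sorted_wrt (<) l" "set l \<subseteq> {N..}" for l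
  proof -
    have "i < j" if "i \<in> set k" "j \<in> set l" for i j
    proof -
      have "i < N" "N \<le> j"
        using member_le_sum_list[OF that(1)] l(2) that(2) by (auto simp: N_def)
      then show ?thesis
        by simp
    qed
    then have "sorted_wrt (<) (k @ l)"
      using k(1) l(1) by (simp add: sorted_wrt_append)
    then have "pvar p x (k @ l) \<le> S"
      unfolding S_def using bdd by (intro cSUP_upper) auto
    then show ?thesis
      using k(2) pvar_append_ge[of p x k l] by linarith
  qed
  then show ?thesis
    by blast
qed

section \<open>The James space as a Banach space\<close>

locale james =
  fixes p :: real
  assumes p: "1 < p"
begin

abbreviation (input) "J \<equiv> james_space p"

lemma carr_J: "carr J = {x. x \<longlonglongrightarrow> 0 \<and> bdd_above (p_variations p x)}"
  and scl_J [simp]: "scl J = (\<lambda>c x n. c * x n)"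
  and nrm_J: "nrm J x = Sup (p_variations p x)"
  by (simp_all add: james_space_def)

lemma p_variations_eq: "p_variations p x = {pvar p x l powr (1 / p) | l. sorted_wrt (<) l \<and> 2 \<le> length l}"
proof (intro equalityI subsetI)
  fix v assume "v \<in> p_variations p x"
  then obtain k n where v: "v = (\<Sum>j=1..k - 1. cmod (x (n (j + 1)) - x (n j)) powr p) powr (1 / p)"
    "2 \<le> k" "strict_mono_on {1..k} (n :: nat \<Rightarrow> nat)"
    by (auto simp: p_variations_def)
  \<comment> \<open>\<open>n\<close> is indexed from 1 and lists from 0: entry \<open>j\<close> of
    \<open>l\<close> is \<open>n (j + 1)\<close>.\<close>
  define l where "l = map n [1..<Suc k]"
  have "sorted_wrt (<) l"
    using v(3) by (auto simp: l_def sorted_wrt_map sorted_wrt_iff_nth_less strict_mono_on_def simp del: upt_Suc)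
  moreover have "length l = k"
    by (simp add: l_def)
  moreover have "pvar p x l = (\<Sum>j=1..k - 1. cmod (x (n (j + 1)) - x (n j)) powr p)"
    unfolding pvar_eq_sum \<open>length l = k\<close>
    by (intro sum.cong refl) (auto simp: l_def nth_map simp del: upt_Suc)
  ultimately show "v \<in> {pvar p x l powr (1 / p) | l. sorted_wrt (<) l \<and> 2 \<le> length l}"
    using v(1,2) by (intro CollectI exI[of _ l]) simp
next
  fix v assume "v \<in> {pvar p x l powr (1 / p) | l. sorted_wrt (<) l \<and> 2 \<le> length l}"
  then obtain l where v: "v = pvar p x l powr (1 / p)" "sorted_wrt (<) l" "2 \<le> length l"
    by blast
  have "strict_mono_on {1..length l} (\<lambda>j. l ! (j - 1))"
    using v(2) by (intro strict_mono_onI) (auto simp: sorted_wrt_iff_nth_less)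
  moreover have "pvar p x l = (\<Sum>j=1..length l - 1. cmod (x (l ! (j + 1 - 1)) - x (l ! (j - 1))) powr p)"
    by (simp add: pvar_eq_sum)
  ultimately show "v \<in> p_variations p x"
    unfolding p_variations_def using v
    by (intro CollectI exI[of _ "length l"] exI[of _ "\<lambda>j. l ! (j - 1)"]) simp
qed

lemma powr_inverse: "0 \<le> a \<Longrightarrow> (a powr (1 / p)) powr p = a"
  using p by (simp add: powr_powr)

text \<open>Membership without roots and without the restriction to length at least 2, as shorter
  lists have variation 0.\<close>

lemma mem_J_iff: "x \<in> carr J \<longleftrightarrow> x \<longlonglongrightarrow> 0 \<and> (\<exists>C. \<forall>l. sorted_wrt (<) l \<longrightarrow> pvar p x l \<le> C)"
proof -
  have "bdd_above (p_variations p x) \<longleftrightarrow> (\<exists>C. \<forall>l. sorted_wrt (<) l \<longrightarrow> pvar p x l \<le> C)"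
  proof
    assume "bdd_above (p_variations p x)"
    then obtain C where C: "\<And>l. sorted_wrt (<) l \<Longrightarrow> 2 \<le> length l \<Longrightarrow> pvar p x l powr (1 / p) \<le> C"
      unfolding p_variations_eq bdd_above_def by blast
    have "pvar p x l \<le> \<bar>C\<bar> powr p" if l: "sorted_wrt (<) l" for l
    proof (cases "2 \<le> length l")
      case True
      have "pvar p x l powr (1 / p) \<le> \<bar>C\<bar>"
        using C[OF l True] by linarith
      then have "(pvar p x l powr (1 / p)) powr p \<le> \<bar>C\<bar> powr p"
        using p by (intro powr_mono2) auto
      then show ?thesis
        by (simp add: powr_inverse pvar_nonneg)
    next
      case False
      then have "pvar p x l = 0"
        by (simp add: pvar_short)
      then show ?thesis
        by simp
    qed
    then show "\<exists>C. \<forall>l. sorted_wrt (<) l \<longrightarrow> pvar p x l \<le> C"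
      by blast
  next
    assume "\<exists>C. \<forall>l. sorted_wrt (<) l \<longrightarrow> pvar p x l \<le> C"
    then obtain C where C: "\<And>l. sorted_wrt (<) l \<Longrightarrow> pvar p x l \<le> C"
      by blast
    have "pvar p x l powr (1 / p) \<le> C powr (1 / p)" if "sorted_wrt (<) l" for l
      using C[OF that] p by (intro powr_mono2) (auto simp: pvar_nonneg)
    then show "bdd_above (p_variations p x)"
      unfolding p_variations_eq by (intro bdd_aboveI[of _ "C powr (1 / p)"]) blast
  qed
  then show ?thesis
    by (simp add: carr_J)
qed

lemma nrm_J_nonneg: "x \<in> carr J \<Longrightarrow> 0 \<le> nrm J x"
proof -
  assume "x \<in> carr J"
  then have "pvar p x [0, 1] powr (1 / p) \<le> nrm J x"
    unfolding nrm_J by (intro cSup_upper) (auto simp: carr_J p_variations_eq simp del: pvar.simps intro!: exI[of _ "[0, 1]"])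
  then show ?thesis
    by (rule order_trans[rotated]) simp
qed

lemma pvar_le_nrm:
  assumes x: "x \<in> carr J" and l: "sorted_wrt (<) l"
  shows "pvar p x l \<le> nrm J x powr p"
proof (cases "2 \<le> length l")
  case True
  have "pvar p x l powr (1 / p) \<le> nrm J x"
    unfolding nrm_J using x l True by (intro cSup_upper) (auto simp: carr_J p_variations_eq)
  then have "(pvar p x l powr (1 / p)) powr p \<le> nrm J x powr p"
    using p by (intro powr_mono2) auto
  then show ?thesis
    by (simp add: powr_inverse pvar_nonneg)
next
  case False
  then have "pvar p x l = 0"
    by (simp add: pvar_short)
  then show ?thesis
    by simp
qed

lemma nrm_le:
  assumes "0 \<le> C" "\<And>l. sorted_wrt (<) l \<Longrightarrow> pvar p x l \<le> C powr p"
  shows "nrm J x \<le> C"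
  unfolding nrm_J
proof (rule cSup_least)
  show "p_variations p x \<noteq> {}"
    by (auto simp: p_variations_eq simp del: pvar.simps intro!: exI[of _ "[0, 1]"])
  fix v assume "v \<in> p_variations p x"
  then obtain l where v: "v = pvar p x l powr (1 / p)" "sorted_wrt (<) l"
    by (auto simp: p_variations_eq)
  have "v powr p \<le> C powr p"
    using assms(2)[OF v(2)] by (simp add: v(1) powr_inverse pvar_nonneg)
  then show "v \<le> C"
    using p assms(1) powr_le_cancel[of p C v] by simp
qed

text \<open>\<open>x i\<close> is the limit of the two-term differences \<open>x i - x k\<close>,
  because \<open>x\<close> tends to 0. For the same reason the p-variation, which ignores constants,
  is a norm on this space.\<close>

lemma cmod_le_nrm:
  assumes x: "x \<in> carr J"
  shows "cmod (x i) \<le> nrm J x"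
proof (rule tendsto_upperbound)
  have "x \<longlonglongrightarrow> 0"
    using x by (simp add: carr_J)
  then have "(\<lambda>k. cmod (x k - x i)) \<longlonglongrightarrow> cmod (0 - x i)"
    by (intro tendsto_intros)
  then show "(\<lambda>k. cmod (x k - x i)) \<longlonglongrightarrow> cmod (x i)"
    by simp
  show "\<forall>\<^sub>F k in sequentially. cmod (x k - x i) \<le> nrm J x"
    using eventually_gt_at_top[of i]
  proof eventually_elim
    case (elim k)
    then have "cmod (x k - x i) powr p \<le> nrm J x powr p"
      using pvar_le_nrm[OF x, of "[i, k]"] by simp
    then show ?case
      using p nrm_J_nonneg[OF x] powr_le_cancel[of p "nrm J x" "cmod (x k - x i)"] by simp
  qed
qed simp

lemma add_mem_J: "x \<in> carr J \<Longrightarrow> y \<in> carr J \<Longrightarrow> x + y \<in> carr J"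
proof -
  assume x: "x \<in> carr J" and y: "y \<in> carr J"
  \<comment> \<open>The added 1 keeps the radii positive, since the Minkowski inequality divides by
    them.\<close>
  have "pvar p (\<lambda>i. x i + y i) l \<le> ((nrm J x + 1) + (nrm J y + 1)) powr p" if "sorted_wrt (<) l" for l
    using p nrm_J_nonneg[OF x] nrm_J_nonneg[OF y] pvar_le_nrm[OF x that] pvar_le_nrm[OF y that]
      powr_mono2[of p "nrm J x" "nrm J x + 1"] powr_mono2[of p "nrm J y" "nrm J y + 1"]
    by (intro pvar_add_le') auto
  moreover have "(\<lambda>i. x i + y i) \<longlonglongrightarrow> 0"
    using tendsto_add[of x 0 sequentially y 0] x y by (simp add: carr_J)
  ultimately show ?thesis
    unfolding mem_J_iff by (auto simp: plus_fun_def)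
qed

lemma scl_mem_J: "x \<in> carr J \<Longrightarrow> (\<lambda>i. c * x i) \<in> carr J"
  and nrm_J_scl: "x \<in> carr J \<Longrightarrow> nrm J (\<lambda>i. c * x i) \<le> cmod c * nrm J x"
proof -
  assume x: "x \<in> carr J"
  have le: "pvar p (\<lambda>i. c * x i) l \<le> (cmod c * nrm J x) powr p" if "sorted_wrt (<) l" for l
    using pvar_le_nrm[OF x that] nrm_J_nonneg[OF x] by (simp add: pvar_scale powr_mult mult_left_mono)
  moreover have "(\<lambda>i. c * x i) \<longlonglongrightarrow> 0"
    using tendsto_mult_left[of x 0 sequentially c] x by (simp add: carr_J)
  ultimately show "(\<lambda>i. c * x i) \<in> carr J"
    unfolding mem_J_iff by blast
  show "nrm J (\<lambda>i. c * x i) \<le> cmod c * nrm J x"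
    using le nrm_J_nonneg[OF x] by (intro nrm_le) auto
qed

lemma vector_space_J: "vector_space (scl J)"
  by unfold_locales (simp_all add: fun_eq_iff algebra_simps)

lemma normed_J: "complex_normed_space J"
proof (rule complex_normed_space.intro)
  show vs: "vector_space (scl J)"
    by (rule vector_space_J)
  interpret v: vector_space "scl J" by (rule vs)
  have "0 \<in> carr J"
    using pvar_const[of p 0] by (auto simp: mem_J_iff zero_fun_def)
  then show "module.subspace (scl J) (carr J)"
    unfolding v.subspace_def using add_mem_J scl_mem_J by simp
  fix x assume x: "x \<in> carr J"
  show "0 \<le> nrm J x"
    using x by (rule nrm_J_nonneg)
  show "nrm J x = 0 \<longleftrightarrow> x = 0"
  proof
    assume "nrm J x = 0"
    then show "x = 0"
      using cmod_le_nrm[OF x] by (simp add: fun_eq_iff)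
  next
    assume "x = 0"
    then have "nrm J x \<le> 0"
      using pvar_const[of p 0] by (intro nrm_le) (simp_all add: zero_fun_def)
    then show "nrm J x = 0"
      using nrm_J_nonneg[OF x] by simp
  qed
  show "nrm J (scl J c x) = cmod c * nrm J x" for c
  proof (cases "c = 0")
    case True
    then show ?thesis
      using nrm_J_scl[OF x, of c] nrm_J_nonneg[OF scl_mem_J[OF x, of c]] by simp
  next
    case False
    have "nrm J x \<le> cmod (inverse c) * nrm J (\<lambda>i. c * x i)"
      using nrm_J_scl[OF scl_mem_J[OF x], of "inverse c" c] False by (simp flip: mult.assoc)
    then have "cmod c * nrm J x \<le> cmod c * (cmod (inverse c) * nrm J (\<lambda>i. c * x i))"
      by (rule mult_left_mono) simp
    also have "\<dots> = nrm J (\<lambda>i. c * x i)"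
      using False by (simp add: norm_inverse)
    finally have "cmod c * nrm J x \<le> nrm J (\<lambda>i. c * x i)" .
    then show ?thesis
      using nrm_J_scl[OF x, of c] by simp
  qed
  fix y assume y: "y \<in> carr J"
  show "nrm J (x + y) \<le> nrm J x + nrm J y"
  proof (rule field_le_epsilon)
    fix e :: real assume e: "0 < e"
    \<comment> \<open>Again the radii must be positive, here with an arbitrarily small
      excess.\<close>
    have "pvar p (x + y) l \<le> ((nrm J x + e / 2) + (nrm J y + e / 2)) powr p" if "sorted_wrt (<) l" for l
      unfolding plus_fun_def
      using p e nrm_J_nonneg[OF x] nrm_J_nonneg[OF y] pvar_le_nrm[OF x that] pvar_le_nrm[OF y that]
        powr_mono2[of p "nrm J x" "nrm J x + e / 2"] powr_mono2[of p "nrm J y" "nrm J y + e / 2"]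
      by (intro pvar_add_le') auto
    then have "nrm J (x + y) \<le> (nrm J x + e / 2) + (nrm J y + e / 2)"
      using e nrm_J_nonneg[OF x] nrm_J_nonneg[OF y] by (intro nrm_le) auto
    then show "nrm J (x + y) \<le> nrm J x + nrm J y + e"
      by simp
  qed
qed

sublocale J: complex_normed_space "james_space p"
  by (rule normed_J)

sublocale J: operator_space "james_space p"
  by unfold_locales

lemma banach_J: "complex_banach_space J"
proof (rule J.complex_banach_spaceI)
  fix \<sigma> :: "nat \<Rightarrow> nat \<Rightarrow> complex"
  assume range: "range \<sigma> \<subseteq> carr J"
    and cauchy: "\<And>e. 0 < e \<Longrightarrow> \<exists>N. \<forall>m\<ge>N. \<forall>n\<ge>N. nrm J (\<sigma> m - \<sigma> n) < e"
  have mem: "\<sigma> n \<in> carr J" for n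
    using range by auto
  have coord: "cmod (\<sigma> m i - \<sigma> n i) \<le> nrm J (\<sigma> m - \<sigma> n)" for m n i
    using cmod_le_nrm[of "\<sigma> m - \<sigma> n" i] mem by simp
  have "convergent (\<lambda>n. \<sigma> n i)" for i
  proof (rule Cauchy_convergent, rule CauchyI)
    fix e :: real assume "0 < e"
    then obtain N where "\<forall>m\<ge>N. \<forall>n\<ge>N. nrm J (\<sigma> m - \<sigma> n) < e"
      using cauchy by blast
    then show "\<exists>N. \<forall>m\<ge>N. \<forall>n\<ge>N. norm (\<sigma> m i - \<sigma> n i) < e"
      using coord by (meson le_less_trans)
  qed
  then obtain x where x: "\<And>i. (\<lambda>n. \<sigma> n i) \<longlonglongrightarrow> x i"
    unfolding convergent_def by metis
  \<comment> \<open>Along a fixed list the Cauchy estimate for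
    \<open>\<sigma> n - \<sigma> m\<close> survives the pointwise limit in \<open>m\<close>.\<close>
  have close: "pvar p (\<sigma> n - x) l \<le> e powr p"
    if N: "\<forall>m\<ge>N. \<forall>n\<ge>N. nrm J (\<sigma> m - \<sigma> n) < e" "N \<le> n" and l: "sorted_wrt (<) l" for e N n l
  proof (rule tendsto_upperbound)
    show "(\<lambda>m. pvar p (\<sigma> n - \<sigma> m) l) \<longlonglongrightarrow> pvar p (\<sigma> n - x) l"
      using p x by (intro tendsto_pvar) (auto intro!: tendsto_intros)
    show "\<forall>\<^sub>F m in sequentially. pvar p (\<sigma> n - \<sigma> m) l \<le> e powr p"
      using eventually_ge_at_top[of N]
    proof eventually_elim
      case (elim m)
      have "nrm J (\<sigma> n - \<sigma> m) \<le> e"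
        using N elim by (simp add: less_imp_le)
      then have "nrm J (\<sigma> n - \<sigma> m) powr p \<le> e powr p"
        using p nrm_J_nonneg[of "\<sigma> n - \<sigma> m"] mem by (intro powr_mono2) auto
      then show ?case
        using pvar_le_nrm[OF _ l, of "\<sigma> n - \<sigma> m"] mem by simp
    qed
  qed simp
  have close': "cmod (\<sigma> n i - x i) \<le> e"
    if N: "\<forall>m\<ge>N. \<forall>n\<ge>N. nrm J (\<sigma> m - \<sigma> n) < e" "N \<le> n" for e N n i
  proof (rule tendsto_upperbound)
    show "(\<lambda>m. cmod (\<sigma> n i - \<sigma> m i)) \<longlonglongrightarrow> cmod (\<sigma> n i - x i)"
      using x by (intro tendsto_intros)
    show "\<forall>\<^sub>F m in sequentially. cmod (\<sigma> n i - \<sigma> m i) \<le> e"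
      using eventually_ge_at_top[of N]
    proof eventually_elim
      case (elim m)
      then show ?case
        using N coord[of n i m] by (meson less_imp_le order_trans)
    qed
  qed simp
  have x0: "x \<longlonglongrightarrow> 0"
  proof (rule LIMSEQ_I)
    fix e :: real assume e: "0 < e"
    obtain N where N: "\<forall>m\<ge>N. \<forall>n\<ge>N. nrm J (\<sigma> m - \<sigma> n) < e / 2"
      using cauchy[of "e / 2"] e by auto
    have "\<sigma> N \<longlonglongrightarrow> 0"
      using mem by (simp add: carr_J)
    then obtain M where M: "\<And>i. M \<le> i \<Longrightarrow> norm (\<sigma> N i - 0) < e / 2"
      using LIMSEQ_D[of "\<sigma> N" 0 "e / 2"] e by auto
    have "norm (x i - 0) < e" if "M \<le> i" for i
      using close'[OF N order_refl, of i] M[OF that] norm_triangle_ineq4[of "\<sigma> N i" "\<sigma> N i - x i"] by simp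
    then show "\<exists>M. \<forall>i\<ge>M. norm (x i - 0) < e"
      by blast
  qed
  obtain N where N: "\<forall>m\<ge>N. \<forall>n\<ge>N. nrm J (\<sigma> m - \<sigma> n) < 1"
    using cauchy[of 1] by auto
  \<comment> \<open>Membership of \<open>x\<close> comes from writing it as
    \<open>\<sigma> N - (\<sigma> N - x)\<close>, where the difference has variation at most
    1.\<close>
  have "(\<lambda>i. \<sigma> N i - x i) \<longlonglongrightarrow> 0 - 0"
    using x0 mem[of N] by (intro tendsto_diff) (simp_all add: carr_J)
  then have "\<sigma> N - x \<in> carr J"
    unfolding mem_J_iff using close[OF N order_refl] by (auto simp: fun_diff_def)
  then have "\<sigma> N - (\<sigma> N - x) \<in> carr J"
    by (rule J.diff_mem[OF mem])
  moreover have "\<sigma> N - (\<sigma> N - x) = x"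
    by simp
  ultimately have xJ: "x \<in> carr J"
    by metis
  have "\<exists>N. \<forall>n\<ge>N. nrm J (\<sigma> n - x) < e" if e: "0 < e" for e
  proof -
    obtain N where N: "\<forall>m\<ge>N. \<forall>n\<ge>N. nrm J (\<sigma> m - \<sigma> n) < e / 2"
      using cauchy[of "e / 2"] e by auto
    have "nrm J (\<sigma> n - x) < e" if "N \<le> n" for n
    proof -
      have "nrm J (\<sigma> n - x) \<le> e / 2"
        using e close[OF N that] by (intro nrm_le) auto
      then show ?thesis
        using e by simp
    qed
    then show ?thesis
      by blast
  qed
  then show "\<exists>x\<in>carr J. \<forall>e>0. \<exists>N. \<forall>n\<ge>N. nrm J (\<sigma> n - x) < e"
    using xJ by blast
qed

section \<open>Truncations and bounded functionals on the James space\<close>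

definition trunc :: "nat \<Rightarrow> (nat \<Rightarrow> complex) \<Rightarrow> nat \<Rightarrow> complex" where
  "trunc N x = (\<lambda>i. if i < N then x i else 0)"

text \<open>A crude bound: an increasing list visits each index at most once, and the step leaving
  an index is estimated by the sum over all possible targets.\<close>

lemma mem_J_finite_support:
  assumes "\<And>i. N \<le> i \<Longrightarrow> x i = 0"
  shows "x \<in> carr J"
proof -
  have "x \<longlonglongrightarrow> 0"
    by (rule tendsto_eventually) (use assms in \<open>auto simp: eventually_sequentially\<close>)
  moreover have "pvar p x l \<le> (\<Sum>i\<le>N. \<Sum>j\<le>N. cmod (x j - x i) powr p) + 0 + (2 * (\<Sum>i\<le>N. cmod (x i))) powr p"
    if "sorted_wrt (<) l" for l
  proof -
    have x: "x = (\<lambda>i. if i < N then x i else 0)"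
      using assms by (auto simp: fun_eq_iff)
    have M: "cmod (x i) \<le> (\<Sum>i\<le>N. cmod (x i))" if "i < N" for i
      using that member_le_sum[of i "{..N}" "\<lambda>i. cmod (x i)"] by simp
    have A: "pvar p x k \<le> (\<Sum>i\<le>N. \<Sum>j\<le>N. cmod (x j - x i) powr p)"
      if k: "sorted_wrt (<) k" "set k \<subseteq> {..<N}" for k
    proof -
      have "pvar p x k \<le> (\<Sum>i\<in>set k. \<Sum>j\<le>N. cmod (x j - x i) powr p)"
        using k
      proof (induction k rule: induct_list012)
        case (3 a b k)
        have "cmod (x b - x a) powr p \<le> (\<Sum>j\<le>N. cmod (x j - x a) powr p)"
          using 3(4) by (intro member_le_sum) auto
        moreover have a: "a \<notin> set (b # k)"
          using 3(3) by auto
        have "(\<Sum>i\<in>set (a # b # k). \<Sum>j\<le>N. cmod (x j - x i) powr p) =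
            (\<Sum>j\<le>N. cmod (x j - x a) powr p) + (\<Sum>i\<in>set (b # k). \<Sum>j\<le>N. cmod (x j - x i) powr p)"
          by (simp only: list.set(2)[of a] sum.insert[OF finite_set a])
        moreover have "pvar p x (b # k) \<le> (\<Sum>i\<in>set (b # k). \<Sum>j\<le>N. cmod (x j - x i) powr p)"
          using 3 by simp
        ultimately show ?case
          by (simp only: pvar.simps)
      qed (simp_all add: sum_nonneg)
      also have "\<dots> \<le> (\<Sum>i\<le>N. \<Sum>j\<le>N. cmod (x j - x i) powr p)"
        using k(2) by (intro sum_mono2 sum_nonneg) auto
      finally show ?thesis .
    qed
    show ?thesis
      by (subst x, rule pvar_splice)
        (use p that M A in \<open>auto simp: pvar_const sum_nonneg\<close>)
  qed
  ultimately show ?thesis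
    unfolding mem_J_iff by blast
qed

lemma trunc_mem: "trunc N x \<in> carr J"
  by (rule mem_J_finite_support[of N]) (simp add: trunc_def)

text \<open>One half of \<open>e powr p\<close> is allotted to the variation of the tail and the
  other to the jump at the cut, where \<open>M\<close> is chosen such that
  \<open>(2 * M) powr p = h\<close>.\<close>

lemma norm_diff_trunc:
  assumes x: "x \<in> carr J" and e: "0 < e"
  shows "\<exists>N0. \<forall>N\<ge>N0. nrm J (x - trunc N x) \<le> e"
proof -
  define h where "h = e powr p / 2"
  have h: "0 < h"
    using e by (simp add: h_def)
  define M where "M = (h powr (1 / p)) / 2"
  have M: "0 < M" "(2 * M) powr p = h"
    using h powr_inverse[of h] by (simp_all add: M_def)
  obtain N1 where N1: "\<And>l. sorted_wrt (<) l \<Longrightarrow> set l \<subseteq> {N1..} \<Longrightarrow> pvar p x l \<le> h"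
    using pvar_tail[OF pvar_le_nrm[OF x] h] by blast
  have "x \<longlonglongrightarrow> 0"
    using x by (simp add: carr_J)
  then obtain N2 where N2: "\<And>i. N2 \<le> i \<Longrightarrow> norm (x i - 0) < M"
    using LIMSEQ_D[of x 0 M] M by auto
  have "nrm J (x - trunc N x) \<le> e" if N: "max N1 N2 \<le> N" for N
  proof (rule nrm_le)
    fix l :: "nat list" assume l: "sorted_wrt (<) l"
    have "x - trunc N x = (\<lambda>i. if i < N then 0 else x i)"
      by (auto simp: fun_eq_iff trunc_def)
    moreover have "pvar p (\<lambda>i. if i < N then 0 else x i) l \<le> 0 + h + (2 * M) powr p"
    proof (rule pvar_splice[OF _ l])
      show "pvar p x k \<le> h" if "sorted_wrt (<) k" "set k \<subseteq> {N..}" for k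
        using that N by (intro N1) auto
      show "cmod (x i) \<le> M" if "N \<le> i" for i
        using N2[of i] that N by simp
    qed (use p M in \<open>auto simp: pvar_const\<close>)
    ultimately show "pvar p (x - trunc N x) l \<le> e powr p"
      using M(2) by (simp add: h_def)
  qed (use e in simp)
  then show ?thesis
    by blast
qed

lemma functional_trunc:
  assumes f: "bounded_linear_on J scalar_space f" and x: "x \<in> carr J"
  shows "(\<lambda>N. f (trunc N x)) \<longlonglongrightarrow> f x"
proof -
  interpret C: complex_normed_space scalar_space by (rule complex_normed_space_scalar_space)
  interpret f: bounded_linear_map J scalar_space f by unfold_locales fact
  obtain K where K: "0 < K" "\<And>x. x \<in> carr J \<Longrightarrow> cmod (f x) \<le> K * nrm J x"
    using f.bounded by auto
  show ?thesis
  proof (rule LIMSEQ_I)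
    fix e :: real assume e: "0 < e"
    obtain N0 where N0: "\<And>N. N0 \<le> N \<Longrightarrow> nrm J (x - trunc N x) \<le> e / (2 * K)"
      using norm_diff_trunc[OF x, of "e / (2 * K)"] e K(1) by auto
    have "norm (f (trunc N x) - f x) < e" if "N0 \<le> N" for N
    proof -
      have "norm (f (trunc N x) - f x) = cmod (f (x - trunc N x))"
        using x trunc_mem f.diff[OF x trunc_mem, of N] by (simp add: norm_minus_commute)
      also have "\<dots> \<le> K * (e / (2 * K))"
      proof -
        have "K * nrm J (x - trunc N x) \<le> K * (e / (2 * K))"
          using N0[OF that] K(1) by (intro mult_left_mono) auto
        then show ?thesis
          using K(2)[OF J.diff_mem[OF x trunc_mem[of N x]]] by linarith
      qed
      also have "\<dots> < e"
        using K(1) e by simp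
      finally show ?thesis .
    qed
    then show "\<exists>N0. \<forall>N\<ge>N0. norm (f (trunc N x) - f x) < e"
      by blast
  qed
qed

text \<open>A truncation is a combination of \<open>N\<close> unit vectors. The 1 added to the sum
  of the values of \<open>f\<close> on these makes \<open>E\<close> positive, so that it can be
  divided by.\<close>

lemma functional_trunc_le:
  assumes f: "bounded_linear_on J scalar_space f"
  shows "\<exists>E>0. \<forall>x\<in>carr J. \<forall>e. (\<forall>i<N. cmod (x i) \<le> e) \<longrightarrow> 0 \<le> e \<longrightarrow> cmod (f (trunc N x)) \<le> e * E"
proof -
  interpret C: complex_normed_space scalar_space by (rule complex_normed_space_scalar_space)
  interpret f: bounded_linear_map J scalar_space f by unfold_locales fact
  define b :: "nat \<Rightarrow> nat \<Rightarrow> complex" where "b i = (\<lambda>j. if j = i then 1 else 0)" for i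
  have b: "b i \<in> carr J" for i
    by (rule mem_J_finite_support[of "Suc i"]) (simp add: b_def)
  have "cmod (f (trunc N x)) \<le> e * (\<Sum>i<N. cmod (f (b i)))"
    if "\<forall>i<N. cmod (x i) \<le> e" for x e
    using that
  proof (induction N)
    case 0
    have "trunc 0 x = 0"
      by (simp add: trunc_def zero_fun_def)
    then have "f (trunc 0 x) = 0"
      using f.zero by metis
    then show ?case
      by simp
  next
    case (Suc N)
    have "trunc (Suc N) x = trunc N x + scl J (x N) (b N)"
      by (auto simp: fun_eq_iff trunc_def b_def less_Suc_eq)
    then have "f (trunc (Suc N) x) = f (trunc N x) + x N * f (b N)"
      using f.add[OF trunc_mem J.scl_mem[OF b]] f.scl[OF b] by simp
    then have "cmod (f (trunc (Suc N) x)) \<le> cmod (f (trunc N x)) + cmod (x N) * cmod (f (b N))"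
      by (metis norm_mult norm_triangle_ineq)
    also have "\<dots> \<le> e * (\<Sum>i<N. cmod (f (b i))) + e * cmod (f (b N))"
      using Suc by (intro add_mono mult_right_mono) auto
    finally show ?case
      by (simp add: distrib_left)
  qed
  moreover have "e * (\<Sum>i<N. cmod (f (b i))) \<le> e * (1 + (\<Sum>i<N. cmod (f (b i))))" if "0 \<le> e" for e
    using that by (intro mult_left_mono) auto
  ultimately show ?thesis
    by (intro exI[of _ "1 + (\<Sum>i<N. cmod (f (b i)))"])
      (auto intro: order_trans simp: add_pos_nonneg sum_nonneg)
qed

text \<open>A gliding hump argument: otherwise there would be \<open>n\<close> almost disjoint blocks whose sum has norm
  \<open>O(n powr (1 / p))\<close>, while \<open>f\<close> is at least \<open>n * \<delta> / 2\<close> there.\<close>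

lemma functional_small:
  assumes f: "bounded_linear_on J scalar_space f" and C: "0 \<le> C" and \<delta>: "0 < \<delta>"
  shows "\<exists>N e. 0 < e \<and> (\<forall>w\<in>carr J. nrm J w \<le> C \<longrightarrow> (\<forall>i<N. cmod (w i) \<le> e) \<longrightarrow> cmod (f w) < \<delta>)"
proof (rule ccontr)
  assume neg: "\<not> ?thesis"
  interpret C: complex_normed_space scalar_space by (rule complex_normed_space_scalar_space)
  interpret f: bounded_linear_map J scalar_space f by unfold_locales fact
  \<comment> \<open>The increase of the p-variation per hump: the variation of the new block and one
    jump at each of its two ends.\<close>
  define D where "D = C powr p + 2 * (2 * C) powr p"
  have D: "0 \<le> D"
    by (simp add: D_def)
  have hump: "\<exists>y N. (\<forall>i\<ge>N. y i = 0) \<and> (\<forall>i. cmod (y i) \<le> C) \<and> (\<forall>l. sorted_wrt (<) l \<longrightarrow> pvar p y l \<le> n * D) \<and>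
      n * \<delta> / 2 \<le> Re (f y)" for n :: nat
  proof (induction n)
    case 0
    show ?case
      by (intro exI[of _ "0 :: nat \<Rightarrow> complex"]) (simp add: C pvar_const zero_fun_def[symmetric], simp add: zero_fun_def pvar_const)
  next
    case (Suc n)
    then obtain y N where y: "\<And>i. N \<le> i \<Longrightarrow> y i = 0" "\<And>i. cmod (y i) \<le> C"
      "\<And>l. sorted_wrt (<) l \<Longrightarrow> pvar p y l \<le> n * D" "n * \<delta> / 2 \<le> Re (f y)"
      by blast
    obtain E where E: "0 < E" "\<And>x e. x \<in> carr J \<Longrightarrow> (\<forall>i<N. cmod (x i) \<le> e) \<Longrightarrow> 0 \<le> e \<Longrightarrow> cmod (f (trunc N x)) \<le> e * E"
      using functional_trunc_le[OF f, of N] by blast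
    \<comment> \<open>With this bound, cutting the new hump off below \<open>N\<close> changes
      \<open>f\<close> by at most \<delta> / 4. Cutting it at \<open>N'\<close> costs another
      \<delta> / 4, so a gain of \<delta> / 2 remains.\<close>
    have "0 < \<delta> / (4 * E)"
      using \<delta> E(1) by simp
    then obtain w where w: "w \<in> carr J" "nrm J w \<le> C" "\<forall>i<N. cmod (w i) \<le> \<delta> / (4 * E)" "\<delta> \<le> cmod (f w)"
      using neg by (meson not_less)
    \<comment> \<open>A unimodular factor that turns \<open>f w\<close> into a positive real, so
      that the contributions of the humps add up.\<close>
    define c where "c = cnj (f w) / cmod (f w)"
    have fw: "f w \<noteq> 0"
      using w(4) \<delta> by auto
    have c: "cmod c = 1" "c * f w = cmod (f w)"
      using fw complex_norm_square[of "f w"]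
      by (simp_all add: c_def norm_divide power2_eq_square mult.commute nonzero_divide_eq_eq)
    define v where "v = (\<lambda>i. c * w i)"
    have v: "v \<in> carr J" "nrm J v \<le> C" "\<forall>i<N. cmod (v i) \<le> \<delta> / (4 * E)"
      using scl_mem_J[OF w(1)] nrm_J_scl[OF w(1), of c] w(2,3) c(1) by (auto simp: v_def norm_mult)
    have fv: "f v = cmod (f w)"
      using f.scl[OF w(1), of c] c(2) by (simp add: v_def)
    have vC: "cmod (v i) \<le> C" for i
      using cmod_le_nrm[OF v(1), of i] v(2) by linarith
    have vV: "pvar p v l \<le> C powr p" if "sorted_wrt (<) l" for l
    proof -
      have "nrm J v powr p \<le> C powr p"
        using v(2) p nrm_J_nonneg[OF v(1)] by (intro powr_mono2) auto
      then show ?thesis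
        using pvar_le_nrm[OF v(1) that] by linarith
    qed
    have small: "cmod (f (trunc N v)) \<le> \<delta> / 4"
      using E(2)[OF v(1,3)] \<delta> E(1) by simp
    obtain N' where N': "N \<le> N'" "cmod (f (trunc N' v) - f v) < \<delta> / 4"
    proof -
      obtain M where "\<And>n. M \<le> n \<Longrightarrow> norm (f (trunc n v) - f v) < \<delta> / 4"
        using LIMSEQ_D[OF functional_trunc[OF f v(1)], of "\<delta> / 4"] \<delta> by auto
      then show ?thesis
        using that[of "max M N"] by simp
    qed
    define y' where "y' = (\<lambda>i. if i < N then y i else if i < N' then v i else 0)"
    have yJ: "y \<in> carr J"
      using y(1) by (rule mem_J_finite_support)
    have "y' = y + (trunc N' v - trunc N v)"
      using y(1) N'(1) by (auto simp: fun_eq_iff y'_def trunc_def)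
    then have "f y' = f y + (f (trunc N' v) - f (trunc N v))"
      using f.add[OF yJ J.diff_mem[OF trunc_mem trunc_mem]] f.diff[OF trunc_mem trunc_mem] by simp
    then have "Re (f y') = Re (f y) + (Re (f (trunc N' v)) - Re (f (trunc N v)))"
      by simp
    moreover have "cmod (f w) - \<delta> / 4 \<le> Re (f (trunc N' v))"
      using N'(2) abs_Re_le_cmod[of "f (trunc N' v) - f v"] fv by simp
    moreover have "Re (f (trunc N v)) \<le> \<delta> / 4"
      using small abs_Re_le_cmod[of "f (trunc N v)"] by simp
    ultimately have "Suc n * \<delta> / 2 \<le> Re (f y')"
      using y(4) w(4) by (simp add: distrib_right add_divide_distrib)
    moreover have "pvar p y' l \<le> Suc n * D" if l: "sorted_wrt (<) l" for l
    proof -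
      have "pvar p (\<lambda>i. if i < N' then v i else 0) k \<le> C powr p + 0 + (2 * C) powr p"
        if "sorted_wrt (<) k" for k
        by (rule pvar_splice[OF _ that]) (use p vC vV C in \<open>auto simp: pvar_const\<close>)
      then have "pvar p y' l \<le> n * D + (C powr p + 0 + (2 * C) powr p) + (2 * C) powr p"
        unfolding y'_def by (intro pvar_splice[OF _ l]) (use p y vC C in auto)
      then show ?thesis
        by (simp add: D_def algebra_simps)
    qed
    moreover have "\<forall>i\<ge>N'. y' i = 0" "\<forall>i. cmod (y' i) \<le> C"
      using N'(1) y(2) vC C by (auto simp: y'_def)
    ultimately show ?case
      by blast
  qed
  have ex: "\<exists>y\<in>carr J. nrm J y \<le> (n * D) powr (1 / p) \<and> n * \<delta> / 2 \<le> cmod (f y)" for n :: nat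
  proof -
    obtain y N where y: "\<And>i. N \<le> i \<Longrightarrow> y i = 0"
      "\<And>l. sorted_wrt (<) l \<Longrightarrow> pvar p y l \<le> n * D" "n * \<delta> / 2 \<le> Re (f y)"
      using hump[of n] by blast
    have "y \<in> carr J"
      using y(1) by (rule mem_J_finite_support)
    moreover have "nrm J y \<le> (n * D) powr (1 / p)"
      using y(2) D by (intro nrm_le) (auto simp: powr_inverse)
    moreover have "n * \<delta> / 2 \<le> cmod (f y)"
      using y(3) complex_Re_le_cmod[of "f y"] by linarith
    ultimately show ?thesis
      by blast
  qed
  obtain K where K: "0 < K" "\<And>x. x \<in> carr J \<Longrightarrow> cmod (f x) \<le> K * nrm J x"
    using f.bounded by auto
  \<comment> \<open>The inequality \<open>n * \<delta> / 2 \<le> K * (n * D) powr (1 / p)\<close>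
    amounts to \<open>n powr s \<le> B\<close>. As p > 1, the exponent is positive and large
    \<open>n\<close> contradict this.\<close>
  define s where "s = 1 - 1 / p"
  have s: "0 < s"
    using p by (simp add: s_def)
  define B where "B = 2 * K * D powr (1 / p) / \<delta>"
  have B: "0 \<le> B"
    using K(1) \<delta> by (simp add: B_def)
  have le: "real n powr s \<le> B" if n: "0 < n" for n :: nat
  proof -
    obtain y where y: "y \<in> carr J" "nrm J y \<le> (n * D) powr (1 / p)" "n * \<delta> / 2 \<le> cmod (f y)"
      using ex[of n] by blast
    have "n * \<delta> / 2 \<le> K * (n * D) powr (1 / p)"
    proof -
      have "K * nrm J y \<le> K * (n * D) powr (1 / p)"
        using y(2) K(1) by (intro mult_left_mono) auto
      then show ?thesis
        using K(2)[OF y(1)] y(3) by linarith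
    qed
    also have "\<dots> = n powr (1 / p) * (K * D powr (1 / p))"
      by (simp add: powr_mult)
    finally have "n \<le> n powr (1 / p) * B"
      using \<delta> by (simp add: B_def field_simps)
    moreover have "real n = n powr (1 / p) * n powr s"
      using n by (simp add: s_def flip: powr_add)
    ultimately show ?thesis
      using n by (metis mult_le_cancel_left_pos of_nat_0_less_iff powr_gt_zero less_numeral_extra(3))
  qed
  obtain n :: nat where n: "(B + 1) powr (1 / s) < n"
    using reals_Archimedean2 by blast
  have "0 < n"
    using n powr_ge_zero[of "B + 1" "1 / s"] by linarith
  have "B + 1 = ((B + 1) powr (1 / s)) powr s"
    using s B by (simp add: powr_powr)
  also have "\<dots> \<le> n powr s"
    using n s by (intro powr_mono2) auto
  also have "\<dots> \<le> B"
    using \<open>0 < n\<close> by (rule le)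
  finally show False
    by simp
qed

section \<open>The character of the operators on the James space\<close>

lemma operator_coordinate:
  assumes "T \<in> bounded_operators J"
  shows "bounded_linear_on J scalar_space (\<lambda>x. T x i)"
proof -
  interpret T: bounded_linear_map J J T by (rule J.operator_linear_map) fact
  obtain K where K: "0 < K" "\<And>x. x \<in> carr J \<Longrightarrow> nrm J (T x) \<le> K * nrm J x"
    using T.bounded by blast
  have "cmod (T x i) \<le> K * nrm J x" if "x \<in> carr J" for x
    using cmod_le_nrm[OF T.mem[OF that], of i] K(2)[OF that] by linarith
  moreover have "T (\<lambda>n. c * x n) = (\<lambda>n. c * T x n)" if "x \<in> carr J" for c x
    using T.scl[OF that, of c] by simp
  ultimately show ?thesis
    unfolding bounded_linear_on_def by (auto simp: T.add)
qed

definition unit_block :: "nat \<Rightarrow> nat \<Rightarrow> complex" where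
  "unit_block n = (\<lambda>i. if i < n then 1 else 0)"

lemma unit_block_mem: "unit_block n \<in> carr J"
  by (rule mem_J_finite_support[of n]) (simp add: unit_block_def)

text \<open>There is a single jump, from 1 to 0; the general junction estimate charges it as
  \<open>2 * 1\<close>.\<close>

lemma nrm_unit_block: "nrm J (unit_block n) \<le> 2"
proof (rule nrm_le)
  fix l :: "nat list" assume "sorted_wrt (<) l"
  then have "pvar p (\<lambda>i. if i < n then 1 else 0) l \<le> 0 + 0 + (2 * 1) powr p"
    using p by (intro pvar_splice) (auto simp: pvar_const)
  then show "pvar p (unit_block n) l \<le> 2 powr p"
    by (simp add: unit_block_def)
qed simp

text \<open>The difference of two blocks of length at least \<open>N\<close> vanishes below
  \<open>N\<close> and has norm at most 4, so it is covered by
  \<open>functional_small\<close>.\<close>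

lemma functional_unit_block_convergent:
  assumes f: "bounded_linear_on J scalar_space f"
  shows "convergent (\<lambda>n. f (unit_block n))"
proof (rule Cauchy_convergent, rule CauchyI)
  fix \<delta> :: real assume \<delta>: "0 < \<delta>"
  interpret C: complex_normed_space scalar_space by (rule complex_normed_space_scalar_space)
  interpret f: bounded_linear_map J scalar_space f by unfold_locales fact
  obtain N e where N: "0 < e"
    "\<And>w. w \<in> carr J \<Longrightarrow> nrm J w \<le> 4 \<Longrightarrow> (\<forall>i<N. cmod (w i) \<le> e) \<Longrightarrow> cmod (f w) < \<delta>"
    using functional_small[OF f, of 4 \<delta>] \<delta> by auto
  have "norm (f (unit_block m) - f (unit_block n)) < \<delta>" if "N \<le> m" "N \<le> n" for m n
  proof -
    have "cmod (f (unit_block m - unit_block n)) < \<delta>"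
    proof (rule N(2))
      show "nrm J (unit_block m - unit_block n) \<le> 4"
        using J.norm_triangle_diff[OF unit_block_mem[of m] unit_block_mem[of n]]
          nrm_unit_block[of m] nrm_unit_block[of n] by simp
      show "\<forall>i<N. cmod ((unit_block m - unit_block n) i) \<le> e"
        using that N(1) by (simp add: unit_block_def)
    qed (intro J.diff_mem unit_block_mem)
    then show ?thesis
      by (simp add: f.diff unit_block_mem)
  qed
  then show "\<exists>N. \<forall>m\<ge>N. \<forall>n\<ge>N. norm (f (unit_block m) - f (unit_block n)) < \<delta>"
    by blast
qed

text \<open>The pointwise limit \<open>t\<close> of the images of the blocks inherits a bound on its
  p-variation and therefore converges; its limit is the coefficient of the constant sequence
  1.\<close>

lemma ex_character_J: "\<exists>\<psi>. character (\<B> J) \<psi>"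
proof (rule ex_character[where u = unit_block and e = "\<lambda>i. 1" and F = sequentially])
  show "complex_normed_space J"
    by (rule normed_J)
  show "unit_block n \<in> carr J" "nrm J (unit_block n) \<le> 2" for n
    by (rule unit_block_mem, rule nrm_unit_block)
  show "(\<lambda>n. unit_block n i) \<longlonglongrightarrow> 1" for i
    by (rule tendsto_eventually)
      (auto simp: unit_block_def eventually_sequentially intro!: exI[of _ "Suc i"])
  show "(\<lambda>i. 1) \<notin> carr J"
    by (auto simp: carr_J LIMSEQ_const_iff)
next
  fix T assume T: "T \<in> bounded_operators J"
  interpret T: bounded_linear_map J J T by (rule J.operator_linear_map) fact
  obtain K where K: "0 < K" "\<And>x. x \<in> carr J \<Longrightarrow> nrm J (T x) \<le> K * nrm J x"
    using T.bounded by blast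
  obtain t where t: "\<And>i. (\<lambda>n. T (unit_block n) i) \<longlonglongrightarrow> t i"
    using functional_unit_block_convergent[OF operator_coordinate[OF T]] unfolding convergent_def by metis
  have bound: "pvar p t l \<le> (K * 2) powr p" if l: "sorted_wrt (<) l" for l
  proof (rule tendsto_upperbound)
    show "(\<lambda>n. pvar p (T (unit_block n)) l) \<longlonglongrightarrow> pvar p t l"
      using p t by (intro tendsto_pvar) auto
    have "pvar p (T (unit_block n)) l \<le> (K * 2) powr p" for n
    proof -
      have "K * nrm J (unit_block n) \<le> K * 2"
        using nrm_unit_block K(1) by (intro mult_left_mono) auto
      then have "nrm J (T (unit_block n)) \<le> K * 2"
        using K(2)[OF unit_block_mem, of n] by linarith
      then have "nrm J (T (unit_block n)) powr p \<le> (K * 2) powr p"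
        using p nrm_J_nonneg[OF T.mem[OF unit_block_mem]] by (intro powr_mono2) auto
      then show ?thesis
        using pvar_le_nrm[OF T.mem[OF unit_block_mem] l, of n] by linarith
    qed
    then show "\<forall>\<^sub>F n in sequentially. pvar p (T (unit_block n)) l \<le> (K * 2) powr p"
      by simp
  qed simp
  \<comment> \<open>Lists of length 2 far out have small variation, which is the Cauchy
    property.\<close>
  have "convergent t"
  proof (rule Cauchy_convergent, rule CauchyI)
    fix e :: real assume e: "0 < e"
    define h where "h = (e / 2) powr p"
    obtain N where N: "\<And>l. sorted_wrt (<) l \<Longrightarrow> set l \<subseteq> {N..} \<Longrightarrow> pvar p t l \<le> h"
      using pvar_tail[OF bound, of h] e by (auto simp: h_def)
    have le: "norm (t n - t m) < e" if "N \<le> m" "m < n" for m n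
    proof -
      have "norm (t n - t m) powr p \<le> (e / 2) powr p"
        using N[of "[m, n]"] that by (simp add: h_def)
      then have "norm (t n - t m) \<le> e / 2"
        using powr_le_cancel[of p "e / 2" "norm (t n - t m)"] p e by simp
      then show ?thesis
        using e by simp
    qed
    have "norm (t m - t n) < e" if "N \<le> m" "N \<le> n" for m n
      using le[of m n] le[of n m] that e norm_minus_commute[of "t m" "t n"]
      by (cases m n rule: linorder_cases) auto
    then show "\<exists>N. \<forall>m\<ge>N. \<forall>n\<ge>N. norm (t m - t n) < e"
      by blast
  qed
  then obtain c where c: "t \<longlonglongrightarrow> c"
    by (auto simp: convergent_def)
  have "(\<lambda>i. t i + - c) \<longlonglongrightarrow> c + - c"
    using c by (intro tendsto_intros)
  then have "(\<lambda>i. t i + - c) \<in> carr J"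
    unfolding mem_J_iff pvar_add_const using bound by auto
  then show "\<exists>g\<in>carr J. \<exists>c. \<forall>i. (\<lambda>n. T (unit_block n) i) \<longlonglongrightarrow> g i + c * 1"
    using t by (intro bexI[of _ "\<lambda>i. t i + - c"] exI[of _ c]) simp_all
next
  fix w N T i
  assume w: "\<And>n :: nat. w n \<in> carr J" "\<And>n. nrm J (w n) \<le> N" "\<And>j. (\<lambda>n. w n j) \<longlonglongrightarrow> 0"
    and T: "T \<in> bounded_operators J"
  have N: "0 \<le> N"
    using nrm_J_nonneg[OF w(1)] w(2) order_trans by blast
  show "(\<lambda>n. T (w n) i) \<longlonglongrightarrow> 0"
  proof (rule tendstoI)
    fix \<delta> :: real assume "0 < \<delta>"
    \<comment> \<open>Smallness of \<open>T (w n) i\<close> needs control of finitely many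
      coordinates only, and these become small together.\<close>
    then obtain M e where M: "0 < e"
      "\<And>w. w \<in> carr J \<Longrightarrow> nrm J w \<le> N \<Longrightarrow> (\<forall>i<M. cmod (w i) \<le> e) \<Longrightarrow> cmod (T w i) < \<delta>"
      using functional_small[OF operator_coordinate[OF T] N, of \<delta> i] by blast
    have "\<forall>\<^sub>F n in sequentially. \<forall>j\<in>{..<M}. dist (w n j) 0 < e"
      using w(3) M(1) by (intro eventually_ball_finite ballI tendstoD) auto
    then show "\<forall>\<^sub>F n in sequentially. dist (T (w n) i) 0 < \<delta>"
    proof eventually_elim
      case (elim n)
      then show ?case
        using M(2)[OF w(1,2), of n] by (auto simp: less_imp_le)
    qed
  qed
qed (simp_all add: fun_eq_iff)

section \<open>Shifts on the James space\<close>

lemma left_shift: "bounded_linear_on J J (\<lambda>x i. x (Suc i))"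
proof -
  have le: "pvar p (\<lambda>i. x (Suc i)) l \<le> nrm J x powr p" if "x \<in> carr J" "sorted_wrt (<) l" for x l
    using pvar_le_nrm[OF that(1), of "map Suc l"] that(2) by (simp add: pvar_map sorted_wrt_map)
  have "(\<lambda>i. x (Suc i)) \<in> carr J" if x: "x \<in> carr J" for x
    using le[OF x] x LIMSEQ_Suc[of x 0] by (auto simp: mem_J_iff)
  moreover have "nrm J (\<lambda>i. x (Suc i)) \<le> 1 * nrm J x" if x: "x \<in> carr J" for x
    using le[OF x] nrm_J_nonneg[OF x] by (intro nrm_le) auto
  ultimately show ?thesis
    unfolding bounded_linear_on_def by (auto simp: fun_eq_iff intro!: exI[of _ 1])
qed

text \<open>The inserted 0 adds one jump of size at most twice the norm, whence \<open>K\<close>.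
  The form with \<open>i < 1\<close> presents the shift as a sequence spliced at 1.\<close>

lemma right_shift: "bounded_linear_on J J (\<lambda>x i. if i < 1 then 0 else x (i - 1))"
proof -
  define K where "K = (1 + 2 powr p) powr (1 / p)"
  have K: "K powr p = 1 + 2 powr p" "0 \<le> K"
    by (simp_all add: K_def powr_inverse)
  have le: "pvar p (\<lambda>i. if i < 1 then 0 else x (i - 1)) l \<le> (K * nrm J x) powr p"
    if x: "x \<in> carr J" and l: "sorted_wrt (<) l" for x l
  proof -
    have "pvar p (\<lambda>i. if i < 1 then 0 else x (i - 1)) l \<le> 0 + nrm J x powr p + (2 * nrm J x) powr p"
    proof (rule pvar_splice[OF _ l])
      show "pvar p (\<lambda>i. x (i - 1)) k \<le> nrm J x powr p" if k: "sorted_wrt (<) k" "set k \<subseteq> {1..}" for k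
      proof -
        have "sorted_wrt (<) (map (\<lambda>i. i - 1) k)"
          unfolding sorted_wrt_map using k(2) by (intro sorted_wrt_mono_rel[OF _ k(1)]) (auto simp: subset_eq)
        then show ?thesis
          using pvar_le_nrm[OF x, of "map (\<lambda>i. i - 1) k"] by (simp add: pvar_map)
      qed
    qed (use p nrm_J_nonneg[OF x] cmod_le_nrm[OF x] in \<open>auto simp: pvar_const\<close>)
    also have "\<dots> = (K * nrm J x) powr p"
      by (simp add: powr_mult K(1) distrib_right)
    finally show ?thesis .
  qed
  have mem: "(\<lambda>i. if i < 1 then 0 else x (i - 1)) \<in> carr J" if x: "x \<in> carr J" for x
  proof -
    have "(\<lambda>i. if i < 1 then 0 else x (i - 1)) \<longlonglongrightarrow> 0"
      by (rule LIMSEQ_imp_Suc) (use x in \<open>simp add: carr_J\<close>)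
    then show ?thesis
      unfolding mem_J_iff using le[OF x] by blast
  qed
  have bound: "nrm J (\<lambda>i. if i < 1 then 0 else x (i - 1)) \<le> K * nrm J x" if x: "x \<in> carr J" for x
    using le[OF x] nrm_J_nonneg[OF x] K(2) by (intro nrm_le) auto
  show ?thesis
    unfolding bounded_linear_on_def
  proof (intro conjI ballI allI exI)
    show "nrm J (\<lambda>i. if i < 1 then 0 else x (i - 1)) \<le> K * nrm J x" if "x \<in> carr J" for x
      using that by (rule bound)
    show "(\<lambda>i. if i < 1 then 0 else x (i - 1)) \<in> carr J" if "x \<in> carr J" for x
      using that by (rule mem)
  qed (simp_all add: fun_eq_iff)
qed

text \<open>The left shift undoes the right shift and kills the first unit vector,
  \<open>unit_block 1\<close>.\<close>

lemma james_extension: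
  "\<exists>\<phi>. algebra_hom (\<B> J) (\<B> J) \<phi> \<and> continuous_map (ntop (\<B> J)) (ntop (\<B> J)) \<phi> \<and>
    inj_on \<phi> (carr (\<B> J)) \<and> \<phi> (unt (\<B> J)) = unt (\<B> J) \<and>
    (\<forall>T. rank_one J T \<longrightarrow> rank_one J (\<phi> T)) \<and> \<phi> ` carr (\<B> J) \<noteq> carr (\<B> J)"
proof -
  obtain \<psi> where \<psi>: "character (\<B> J) \<psi>"
    using ex_character_J by blast
  show ?thesis
  proof (rule character_extension[OF banach_J normed_J \<psi> _ right_shift left_shift])
    \<comment> \<open>If both blocks were multiples of \<open>x\<close>, then
      \<open>unit_block 1\<close> would force \<open>x 1 = 0\<close>, but
      \<open>unit_block 2\<close> is 1 at this place.\<close>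
    show "cdim J (carr J) \<noteq> 1"
    proof
      assume "cdim J (carr J) = 1"
      then obtain x where x: "carr J = range (\<lambda>c. scl J c x)"
        using J.dim_eq_1_iff[OF J.subspace] by blast
      obtain c where "unit_block 1 = scl J c x"
        using x unit_block_mem[of 1] by auto
      then have "unit_block 1 0 = c * x 0" "unit_block 1 1 = c * x 1"
        by simp_all
      moreover obtain d where "unit_block 2 = scl J d x"
        using x unit_block_mem[of 2] by auto
      then have "unit_block 2 1 = d * x 1"
        by simp
      ultimately show False
        by (auto simp: unit_block_def)
    qed
    show "unit_block 1 \<in> carr J"
      by (rule unit_block_mem)
    show "unit_block 1 \<noteq> 0"
      by (auto simp: fun_eq_iff unit_block_def)
    show "(\<lambda>i. unit_block 1 (Suc i)) = 0"
      by (simp add: fun_eq_iff unit_block_def)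
  qed simp
qed

end

section \<open>Countable ordinals\<close>

text \<open>Without a bound, \<open>\<omega>\<^sub>1\<close> would be a countable union of countable
  initial segments.\<close>

lemma ex_countable_bound:
  assumes "countable C" "\<And>c. c \<in> C \<Longrightarrow> c < \<omega>\<^sub>1"
  shows "\<exists>b<\<omega>\<^sub>1. \<forall>c\<in>C. c \<le> b"
proof (rule ccontr)
  assume neg: "\<not> ?thesis"
  have "{..<\<omega>\<^sub>1} \<subseteq> (\<Union>c\<in>C. {..<c})"
  proof
    fix b assume "b \<in> {..<\<omega>\<^sub>1}"
    then show "b \<in> (\<Union>c\<in>C. {..<c})"
      using neg by (auto simp: not_le)
  qed
  moreover have "countable (\<Union>c\<in>C. {..<c})"
    using assms countable_lessThan_if_less_omega1 by (intro countable_UN) auto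
  ultimately show False
    using countable_subset uncountable_lessThan_omega1 by blast
qed

lemma ex_between_omega1:
  assumes "c < \<omega>\<^sub>1"
  shows "\<exists>d. c < d \<and> d < \<omega>\<^sub>1"
proof (rule ccontr)
  assume "\<not> ?thesis"
  then have "{..<\<omega>\<^sub>1} \<subseteq> insert c {..<c}"
    by (auto simp: not_less le_less)
  moreover have "countable (insert c {..<c})"
    using countable_lessThan_if_less_omega1[OF assms] by simp
  ultimately show False
    using countable_subset uncountable_lessThan_omega1 by blast
qed

lemma ex_less_omega1: "\<exists>a. a < \<omega>\<^sub>1"
proof -
  have "{..<\<omega>\<^sub>1} \<noteq> {}"
    using uncountable_lessThan_omega1 by (metis countable_empty)
  then show ?thesis
    by blast
qed

lemma eventually_at_left_omega1:
  "eventually P (at_left \<omega>\<^sub>1) \<longleftrightarrow> (\<exists>b<\<omega>\<^sub>1. \<forall>a. b < a \<longrightarrow> a < \<omega>\<^sub>1 \<longrightarrow> P a)"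
  using ex_less_omega1 eventually_at_left by blast

lemma at_left_omega1_neq_bot: "at_left \<omega>\<^sub>1 \<noteq> bot"
proof
  assume "at_left \<omega>\<^sub>1 = bot"
  then have "eventually (\<lambda>_. False) (at_left \<omega>\<^sub>1)"
    by simp
  then show False
    using ex_between_omega1 by (auto simp: eventually_at_left_omega1)
qed

text \<open>The filter is closed under countable intersections, because countably many thresholds
  have a common bound below \<open>\<omega>\<^sub>1\<close>. This property of
  \<open>\<omega>\<^sub>1\<close> turns approximate statements into exact ones.\<close>

lemma eventually_countable_omega1:
  assumes "countable C" "\<And>j. j \<in> C \<Longrightarrow> eventually (P j) (at_left \<omega>\<^sub>1)"
  shows "eventually (\<lambda>a. \<forall>j\<in>C. P j a) (at_left \<omega>\<^sub>1)"
proof -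
  obtain b where b: "\<And>j. j \<in> C \<Longrightarrow> b j < \<omega>\<^sub>1" "\<And>j a. j \<in> C \<Longrightarrow> b j < a \<Longrightarrow> a < \<omega>\<^sub>1 \<Longrightarrow> P j a"
    using assms(2) unfolding eventually_at_left_omega1 by metis
  obtain d where "d < \<omega>\<^sub>1" "\<forall>c\<in>b ` C. c \<le> d"
    using ex_countable_bound[of "b ` C"] assms(1) b(1) by auto
  then show ?thesis
    unfolding eventually_at_left_omega1 using b(2) by (intro exI[of _ d]) (auto intro: le_less_trans)
qed

text \<open>The bounds 1 / (k + 1) for all \<open>k\<close> hold simultaneously on a final
  segment.\<close>

lemma tendsto_0_omega1_iff:
  fixes g :: "ordinal \<Rightarrow> complex"
  shows "(g \<longlongrightarrow> 0) (at_left \<omega>\<^sub>1) \<longleftrightarrow> (\<forall>\<^sub>F a in at_left \<omega>\<^sub>1. g a = 0)"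
proof
  assume g: "(g \<longlongrightarrow> 0) (at_left \<omega>\<^sub>1)"
  have "\<forall>\<^sub>F a in at_left \<omega>\<^sub>1. \<forall>k\<in>UNIV. dist (g a) 0 < 1 / real (Suc k)"
    using tendstoD[OF g] by (intro eventually_countable_omega1) auto
  then show "\<forall>\<^sub>F a in at_left \<omega>\<^sub>1. g a = 0"
  proof eventually_elim
    case (elim a)
    show ?case
    proof (rule ccontr)
      assume "g a \<noteq> 0"
      then obtain k where "1 / real (Suc k) < cmod (g a)"
        using nat_approx_posE[of "cmod (g a)"] by (auto simp: inverse_eq_divide)
      then show False
        using elim by (auto dest: spec[of _ k])
    qed
  qed
qed (rule tendsto_eventually)

section \<open>Continuous functions on ordinals\<close>

text \<open>Continuity at an ordinal is one-sided, because the initial segment up to it is open. The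
  quantifier over \<open>x<a\<close> makes the condition vacuous at the least ordinal, where no
  \<open>c<a\<close> exists. Only values up to \<open>a\<close> matter, so it can be checked on any
  function that agrees there.\<close>

definition left_continuous :: "(ordinal \<Rightarrow> complex) \<Rightarrow> ordinal \<Rightarrow> bool" where
  "left_continuous f a \<longleftrightarrow>
    (\<forall>e>0. \<forall>x<a. \<exists>c<a. \<forall>b. c < b \<longrightarrow> b \<le> a \<longrightarrow> dist (f b) (f a) < e)"

text \<open>The segment is either an open ray ending at the successor of \<open>a\<close> or the
  whole type.\<close>

lemma open_atMost_ordinal: "open {..a :: ordinal}"
proof (cases "\<exists>b. a < b")
  case True
  define s where "s = (LEAST b. a < b)"
  have "a < s"
    unfolding s_def using True by (rule LeastI_ex)
  moreover have "b \<le> a" if "b < s" for b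
    using not_less_Least[of b "\<lambda>b. a < b"] that by (simp add: s_def not_less)
  ultimately have "{..a} = {..<s}"
    by auto
  then show ?thesis
    by simp
next
  case False
  then have "{..a} = UNIV"
    by (auto simp: not_less)
  then show ?thesis
    by simp
qed

lemma continuous_on_iff_left_continuous:
  "continuous_on {..\<omega>\<^sub>1} f \<longleftrightarrow> (\<forall>a\<le>\<omega>\<^sub>1. left_continuous f a)"
proof
  assume f: "continuous_on {..\<omega>\<^sub>1} f"
  show "\<forall>a\<le>\<omega>\<^sub>1. left_continuous f a"
    unfolding left_continuous_def
  proof (intro allI impI)
    fix a x and e :: real assume a: "a \<le> \<omega>\<^sub>1" and e: "0 < e" and x: "x < a"
    obtain U where U: "open U" "a \<in> U" "\<And>b. b \<le> \<omega>\<^sub>1 \<Longrightarrow> b \<in> U \<Longrightarrow> f b \<in> ball (f a) e"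
      using f a e unfolding continuous_on_topological by (metis atMost_iff centre_in_ball open_ball)
    obtain c where "c < a" "{c<..a} \<subseteq> U"
      using open_left[OF U(1,2) x] by blast
    then show "\<exists>c<a. \<forall>b. c < b \<longrightarrow> b \<le> a \<longrightarrow> dist (f b) (f a) < e"
      using U(3) a by (intro exI[of _ c]) (auto simp: dist_commute subset_eq)
  qed
next
  assume f: "\<forall>a\<le>\<omega>\<^sub>1. left_continuous f a"
  show "continuous_on {..\<omega>\<^sub>1} f"
    unfolding continuous_on_topological
  proof (intro ballI allI impI)
    fix a and B :: "complex set" assume a: "a \<in> {..\<omega>\<^sub>1}" and B: "open B" "f a \<in> B"
    obtain e where e: "0 < e" "ball (f a) e \<subseteq> B"
      using B openE by blast
    show "\<exists>A. open A \<and> a \<in> A \<and> (\<forall>b\<in>{..\<omega>\<^sub>1}. b \<in> A \<longrightarrow> f b \<in> B)"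
    proof (cases "\<exists>x. x < a")
      case True
      then obtain c where c: "c < a" "\<And>b. c < b \<Longrightarrow> b \<le> a \<Longrightarrow> dist (f b) (f a) < e"
        using f a e(1) unfolding left_continuous_def by blast
      have "open ({c<..} \<inter> {..a})"
        by (intro open_Int open_greaterThan open_atMost_ordinal)
      moreover have "f b \<in> B" if "c < b" "b \<le> a" for b
        using c(2)[OF that] e(2) by (auto simp: dist_commute subset_eq)
      ultimately show ?thesis
        using c(1) by (intro exI[of _ "{c<..} \<inter> {..a}"]) auto
    next
      case False
      then have "b = a" if "b \<le> a" for b
        using that by (auto simp: le_less)
      then show ?thesis
        using open_atMost_ordinal[of a] B(2) by (intro exI[of _ "{..a}"]) auto
    qed
  qed
qed

lemma left_continuous_cong:
  "(\<And>b. b \<le> a \<Longrightarrow> f b = g b) \<Longrightarrow> left_continuous f a \<longleftrightarrow> left_continuous g a"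
  unfolding left_continuous_def by (smt (verit) order_refl)

lemma left_continuousD:
  assumes "left_continuous f a" "0 < e" "x < a"
  obtains c where "x \<le> c" "c < a" "\<And>b. c < b \<Longrightarrow> b \<le> a \<Longrightarrow> dist (f b) (f a) < e"
proof -
  obtain c where "c < a" "\<And>b. c < b \<Longrightarrow> b \<le> a \<Longrightarrow> dist (f b) (f a) < e"
    using assms unfolding left_continuous_def by blast
  then show ?thesis
    using that[of "max x c"] assms(3) by simp
qed

lemma left_continuous_eventually_const:
  assumes "c < a" "\<And>b. c < b \<Longrightarrow> b \<le> a \<Longrightarrow> f b = f a"
  shows "left_continuous f a"
  unfolding left_continuous_def
proof (intro allI impI exI conjI)
  show "dist (f b) (f a) < e" if "0 < e" "c < b" "b \<le> a" for b and e :: real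
    using assms(2)[OF that(2,3)] that(1) by simp
qed (rule assms(1))

text \<open>Otherwise \<open>t\<close> oscillates by \<open>e\<close> along an increasing sequence, hence at its supremum.\<close>

lemma oscillation_small:
  assumes t: "\<And>a. a < \<omega>\<^sub>1 \<Longrightarrow> left_continuous t a" and e: "0 < e"
  shows "\<exists>\<gamma><\<omega>\<^sub>1. \<forall>a b. \<gamma> < a \<longrightarrow> a < b \<longrightarrow> b < \<omega>\<^sub>1 \<longrightarrow> dist (t a) (t b) < e"
proof (rule ccontr)
  assume "\<not> ?thesis"
  then have "\<forall>\<gamma>. \<gamma> < \<omega>\<^sub>1 \<longrightarrow> (\<exists>a b. \<gamma> < a \<and> a < b \<and> b < \<omega>\<^sub>1 \<and> e \<le> dist (t a) (t b))"
    by (meson not_less)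
  then obtain A B where AB: "\<And>\<gamma>. \<gamma> < \<omega>\<^sub>1 \<Longrightarrow> \<gamma> < A \<gamma> \<and> A \<gamma> < B \<gamma> \<and> B \<gamma> < \<omega>\<^sub>1 \<and> e \<le> dist (t (A \<gamma>)) (t (B \<gamma>))"
    by metis
  obtain g0 where g0: "g0 < \<omega>\<^sub>1"
    using ex_less_omega1 by blast
  \<comment> \<open>From \<open>g n\<close> on, \<open>A (g n)\<close> and
    \<open>g (Suc n) = B (g n)\<close> are two further points between which \<open>t\<close> differs
    by at least \<open>e\<close>.\<close>
  define g where "g = rec_nat g0 (\<lambda>_. B)"
  have g_simps: "g 0 = g0" "\<And>n. g (Suc n) = B (g n)"
    by (simp_all add: g_def)
  have g: "g n < \<omega>\<^sub>1" for n
    by (induction n) (simp_all add: g_simps g0 AB)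
  obtain b where b: "b < \<omega>\<^sub>1" "\<forall>c\<in>range g. c \<le> b"
    using ex_countable_bound[of "range g"] g by auto
  \<comment> \<open>The supremum of a countable sequence stays below
    \<open>\<omega>\<^sub>1\<close>, so \<open>t\<close> is left-continuous there; any
    \<open>c < l\<close> is exceeded by some \<open>g n\<close>.\<close>
  define l where "l = (LEAST x. \<forall>n. g n \<le> x)"
  have l: "g n \<le> l" for n
    unfolding l_def using LeastI[of "\<lambda>x. \<forall>n. g n \<le> x" b] b(2) by blast
  have "l \<le> b"
    unfolding l_def using Least_le[of "\<lambda>x. \<forall>n. g n \<le> x" b] b(2) by blast
  then have "l < \<omega>\<^sub>1"
    using b(1) by simp
  have "g 0 < g 1"
    using AB[OF g0] by (auto simp: g_simps)
  then have "g 0 < l"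
    using l[of 1] by simp
  then obtain c where c: "c < l" "\<And>b. c < b \<Longrightarrow> b \<le> l \<Longrightarrow> dist (t b) (t l) < e / 2"
    using left_continuousD[OF t[OF \<open>l < \<omega>\<^sub>1\<close>], of "e / 2" "g 0"] e by auto
  obtain n where n: "c < g n"
    using not_less_Least[of c "\<lambda>x. \<forall>n. g n \<le> x"] c(1) by (auto simp: l_def not_le)
  have AB': "g n < A (g n)" "A (g n) < g (Suc n)" "e \<le> dist (t (A (g n))) (t (g (Suc n)))"
    using AB[OF g[of n]] by (simp_all add: g_simps)
  have "dist (t (A (g n))) (t l) < e / 2" "dist (t (g (Suc n))) (t l) < e / 2"
    using c(2)[of "A (g n)"] c(2)[of "g (Suc n)"] n AB'(1,2) l[of "Suc n"] by auto
  then have "dist (t (A (g n))) (t (g (Suc n))) < e"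
    using dist_triangle_half_l by blast
  then show False
    using AB'(3) by simp
qed

text \<open>Beyond a common bound of the countably many thresholds, the oscillation is below every 1
  / (k + 1).\<close>

lemma eventually_constant:
  assumes "\<And>a. a < \<omega>\<^sub>1 \<Longrightarrow> left_continuous t a"
  shows "\<exists>c. \<forall>\<^sub>F a in at_left \<omega>\<^sub>1. t a = c"
proof -
  have "\<exists>\<gamma>. \<gamma> < \<omega>\<^sub>1 \<and> (\<forall>a b. \<gamma> < a \<longrightarrow> a < b \<longrightarrow> b < \<omega>\<^sub>1 \<longrightarrow> dist (t a) (t b) < 1 / real (Suc k))" for k
    using oscillation_small[OF assms, of "1 / real (Suc k)"] by auto
  then obtain \<gamma> where \<gamma>: "\<And>k. \<gamma> k < \<omega>\<^sub>1"
    "\<And>k a b. \<gamma> k < a \<Longrightarrow> a < b \<Longrightarrow> b < \<omega>\<^sub>1 \<Longrightarrow> dist (t a) (t b) < 1 / real (Suc k)"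
    by metis
  obtain d where d: "d < \<omega>\<^sub>1" "\<forall>c\<in>range \<gamma>. c \<le> d"
    using ex_countable_bound[of "range \<gamma>"] \<gamma>(1) by auto
  \<comment> \<open>The estimates hold strictly beyond \<open>\<gamma> k\<close>, so the point of
    comparison has to exceed \<open>d\<close>.\<close>
  obtain d' where d': "d < d'" "d' < \<omega>\<^sub>1"
    using ex_between_omega1[OF d(1)] by blast
  have "t a = t d'" if a: "d' < a" "a < \<omega>\<^sub>1" for a
  proof (rule ccontr)
    assume "t a \<noteq> t d'"
    then obtain k where "1 / real (Suc k) < dist (t d') (t a)"
      using nat_approx_posE[of "dist (t d') (t a)"] by (auto simp: inverse_eq_divide)
    moreover have "\<gamma> k \<le> d"
      using d(2) by auto
    then have "\<gamma> k < d'"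
      using d'(1) by simp
    ultimately show False
      using \<gamma>(2)[of k d' a] a by simp
  qed
  then show ?thesis
    unfolding eventually_at_left_omega1 using d'(2) by blast
qed

section \<open>The Semadeni space\<close>

abbreviation (input) "W \<equiv> semadeni_space"

lemma scl_W [simp]: "scl W = (\<lambda>c f a. c * f a)"
  and nrm_W: "nrm W f = (SUP a\<in>{..\<omega>\<^sub>1}. cmod (f a))"
  by (simp_all add: semadeni_space_def)

lemma carr_W: "carr W = {f. continuous_on {..\<omega>\<^sub>1} f \<and> (\<forall>a. a \<notin> {..\<omega>\<^sub>1} \<longrightarrow> f a = 0)}"
  by (simp add: semadeni_space_def)

lemma mem_W_iff: "f \<in> carr W \<longleftrightarrow> (\<forall>a\<le>\<omega>\<^sub>1. left_continuous f a) \<and> (\<forall>a>\<omega>\<^sub>1. f a = 0)"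
  by (auto simp: carr_W continuous_on_iff_left_continuous not_le)

text \<open>Induction on \<open>a\<close> in place of compactness: on some interval from
  \<open>c\<close> to \<open>a\<close> the values are within 1 of \<open>f a\<close>, and up to
  \<open>c\<close> the induction hypothesis applies.\<close>

lemma bounded_W:
  assumes "f \<in> carr W"
  shows "\<exists>M. \<forall>a\<le>\<omega>\<^sub>1. cmod (f a) \<le> M"
proof -
  have "a \<le> \<omega>\<^sub>1 \<longrightarrow> (\<exists>M. \<forall>b\<le>a. cmod (f b) \<le> M)" for a
  proof (induction a rule: less_induct)
    case (less a)
    show ?case
    proof
      assume a: "a \<le> \<omega>\<^sub>1"
      show "\<exists>M. \<forall>b\<le>a. cmod (f b) \<le> M"
      proof (cases "\<exists>x. x < a")
        case True
        then obtain c where c: "c < a" "\<And>b. c < b \<Longrightarrow> b \<le> a \<Longrightarrow> dist (f b) (f a) < 1"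
          using assms a left_continuousD[of f a 1] by (metis mem_W_iff zero_less_one)
        then obtain M where M: "\<And>b. b \<le> c \<Longrightarrow> cmod (f b) \<le> M"
          using less a by fastforce
        have "cmod (f b) \<le> max M (cmod (f a) + 1)" if "b \<le> a" for b
        proof (cases "b \<le> c")
          case False
          then have "dist (f b) (f a) < 1"
            using c(2) that by simp
          then show ?thesis
            using norm_triangle_sub[of "f b" "f a"] by (simp add: dist_norm)
        qed (use M in \<open>simp add: le_max_iff_disj\<close>)
        then show ?thesis
          by blast
      next
        case False
        then have "b = a" if "b \<le> a" for b
          using that by (auto simp: le_less)
        then show ?thesis
          by blast
      qed
    qed
  qed
  then show ?thesis
    by blast
qed

lemma cmod_le_nrm_W:
  assumes f: "f \<in> carr W"
  shows "cmod (f a) \<le> nrm W f"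
proof -
  obtain M where M: "\<And>a. a \<le> \<omega>\<^sub>1 \<Longrightarrow> cmod (f a) \<le> M"
    using bounded_W[OF f] by blast
  have bdd: "bdd_above ((\<lambda>a. cmod (f a)) ` {..\<omega>\<^sub>1})"
    using M by (intro bdd_aboveI2[of _ _ M]) simp
  have le: "cmod (f a) \<le> nrm W f" if "a \<le> \<omega>\<^sub>1" for a
    unfolding nrm_W using bdd that by (intro cSUP_upper) auto
  show ?thesis
  proof (cases "a \<le> \<omega>\<^sub>1")
    case False
    then have "f a = 0"
      using f by (simp add: mem_W_iff)
    then show ?thesis
      using le[of \<omega>\<^sub>1] norm_ge_zero[of "f \<omega>\<^sub>1"] by (simp del: norm_ge_zero)
  qed (rule le)
qed

lemma nrm_W_le: "(\<And>a. a \<le> \<omega>\<^sub>1 \<Longrightarrow> cmod (f a) \<le> C) \<Longrightarrow> nrm W f \<le> C"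
  unfolding nrm_W by (rule cSUP_least) auto

lemma normed_W: "complex_normed_space W"
proof (rule complex_normed_space.intro)
  show vs: "vector_space (scl W)"
    by unfold_locales (simp_all add: fun_eq_iff algebra_simps)
  interpret v: vector_space "scl W" by (rule vs)
  show subspace: "module.subspace (scl W) (carr W)"
    unfolding v.subspace_def by (auto simp: carr_W plus_fun_def zero_fun_def intro!: continuous_intros)
  fix f assume f: "f \<in> carr W"
  show nonneg: "0 \<le> nrm W f"
    using cmod_le_nrm_W[OF f, of \<omega>\<^sub>1] norm_ge_zero[of "f \<omega>\<^sub>1"] by linarith
  show "nrm W f = 0 \<longleftrightarrow> f = 0"
  proof
    assume "nrm W f = 0"
    then show "f = 0"
      using cmod_le_nrm_W[OF f] by (simp add: fun_eq_iff)
  next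
    assume "f = 0"
    then have "nrm W f \<le> 0"
      by (intro nrm_W_le) simp
    then show "nrm W f = 0"
      using nonneg by simp
  qed
  have cf: "scl W c f \<in> carr W" for c
    using v.subspace_scale[OF subspace f] .
  show "nrm W (scl W c f) = cmod c * nrm W f" for c
  proof (rule antisym)
    show "nrm W (scl W c f) \<le> cmod c * nrm W f"
      by (intro nrm_W_le) (simp add: norm_mult mult_left_mono cmod_le_nrm_W[OF f])
    show "cmod c * nrm W f \<le> nrm W (scl W c f)"
    proof (cases "c = 0")
      case True
      then show ?thesis
        using cmod_le_nrm_W[OF cf, of c \<omega>\<^sub>1] by simp
    next
      case False
      have "nrm W f \<le> nrm W (scl W c f) / cmod c"
      proof (rule nrm_W_le)
        fix a
        show "cmod (f a) \<le> nrm W (scl W c f) / cmod c"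
          using cmod_le_nrm_W[OF cf, of c a] False by (simp add: norm_mult pos_le_divide_eq mult.commute)
      qed
      then show ?thesis
        using False by (simp add: pos_le_divide_eq mult.commute)
    qed
  qed
  fix g assume g: "g \<in> carr W"
  show "nrm W (f + g) \<le> nrm W f + nrm W g"
  proof (rule nrm_W_le)
    fix a
    show "cmod ((f + g) a) \<le> nrm W f + nrm W g"
      using norm_triangle_ineq[of "f a" "g a"] cmod_le_nrm_W[OF f, of a] cmod_le_nrm_W[OF g, of a] by simp
  qed
qed

interpretation W: complex_normed_space W
  by (rule normed_W)

interpretation W: operator_space W
  by unfold_locales

lemma banach_W: "complex_banach_space W"
proof (rule W.complex_banach_spaceI)
  fix \<sigma> :: "nat \<Rightarrow> ordinal \<Rightarrow> complex"
  assume range: "range \<sigma> \<subseteq> carr W"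
    and cauchy: "\<And>e. 0 < e \<Longrightarrow> \<exists>N. \<forall>m\<ge>N. \<forall>n\<ge>N. nrm W (\<sigma> m - \<sigma> n) < e"
  have mem: "\<sigma> n \<in> carr W" for n
    using range by auto
  have coord: "cmod (\<sigma> m a - \<sigma> n a) \<le> nrm W (\<sigma> m - \<sigma> n)" for m n a
    using cmod_le_nrm_W[of "\<sigma> m - \<sigma> n" a] mem by simp
  have "convergent (\<lambda>n. \<sigma> n a)" for a
  proof (rule Cauchy_convergent, rule CauchyI)
    fix e :: real assume "0 < e"
    then obtain N where "\<forall>m\<ge>N. \<forall>n\<ge>N. nrm W (\<sigma> m - \<sigma> n) < e"
      using cauchy by blast
    then show "\<exists>N. \<forall>m\<ge>N. \<forall>n\<ge>N. norm (\<sigma> m a - \<sigma> n a) < e"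
      using coord by (meson le_less_trans)
  qed
  then obtain f where f: "\<And>a. (\<lambda>n. \<sigma> n a) \<longlonglongrightarrow> f a"
    unfolding convergent_def by metis
  have close: "cmod (\<sigma> n a - f a) \<le> e"
    if N: "\<forall>m\<ge>N. \<forall>n\<ge>N. nrm W (\<sigma> m - \<sigma> n) < e" "N \<le> n" for e N n a
  proof (rule tendsto_upperbound)
    show "(\<lambda>m. cmod (\<sigma> n a - \<sigma> m a)) \<longlonglongrightarrow> cmod (\<sigma> n a - f a)"
      using f by (intro tendsto_intros)
    show "\<forall>\<^sub>F m in sequentially. cmod (\<sigma> n a - \<sigma> m a) \<le> e"
      using eventually_ge_at_top[of N]
    proof eventually_elim
      case (elim m)
      then show ?case
        using N coord[of n a m] by (meson less_imp_le order_trans)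
    qed
  qed simp
  have uniform: "\<exists>N. \<forall>n\<ge>N. \<forall>a. dist (\<sigma> n a) (f a) < e" if e: "0 < e" for e
  proof -
    obtain N where N: "\<forall>m\<ge>N. \<forall>n\<ge>N. nrm W (\<sigma> m - \<sigma> n) < e / 2"
      using cauchy[of "e / 2"] e by auto
    have "dist (\<sigma> n a) (f a) < e" if "N \<le> n" for n a
      using close[OF N that, of a] e by (simp add: dist_norm)
    then show ?thesis
      by blast
  qed
  have "continuous_on {..\<omega>\<^sub>1} f"
  proof (rule uniform_limit_theorem)
    show "\<forall>\<^sub>F n in sequentially. continuous_on {..\<omega>\<^sub>1} (\<sigma> n)"
      using mem by (simp add: carr_W)
    show "uniform_limit {..\<omega>\<^sub>1} \<sigma> f sequentially"
      unfolding uniform_limit_iff eventually_sequentially using uniform by blast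
  qed simp
  moreover have "f a = 0" if "a \<notin> {..\<omega>\<^sub>1}" for a
    using f[of a] mem that by (simp add: carr_W LIMSEQ_const_iff)
  ultimately have fW: "f \<in> carr W"
    by (simp add: carr_W)
  have "\<exists>N. \<forall>n\<ge>N. nrm W (\<sigma> n - f) < e" if e: "0 < e" for e
  proof -
    obtain N where N: "\<And>n a. N \<le> n \<Longrightarrow> dist (\<sigma> n a) (f a) < e / 2"
      using uniform[of "e / 2"] e by auto
    have "nrm W (\<sigma> n - f) < e" if "N \<le> n" for n
    proof -
      have "nrm W (\<sigma> n - f) \<le> e / 2"
        using N[OF that] by (intro nrm_W_le) (simp add: dist_norm less_imp_le)
      then show ?thesis
        using e by simp
    qed
    then show ?thesis
      by blast
  qed
  then show "\<exists>f\<in>carr W. \<forall>e>0. \<exists>N. \<forall>n\<ge>N. nrm W (\<sigma> n - f) < e"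
    using fW by blast
qed

text \<open>Continuity at \<open>\<omega>\<^sub>1\<close> makes
  \<open>f - f \<omega>\<^sub>1\<close> tend to 0 there, and by the countability argument it then
  vanishes on a final segment.\<close>

lemma eventually_eq_omega1:
  assumes "f \<in> carr W"
  shows "\<forall>\<^sub>F a in at_left \<omega>\<^sub>1. f a = f \<omega>\<^sub>1"
proof -
  obtain x where x: "x < \<omega>\<^sub>1"
    using ex_less_omega1 by blast
  have lc: "left_continuous f \<omega>\<^sub>1"
    using assms by (simp add: mem_W_iff)
  have "((\<lambda>a. f a - f \<omega>\<^sub>1) \<longlongrightarrow> 0) (at_left \<omega>\<^sub>1)"
  proof (rule tendstoI)
    fix e :: real assume "0 < e"
    then obtain c where "c < \<omega>\<^sub>1" "\<And>b. c < b \<Longrightarrow> b \<le> \<omega>\<^sub>1 \<Longrightarrow> dist (f b) (f \<omega>\<^sub>1) < e"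
      using left_continuousD[OF lc _ x] by blast
    then show "\<forall>\<^sub>F a in at_left \<omega>\<^sub>1. dist (f a - f \<omega>\<^sub>1) 0 < e"
      unfolding eventually_at_left_omega1 by (intro exI[of _ c]) (simp add: dist_norm)
  qed
  then show ?thesis
    by (simp add: tendsto_0_omega1_iff)
qed

text \<open>The gliding hump: otherwise there would be arbitrarily long sums of disjointly supported
  functions of norm at most 1 with \<open>f\<close> at least \<open>\<delta>\<close> on each summand.\<close>

lemma functional_small_W:
  assumes f: "bounded_linear_on W scalar_space f" and \<delta>: "0 < \<delta>"
  shows "\<exists>\<gamma><\<omega>\<^sub>1. \<forall>w\<in>carr W. nrm W w \<le> 1 \<longrightarrow> (\<forall>a\<le>\<gamma>. w a = 0) \<longrightarrow> w \<omega>\<^sub>1 = 0 \<longrightarrow> cmod (f w) < \<delta>"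
proof (rule ccontr)
  assume neg: "\<not> ?thesis"
  interpret C: complex_normed_space scalar_space by (rule complex_normed_space_scalar_space)
  interpret f: bounded_linear_map W scalar_space f by unfold_locales fact
  have hump: "\<exists>y\<in>carr W. \<exists>\<gamma><\<omega>\<^sub>1. (\<forall>a>\<gamma>. y a = 0) \<and> (\<forall>a. cmod (y a) \<le> 1) \<and> n * \<delta> \<le> Re (f y)" for n :: nat
  proof (induction n)
    case 0
    obtain x where "x < \<omega>\<^sub>1"
      using ex_less_omega1 by blast
    moreover have "real 0 * \<delta> \<le> Re (f 0)"
      unfolding f.zero by simp
    ultimately show ?case
      using W.zero_mem by (metis norm_zero zero_fun_apply zero_le_one)
  next
    case (Suc n)
    then obtain y \<gamma> where y: "y \<in> carr W" "\<gamma> < \<omega>\<^sub>1" "\<And>a. \<gamma> < a \<Longrightarrow> y a = 0" "\<And>a. cmod (y a) \<le> 1" "n * \<delta> \<le> Re (f y)"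
      by blast
    obtain w where w: "w \<in> carr W" "nrm W w \<le> 1" "\<And>a. a \<le> \<gamma> \<Longrightarrow> w a = 0" "w \<omega>\<^sub>1 = 0" "\<delta> \<le> cmod (f w)"
      using neg y(2) by (meson not_less)
    define c where "c = cnj (f w) / cmod (f w)"
    have fw: "f w \<noteq> 0"
      using w(5) \<delta> by auto
    have c: "cmod c = 1" "c * f w = cmod (f w)"
      using fw complex_norm_square[of "f w"]
      by (simp_all add: c_def norm_divide power2_eq_square mult.commute nonzero_divide_eq_eq)
    \<comment> \<open>A function vanishing at \<open>\<omega>\<^sub>1\<close> vanishes on an
      interval below it as well, so the hump ends early enough for another one to follow.\<close>
    obtain \<beta> where \<beta>: "\<beta> < \<omega>\<^sub>1" "\<And>a. \<beta> < a \<Longrightarrow> a < \<omega>\<^sub>1 \<Longrightarrow> w a = 0"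
      using eventually_eq_omega1[OF w(1)] w(4) unfolding eventually_at_left_omega1 by auto
    have w0: "w a = 0" if "\<beta> < a" for a
      using \<beta>(2)[OF that] w(1,4) by (cases a \<omega>\<^sub>1 rule: linorder_cases) (auto simp: mem_W_iff)
    let ?y = "y + scl W c w"
    have "?y \<in> carr W"
      using y(1) w(1) by (intro W.add_mem W.scl_mem)
    moreover have "max \<gamma> \<beta> < \<omega>\<^sub>1" "\<forall>a>max \<gamma> \<beta>. ?y a = 0"
      using y(2,3) \<beta>(1) w0 by auto
    \<comment> \<open>At each point one of the two summands is 0, so the supremum norm does not grow
      with the number of humps.\<close>
    moreover have "cmod (?y a) \<le> 1" for a
    proof (cases "a \<le> \<gamma>")
      case True
      then show ?thesis
        using w(3) y(4) by simp
    next
      case False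
      then show ?thesis
        using y(3) cmod_le_nrm_W[OF w(1), of a] w(2) c(1) by (simp add: norm_mult)
    qed
    moreover have "Suc n * \<delta> \<le> Re (f ?y)"
    proof -
      have "f ?y = f y + of_real (cmod (f w))"
        using f.add[OF y(1) W.scl_mem[OF w(1)], of c] f.scl[OF w(1), of c] c(2) by simp
      then have "Re (f ?y) = Re (f y) + cmod (f w)"
        by simp
      then show ?thesis
        using y(5) w(5) by (simp add: distrib_right)
    qed
    ultimately show ?case
      by blast
  qed
  obtain K where K: "0 < K" "\<And>x. x \<in> carr W \<Longrightarrow> cmod (f x) \<le> K * nrm W x"
    using f.bounded by auto
  obtain n :: nat where n: "K / \<delta> < n"
    using reals_Archimedean2 by blast
  obtain y where y: "y \<in> carr W" "\<And>a. cmod (y a) \<le> 1" "n * \<delta> \<le> Re (f y)"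
    using hump[of n] by blast
  have "nrm W y \<le> 1"
    using y(2) by (rule nrm_W_le)
  then have "K * nrm W y \<le> K * 1"
    using K(1) by (intro mult_left_mono) auto
  then have "n * \<delta> \<le> K"
    using K(2)[OF y(1)] y(3) complex_Re_le_cmod[of "f y"] by linarith
  then show False
    using n \<delta> by (simp add: pos_divide_less_eq)
qed

text \<open>This reflects that the dual space is \<open>l\<^sub>1([0, \<omega>\<^sub>1])\<close>, whose elements have countable support.\<close>

lemma functional_vanishing:
  assumes f: "bounded_linear_on W scalar_space f"
  shows "\<exists>\<gamma><\<omega>\<^sub>1. \<forall>w\<in>carr W. (\<forall>a\<le>\<gamma>. w a = 0) \<longrightarrow> w \<omega>\<^sub>1 = 0 \<longrightarrow> f w = 0"
proof -
  interpret C: complex_normed_space scalar_space by (rule complex_normed_space_scalar_space)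
  interpret f: bounded_linear_map W scalar_space f by unfold_locales fact
  have "\<exists>\<gamma>. \<gamma> < \<omega>\<^sub>1 \<and> (\<forall>w\<in>carr W. nrm W w \<le> 1 \<longrightarrow> (\<forall>a\<le>\<gamma>. w a = 0) \<longrightarrow> w \<omega>\<^sub>1 = 0 \<longrightarrow> cmod (f w) < 1 / real (Suc k))" for k
    using functional_small_W[OF f, of "1 / real (Suc k)"] by auto
  then obtain \<gamma> where \<gamma>: "\<And>k. \<gamma> k < \<omega>\<^sub>1"
    "\<And>k w. w \<in> carr W \<Longrightarrow> nrm W w \<le> 1 \<Longrightarrow> (\<forall>a\<le>\<gamma> k. w a = 0) \<Longrightarrow> w \<omega>\<^sub>1 = 0 \<Longrightarrow> cmod (f w) < 1 / real (Suc k)"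
    by metis
  \<comment> \<open>One ordinal beyond all thresholds: on normalised functions supported past it and
    vanishing at \<open>\<omega>\<^sub>1\<close>, \<open>f\<close> is smaller than every 1 / (k +
    1).\<close>
  obtain d where d: "d < \<omega>\<^sub>1" "\<forall>c\<in>range \<gamma>. c \<le> d"
    using ex_countable_bound[of "range \<gamma>"] \<gamma>(1) by auto
  have "f w = 0" if w: "w \<in> carr W" "\<forall>a\<le>d. w a = 0" "w \<omega>\<^sub>1 = 0" for w
  proof (cases "w = 0")
    case False
    define r where "r = nrm W w"
    have r: "0 < r"
      unfolding r_def using w(1) False by (rule W.norm_pos)
    let ?v = "scl W (of_real (inverse r)) w"
    have v: "?v \<in> carr W"
      using w(1) by (rule W.scl_mem)
    have v1: "nrm W ?v \<le> 1"
      unfolding W.norm_scl[OF w(1)] using r by (simp add: norm_inverse flip: r_def)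
    have small: "cmod (f ?v) < 1 / real (Suc k)" for k
    proof (rule \<gamma>(2)[OF v v1])
      have "\<gamma> k \<le> d"
        using d(2) by auto
      then show "\<forall>a\<le>\<gamma> k. ?v a = 0"
        using w(2) by auto
      show "?v \<omega>\<^sub>1 = 0"
        using w(3) by simp
    qed
    have "f ?v = 0"
    proof (rule ccontr)
      assume "f ?v \<noteq> 0"
      then obtain k where "1 / real (Suc k) < cmod (f ?v)"
        using nat_approx_posE[of "cmod (f ?v)"] by (auto simp: inverse_eq_divide simp del: scl_W)
      then show False
        using small[of k] by simp
    qed
    then have "of_real (inverse r) * f w = 0"
      using f.scl[OF w(1), of "of_real (inverse r)"] by simp
    then show ?thesis
      using r by simp
  qed simp
  then show ?thesis
    using d(1) by blast
qed

section \<open>The character of the operators on the Semadeni space\<close>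

lemma operator_coordinate_W:
  assumes "T \<in> bounded_operators W"
  shows "bounded_linear_on W scalar_space (\<lambda>x. T x i)"
proof -
  interpret T: bounded_linear_map W W T by (rule W.operator_linear_map) fact
  obtain K where K: "0 < K" "\<And>x. x \<in> carr W \<Longrightarrow> nrm W (T x) \<le> K * nrm W x"
    using T.bounded by blast
  have "cmod (T x i) \<le> K * nrm W x" if "x \<in> carr W" for x
    using cmod_le_nrm_W[OF T.mem[OF that], of i] K(2)[OF that] by linarith
  moreover have "T (\<lambda>n. c * x n) = (\<lambda>n. c * T x n)" if "x \<in> carr W" for c x
    using T.scl[OF that, of c] by simp
  ultimately show ?thesis
    unfolding bounded_linear_on_def by (auto simp: T.add)
qed

text \<open>Indicators of clopen final intervals. They decrease to the indicator of the point
  \<open>\<omega>\<^sub>1\<close>, which is not continuous.\<close>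

definition tail :: "ordinal \<Rightarrow> ordinal \<Rightarrow> complex" where
  "tail \<alpha> a = (if \<alpha> < a \<and> a \<le> \<omega>\<^sub>1 then 1 else 0)"

lemma tail_mem: "tail \<alpha> \<in> carr W"
  unfolding mem_W_iff
proof (intro conjI allI impI)
  fix a assume a: "a \<le> \<omega>\<^sub>1"
  show "left_continuous (tail \<alpha>) a"
  proof (cases "\<alpha> < a")
    case True
    then show ?thesis
      using a by (intro left_continuous_eventually_const[of \<alpha>]) (auto simp: tail_def)
  next
    case False
    then have "left_continuous (tail \<alpha>) a \<longleftrightarrow> left_continuous (\<lambda>_. 0) a"
      by (intro left_continuous_cong) (auto simp: tail_def)
    then show ?thesis
      by (auto simp: left_continuous_def)
  qed
qed (auto simp: tail_def)

text \<open>The limit \<open>t\<close> of the images of the tails is continuous below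
  \<open>\<omega>\<^sub>1\<close>, hence eventually constant there with some value \<open>c\<close>.
  Only its value at \<open>\<omega>\<^sub>1\<close> may deviate from \<open>c\<close>; this
  deviation is the coefficient of \<open>e\<close>.\<close>

lemma ex_character_W: "\<exists>\<psi>. character (\<B> W) \<psi>"
proof (rule ex_character[where u = tail and e = "\<lambda>a. if a = \<omega>\<^sub>1 then 1 else 0" and F = "at_left \<omega>\<^sub>1"])
  show "complex_normed_space W"
    by (rule normed_W)
  show "at_left \<omega>\<^sub>1 \<noteq> bot"
    by (rule at_left_omega1_neq_bot)
  show "tail \<alpha> \<in> carr W" for \<alpha>
    by (rule tail_mem)
  show "nrm W (tail \<alpha>) \<le> 1" for \<alpha>
    by (rule nrm_W_le) (simp add: tail_def)
  show "((\<lambda>\<alpha>. tail \<alpha> a) \<longlongrightarrow> (if a = \<omega>\<^sub>1 then 1 else 0)) (at_left \<omega>\<^sub>1)" for a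
  proof (rule tendsto_eventually)
    obtain x where x: "x < \<omega>\<^sub>1"
      using ex_less_omega1 by blast
    show "\<forall>\<^sub>F \<alpha> in at_left \<omega>\<^sub>1. tail \<alpha> a = (if a = \<omega>\<^sub>1 then 1 else 0)"
      unfolding eventually_at_left_omega1
      by (rule exI[of _ "if a < \<omega>\<^sub>1 then a else x"]) (use x in \<open>auto simp: tail_def\<close>)
  qed
  show "(\<lambda>a. if a = \<omega>\<^sub>1 then 1 else 0) \<notin> carr W"
  proof
    assume "(\<lambda>a. if a = \<omega>\<^sub>1 then 1 else 0) \<in> carr W"
    from eventually_eq_omega1[OF this] obtain b where b: "b < \<omega>\<^sub>1"
      "\<And>a. b < a \<Longrightarrow> a < \<omega>\<^sub>1 \<Longrightarrow> (if a = \<omega>\<^sub>1 then 1 else 0) = (1 :: complex)"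
      unfolding eventually_at_left_omega1 by auto
    then show False
      using ex_between_omega1[OF b(1)] by (metis less_irrefl zero_neq_one)
  qed
next
  fix T assume T: "T \<in> bounded_operators W"
  interpret T: bounded_linear_map W W T by (rule W.operator_linear_map) fact
  have "\<exists>\<gamma>. \<gamma> < \<omega>\<^sub>1 \<and> (\<forall>w\<in>carr W. (\<forall>a\<le>\<gamma>. w a = 0) \<longrightarrow> w \<omega>\<^sub>1 = 0 \<longrightarrow> T w i = 0)" for i
    using functional_vanishing[OF operator_coordinate_W[OF T]] by blast
  then obtain \<gamma> where \<gamma>: "\<And>i. \<gamma> i < \<omega>\<^sub>1"
    "\<And>i w. w \<in> carr W \<Longrightarrow> (\<forall>a\<le>\<gamma> i. w a = 0) \<Longrightarrow> w \<omega>\<^sub>1 = 0 \<Longrightarrow> T w i = 0"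
    by metis
  define t where "t i = T (tail (\<gamma> i)) i" for i
  have t: "T (tail \<alpha>) i = t i" if "\<gamma> i \<le> \<alpha>" "\<alpha> < \<omega>\<^sub>1" for \<alpha> i
  proof -
    \<comment> \<open>The difference vanishes up to \<open>\<gamma> i\<close> and, as both tails are
      1 there, at \<open>\<omega>\<^sub>1\<close>. So the net is eventually constant in each
      coordinate.\<close>
    have "T (tail \<alpha> - tail (\<gamma> i)) i = 0"
      using that by (intro \<gamma>(2) W.diff_mem tail_mem) (auto simp: tail_def)
    then show ?thesis
      by (simp add: t_def T.diff tail_mem)
  qed
  have lim: "((\<lambda>\<alpha>. T (tail \<alpha>) i) \<longlongrightarrow> t i) (at_left \<omega>\<^sub>1)" for i
    by (rule tendsto_eventually) (use \<gamma>(1) t in \<open>auto simp: eventually_at_left_omega1 intro!: exI[of _ "\<gamma> i"]\<close>)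
  have lc: "left_continuous t a" if a: "a < \<omega>\<^sub>1" for a
  proof -
    \<comment> \<open>One \<open>\<alpha>\<close> dominates the thresholds of all coordinates up to
      \<open>a\<close>, so that \<open>t\<close> agrees there with the continuous function
      \<open>T (tail \<alpha>)\<close>.\<close>
    have "countable {..a}"
      using countable_lessThan_if_less_omega1[OF a] by (simp add: lessThan_Suc_atMost ivl_disj_un_singleton(2)[symmetric])
    then obtain \<alpha> where \<alpha>: "\<alpha> < \<omega>\<^sub>1" "\<forall>c\<in>\<gamma> ` {..a}. c \<le> \<alpha>"
      using ex_countable_bound[of "\<gamma> ` {..a}"] \<gamma>(1) by auto
    have "left_continuous t a \<longleftrightarrow> left_continuous (T (tail \<alpha>)) a"
      using \<alpha> t by (intro left_continuous_cong) simp
    then show ?thesis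
      using T.mem[OF tail_mem[of \<alpha>]] a by (simp add: mem_W_iff less_imp_le)
  qed
  obtain c b where c: "b < \<omega>\<^sub>1" "\<And>a. b < a \<Longrightarrow> a < \<omega>\<^sub>1 \<Longrightarrow> t a = c"
    using eventually_constant[OF lc] unfolding eventually_at_left_omega1 by blast
  \<comment> \<open>The value at \<open>\<omega>\<^sub>1\<close> is replaced by the one that makes
    the function continuous.\<close>
  define g where "g a = (if a = \<omega>\<^sub>1 then c else t a)" for a
  have "t a = 0" if "\<omega>\<^sub>1 < a" for a
    using T.mem[OF tail_mem, of "\<gamma> a"] that by (simp add: t_def mem_W_iff)
  moreover have "left_continuous g a" if "a \<le> \<omega>\<^sub>1" for a
  proof (cases "a = \<omega>\<^sub>1")
    case True
    then show ?thesis
      using c by (intro left_continuous_eventually_const[of b]) (auto simp: g_def)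
  next
    case False
    then have "left_continuous g a \<longleftrightarrow> left_continuous t a"
      using that by (intro left_continuous_cong) (auto simp: g_def)
    then show ?thesis
      using lc False that by simp
  qed
  ultimately have "g \<in> carr W"
    by (auto simp: mem_W_iff g_def)
  moreover have "t i = g i + (t \<omega>\<^sub>1 - c) * (if i = \<omega>\<^sub>1 then 1 else 0)" for i
    by (simp add: g_def)
  ultimately show "\<exists>g\<in>carr W. \<exists>c. \<forall>i. ((\<lambda>\<alpha>. T (tail \<alpha>) i) \<longlongrightarrow> g i + c * (if i = \<omega>\<^sub>1 then 1 else 0)) (at_left \<omega>\<^sub>1)"
    using lim by metis
next
  fix w N T i
  assume w: "\<And>\<alpha>. w \<alpha> \<in> carr W" "\<And>j. ((\<lambda>\<alpha>. w \<alpha> j) \<longlongrightarrow> 0) (at_left \<omega>\<^sub>1)"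
    and T: "T \<in> bounded_operators W"
  obtain \<gamma> where \<gamma>: "\<gamma> < \<omega>\<^sub>1"
    "\<And>w. w \<in> carr W \<Longrightarrow> (\<forall>a\<le>\<gamma>. w a = 0) \<Longrightarrow> w \<omega>\<^sub>1 = 0 \<Longrightarrow> T w i = 0"
    using functional_vanishing[OF operator_coordinate_W[OF T, of i]] by blast
  \<comment> \<open>The value \<open>T (w \<alpha>) i\<close> is 0 as soon as
    \<open>w \<alpha>\<close> vanishes on these countably many coordinates, which happens eventually
    for all of them at once.\<close>
  have "{..\<gamma>} = insert \<gamma> {..<\<gamma>}"
    by auto
  then have "countable (insert \<omega>\<^sub>1 {..\<gamma>})"
    using countable_lessThan_if_less_omega1[OF \<gamma>(1)] by simp
  then have "\<forall>\<^sub>F \<alpha> in at_left \<omega>\<^sub>1. \<forall>j\<in>insert \<omega>\<^sub>1 {..\<gamma>}. w \<alpha> j = 0"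
    using w(2) by (intro eventually_countable_omega1) (simp_all add: tendsto_0_omega1_iff)
  then have "\<forall>\<^sub>F \<alpha> in at_left \<omega>\<^sub>1. T (w \<alpha>) i = 0"
    by eventually_elim (use \<gamma>(2) w(1) in auto)
  then show "((\<lambda>\<alpha>. T (w \<alpha>) i) \<longlongrightarrow> 0) (at_left \<omega>\<^sub>1)"
    by (rule tendsto_eventually)
qed (simp_all add: fun_eq_iff)

text \<open>The shift by \<open>1 + a\<close> and its left inverse, which are the identity on infinite ordinals.\<close>

definition pred_fin :: "ordinal \<Rightarrow> ordinal" where
  "pred_fin a = (if finite {..<a} \<and> {..<a} \<noteq> {} then Max {..<a} else a)"

definition suc_fin :: "ordinal \<Rightarrow> ordinal" where
  "suc_fin a = (if finite {..<a} then LEAST b. a < b else a)"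

lemma finite_less_omega1: "finite {..<a} \<Longrightarrow> a < \<omega>\<^sub>1"
proof (rule ccontr)
  assume "finite {..<a}" "\<not> a < \<omega>\<^sub>1"
  then have "finite {..<\<omega>\<^sub>1}"
    by (metis finite_subset lessThan_subset_iff not_less)
  then show False
    using uncountable_lessThan_omega1 countable_finite by blast
qed

lemma suc_fin:
  assumes "finite {..<a}"
  shows "a < suc_fin a" "{..<suc_fin a} = insert a {..<a}"
proof -
  have "\<exists>b. a < b"
    using finite_less_omega1[OF assms] by blast
  then show less: "a < suc_fin a"
    using assms unfolding suc_fin_def by (auto intro: LeastI)
  have "b \<le> a" if "b < suc_fin a" for b
    using not_less_Least[of b "\<lambda>b. a < b"] that assms by (auto simp: suc_fin_def not_less)
  then show "{..<suc_fin a} = insert a {..<a}"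
    using less by (auto simp: le_less)
qed

lemma pred_suc_fin: "pred_fin (suc_fin a) = a"
proof (cases "finite {..<a}")
  case True
  have "Max (insert a {..<a}) = a"
    using True by (intro Max_eqI) auto
  then show ?thesis
    using suc_fin(2)[OF True] True by (simp add: pred_fin_def)
next
  case False
  then show ?thesis
    by (simp add: suc_fin_def pred_fin_def)
qed

lemma finite_suc_fin: "finite {..<a} \<Longrightarrow> finite {..<suc_fin a}"
  by (simp add: suc_fin)

lemma finite_pred_fin:
  assumes "finite {..<a}"
  shows "finite {..<pred_fin a}"
proof (cases "{..<a} = {}")
  case False
  then have "pred_fin a \<in> {..<a}"
    using assms Max_in[OF assms False] by (simp add: pred_fin_def)
  then show ?thesis
    using assms by (auto intro: finite_subset[rotated])
next
  case True
  then show ?thesis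
    by (simp add: pred_fin_def)
qed

text \<open>Ordinals with finitely many predecessors are isolated and \<sigma> fixes the others, so
  continuity is at stake only at the first infinite ordinal. There \<open>lim\<close> applies:
  \<sigma> b exceeds any finite \<open>c\<close> once the finite \<open>b\<close> is large
  enough.\<close>

lemma composition_mem:
  assumes f: "f \<in> carr W"
    and inf: "\<And>a. infinite {..<a} \<Longrightarrow> \<sigma> a = a"
    and fin: "\<And>a. finite {..<a} \<Longrightarrow> finite {..<\<sigma> a}"
    and lim: "\<And>c. finite {..<c} \<Longrightarrow> \<exists>d. finite {..<d} \<and> (\<forall>b>d. finite {..<b} \<longrightarrow> c < \<sigma> b)"
  shows "(\<lambda>a. f (\<sigma> a)) \<in> carr W"
  unfolding mem_W_iff
proof (intro conjI allI impI)
  fix a assume "\<omega>\<^sub>1 < a"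
  then have "infinite {..<a}"
    using finite_less_omega1[of a] by (meson less_asym)
  then show "f (\<sigma> a) = 0"
    using inf \<open>\<omega>\<^sub>1 < a\<close> f by (simp add: mem_W_iff)
next
  fix a assume a: "a \<le> \<omega>\<^sub>1"
  show "left_continuous (\<lambda>a. f (\<sigma> a)) a"
  proof (cases "finite {..<a}")
    case True
    show ?thesis
    proof (cases "{..<a} = {}")
      case False
      let ?c = "Max {..<a}"
      have "?c < a"
        using Max_in[OF True False] by simp
      moreover have "b = a" if "?c < b" "b \<le> a" for b
        using that Max_ge[OF True, of b] by (auto simp: le_less)
      ultimately show ?thesis
        by (intro left_continuous_eventually_const[of ?c]) auto
    qed (auto simp: left_continuous_def)
  next
    case False
    have lc: "left_continuous f a"
      using f a by (simp add: mem_W_iff)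
    show ?thesis
      unfolding left_continuous_def
    proof (intro allI impI)
      fix e :: real and x assume "0 < e" "x < a"
      then obtain c where c: "c < a" "\<And>b. c < b \<Longrightarrow> b \<le> a \<Longrightarrow> dist (f b) (f a) < e"
        using left_continuousD[OF lc] by blast
      have fin_less: "b < a" if "finite {..<b}" for b
        using that False by (metis finite_subset lessThan_subset_iff not_less)
      \<comment> \<open>If \<open>c\<close> is infinite, so is every \<open>b\<close> beyond it, and
        \<sigma> fixes \<open>b\<close>; a new bound \<open>d\<close> matters only for finite
        \<open>c\<close>.\<close>
      obtain d where d: "d < a" "finite {..<c} \<longrightarrow> (\<forall>b>d. finite {..<b} \<longrightarrow> c < \<sigma> b)"
      proof (cases "finite {..<c}")
        case True
        then show ?thesis
          using lim[OF True] fin_less that by blast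
      next
        case False
        then show ?thesis
          using that[of c] c(1) by simp
      qed
      have "dist (f (\<sigma> b)) (f (\<sigma> a)) < e" if b: "max c d < b" "b \<le> a" for b
      proof (cases "finite {..<b}")
        case True
        then have "finite {..<c}"
          using b by (auto intro: finite_subset[rotated])
        then have "c < \<sigma> b"
          using d(2) True b by simp
        then show ?thesis
          using c(2)[of "\<sigma> b"] fin_less[OF fin[OF True]] inf[OF False] by simp
      next
        case False
        then show ?thesis
          using c(2)[of b] b inf[OF False] inf[OF \<open>infinite {..<a}\<close>] by simp
      qed
      then show "\<exists>c<a. \<forall>b. c < b \<longrightarrow> b \<le> a \<longrightarrow> dist (f (\<sigma> b)) (f (\<sigma> a)) < e"
        using c(1) d(1) by (intro exI[of _ "max c d"]) auto
    qed
  qed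
qed

lemma composition_operator:
  assumes mem: "\<And>f. f \<in> carr W \<Longrightarrow> (\<lambda>a. f (\<sigma> a)) \<in> carr W"
  shows "bounded_linear_on W W (\<lambda>f a. f (\<sigma> a))"
proof -
  have "nrm W (\<lambda>a. f (\<sigma> a)) \<le> 1 * nrm W f" if "f \<in> carr W" for f
    using cmod_le_nrm_W[OF that] by (intro nrm_W_le) simp
  then show ?thesis
    unfolding bounded_linear_on_def using mem by (auto simp: fun_eq_iff intro!: exI[of _ 1])
qed

text \<open>\<open>pred_fin\<close> sends 0 and 1 to 0, and \<open>suc_fin\<close> omits 0. Hence
  composition with \<open>suc_fin\<close> undoes composition with \<open>pred_fin\<close> and kills
  the indicator of the least ordinal.\<close>

lemma semadeni_extension:
  "\<exists>\<phi>. algebra_hom (\<B> W) (\<B> W) \<phi> \<and> continuous_map (ntop (\<B> W)) (ntop (\<B> W)) \<phi> \<and>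
    inj_on \<phi> (carr (\<B> W)) \<and> \<phi> (unt (\<B> W)) = unt (\<B> W) \<and>
    (\<forall>T. rank_one W T \<longrightarrow> rank_one W (\<phi> T)) \<and> \<phi> ` carr (\<B> W) \<noteq> carr (\<B> W)"
proof -
  obtain \<psi> where \<psi>: "character (\<B> W) \<psi>"
    using ex_character_W by blast
  have S: "bounded_linear_on W W (\<lambda>f a. f (pred_fin a))"
  proof (rule composition_operator, rule composition_mem)
    show "\<exists>d. finite {..<d} \<and> (\<forall>b>d. finite {..<b} \<longrightarrow> c < pred_fin b)" if c: "finite {..<c}" for c
    proof (intro exI[of _ "suc_fin c"] conjI allI impI)
      fix b assume b: "suc_fin c < b" "finite {..<b}"
      then have "suc_fin c \<le> pred_fin b"
        using Max_ge[OF b(2), of "suc_fin c"] by (auto simp: pred_fin_def)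
      then show "c < pred_fin b"
        using suc_fin(1)[OF c] by simp
    qed (rule finite_suc_fin[OF c])
  qed (simp_all add: finite_pred_fin, simp add: pred_fin_def)
  have L: "bounded_linear_on W W (\<lambda>f a. f (suc_fin a))"
  proof (rule composition_operator, rule composition_mem)
    show "\<exists>d. finite {..<d} \<and> (\<forall>b>d. finite {..<b} \<longrightarrow> c < suc_fin b)" if c: "finite {..<c}" for c
      using c suc_fin(1) by (intro exI[of _ c]) (auto intro: less_trans)
  qed (simp_all add: finite_suc_fin, simp add: suc_fin_def)
  define z :: ordinal where "z = (LEAST a. True)"
  have z: "z \<le> a" for a
    unfolding z_def by (rule Least_le) simp
  define w :: "ordinal \<Rightarrow> complex" where "w a = (if a = z then 1 else 0)" for a
  have z_less: "z < \<omega>\<^sub>1"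
    using ex_less_omega1 z le_less_trans by blast
  have wW: "w \<in> carr W"
    unfolding mem_W_iff
  proof (intro conjI allI impI)
    fix a
    show "left_continuous w a"
    proof (cases "a = z")
      case True
      then show ?thesis
        using z by (auto simp: left_continuous_def not_less[symmetric])
    next
      case False
      then show ?thesis
        using z[of a] by (intro left_continuous_eventually_const[of z]) (auto simp: w_def le_less)
    qed
  qed (use z_less in \<open>auto simp: w_def\<close>)
  show ?thesis
  proof (rule character_extension[OF banach_W normed_W \<psi> _ S L])
    \<comment> \<open>The function \<open>w\<close> vanishes at \<open>\<omega>\<^sub>1\<close> but
      not at \<open>z\<close>, while \<open>tail z\<close> is 1 at \<open>\<omega>\<^sub>1\<close>,
      so they are not multiples of one function.\<close>
    show "cdim W (carr W) \<noteq> 1"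
    proof
      assume "cdim W (carr W) = 1"
      then obtain x where x: "carr W = range (\<lambda>c. scl W c x)"
        using W.dim_eq_1_iff[OF W.subspace] by blast
      obtain c where "w = scl W c x"
        using x wW by auto
      then have "w z = c * x z" "w \<omega>\<^sub>1 = c * x \<omega>\<^sub>1"
        by simp_all
      moreover obtain d where "tail z = scl W d x"
        using x tail_mem[of z] by auto
      then have "tail z \<omega>\<^sub>1 = d * x \<omega>\<^sub>1"
        by simp
      moreover have "\<omega>\<^sub>1 \<noteq> z"
        using z_less by simp
      ultimately show False
        using z_less by (auto simp: w_def tail_def)
    qed
    show "w \<in> carr W"
      by (rule wW)
    show "w \<noteq> 0"
      by (auto simp: fun_eq_iff w_def)
    show "(\<lambda>a. w (suc_fin a)) = 0"
    proof
      fix a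
      have "suc_fin a \<noteq> z"
      proof (cases "finite {..<a}")
        case True
        then show ?thesis
          using suc_fin(1)[OF True] z[of a] by auto
      next
        case False
        have "{..<z} = {}"
          using z by (auto simp: not_less[symmetric])
        then show ?thesis
          using False by (auto simp: suc_fin_def)
      qed
      then show "w (suc_fin a) = 0 a"
        by (simp add: w_def)
    qed
  qed (simp add: pred_suc_fin)
qed

theorem proposition1p3:
  fixes X :: "'a::ab_group_add cnspace" and Z :: "'b::ab_group_add cnspace"
  shows
    "(complex_banach_space X \<and> cdim X (carr X) \<noteq> 1 \<and> (\<exists>\<psi>. character (\<B> X) \<psi>) \<and>
      complex_banach_space Z \<and> carr Z \<noteq> {0} \<longrightarrow>
        (\<exists>\<phi>. algebra_hom (\<B> X) (\<B> (direct_sum X Z)) \<phi> \<and>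
          continuous_map (ntop (\<B> X)) (ntop (\<B> (direct_sum X Z))) \<phi> \<and>
          inj_on \<phi> (carr (\<B> X)) \<and>
          \<phi> (unt (\<B> X)) = unt (\<B> (direct_sum X Z)) \<and>
          (\<forall>T. rank_one X T \<longrightarrow> rank_one (direct_sum X Z) (\<phi> T)) \<and>
          \<phi> ` carr (\<B> X) \<noteq> carr (\<B> (direct_sum X Z))))
     \<and>
     (\<forall>p::real. 1 < p \<longrightarrow>
        (\<exists>\<phi>. algebra_hom (\<B> (james_space p)) (\<B> (james_space p)) \<phi> \<and>
          continuous_map (ntop (\<B> (james_space p))) (ntop (\<B> (james_space p))) \<phi> \<and>
          inj_on \<phi> (carr (\<B> (james_space p))) \<and>
          \<phi> (unt (\<B> (james_space p))) = unt (\<B> (james_space p)) \<and>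
          (\<forall>T. rank_one (james_space p) T \<longrightarrow> rank_one (james_space p) (\<phi> T)) \<and>
          \<phi> ` carr (\<B> (james_space p)) \<noteq> carr (\<B> (james_space p))))
     \<and>
     (\<exists>\<phi>. algebra_hom (\<B> semadeni_space) (\<B> semadeni_space) \<phi> \<and>
        continuous_map (ntop (\<B> semadeni_space)) (ntop (\<B> semadeni_space)) \<phi> \<and>
        inj_on \<phi> (carr (\<B> semadeni_space)) \<and>
        \<phi> (unt (\<B> semadeni_space)) = unt (\<B> semadeni_space) \<and>
        (\<forall>T. rank_one semadeni_space T \<longrightarrow> rank_one semadeni_space (\<phi> T)) \<and>
        \<phi> ` carr (\<B> semadeni_space) \<noteq> carr (\<B> semadeni_space))"
proof (intro conjI impI allI; (elim conjE exE)?)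
  fix \<psi>
  assume "complex_banach_space X" "cdim X (carr X) \<noteq> 1" "character (\<B> X) \<psi>"
    "complex_banach_space Z" "carr Z \<noteq> {0}"
  then show "\<exists>\<phi>. algebra_hom (\<B> X) (\<B> (direct_sum X Z)) \<phi> \<and>
      continuous_map (ntop (\<B> X)) (ntop (\<B> (direct_sum X Z))) \<phi> \<and>
      inj_on \<phi> (carr (\<B> X)) \<and>
      \<phi> (unt (\<B> X)) = unt (\<B> (direct_sum X Z)) \<and>
      (\<forall>T. rank_one X T \<longrightarrow> rank_one (direct_sum X Z) (\<phi> T)) \<and>
      \<phi> ` carr (\<B> X) \<noteq> carr (\<B> (direct_sum X Z))"
    by (rule direct_sum_extension)
next
  fix p :: real
  assume "1 < p"
  then interpret james p
    by (rule james.intro)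
  show "\<exists>\<phi>. algebra_hom (\<B> J) (\<B> J) \<phi> \<and> continuous_map (ntop (\<B> J)) (ntop (\<B> J)) \<phi> \<and>
    inj_on \<phi> (carr (\<B> J)) \<and> \<phi> (unt (\<B> J)) = unt (\<B> J) \<and>
    (\<forall>T. rank_one J T \<longrightarrow> rank_one J (\<phi> T)) \<and> \<phi> ` carr (\<B> J) \<noteq> carr (\<B> J)"
    by (rule james_extension)
qed (rule semadeni_extension)

end
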